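(* Let $\mathtt b\ge2$ be an integer and $\mu$ a probability measure on $\mathbb N$ with $\sum_kk\mu(k)=1$. Let $\boldsymbol\tau^*=(\tau^*,\varrho)$ be an IPGW$^+(\mu)$-tree, let $\mathbf o=(U_k)_{k\le0}$ be i.i.d. uniform on $\{1,\dots,\mathtt b\}$ (viewed as an element of $\mathbb W^*_{\mathtt b}$ of height $0$), independent of $\boldsymbol\tau^*$, and, conditionally given $\boldsymbol\tau^*$ and $\mathbf o$, let $\boldsymbol\Theta=(\tau^*,\varrho;(X_v)_{v\in\tau^*})$ be the branching random walk on $\mathbb W^*_{\mathtt b}$ with kernel $p_{\mathtt b}$ indexed by $\tau^*$ with $X_\varrho=\mathbf o$. Then: (1) $\mathtt{scc}^+(\boldsymbol\Theta)$ has the same law as $\boldsymbol\Theta$; (2) letting $(v_n)_{n\ge0}$ enumerate in increasing lexicographical order the vertices $v$ of $\tau^*$ with $\varrho\le v$ (so $v_0=\varrho$), almost surely $$\tfrac1n\#\{X_{v_k};1\le k\le n\}\xrightarrow[n\to\infty]{}c_{\mu,\mathtt b}:=\mathbf P\big(\mathbf o\notin\{X_{v_n};n\ge1\}\big);$$ (3) if moreover $\sum_{k\ge1}k(\log k)^{1+\beta}\mu(k)<\infty$ for some $\beta\in(1,\infty)$, then $c_{\mu,\mathtt b}>0$.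
   Context: $\mathbb W^*_{\mathtt b}$: set of sequences $x=(a_k)_{k\le m}$, $m\in\mathbb Z$, $a_k\in\{1,\dots,\mathtt b\}$; $|x|=m$ is its height; its parent is $\overleftarrow x=(a_k)_{k\le m-1}$ and $x\ast(i)=(a_1',\dots)$ is the sequence $(a_k)_{k\le m}$ extended by $a_{m+1}=i$. Kernel $p_{\mathtt b}(x,\cdot)$: go to $\overleftarrow x$ w.p. $1/2$, to each $x\ast(i)$ w.p. $1/(2\mathtt b)$. Shift: $\varphi_l((a_k)_{k\le m})=(a_{k+l})_{k\le m-l}$. Pointed trees with infinite line of ancestors: a countable tree $t$ in which every vertex has a parent and finitely many children, the children being linearly ordered, and any two vertices have a most recent common ancestor; with a distinguished vertex $\varrho$. Lexicographical order on $t$: $u<v$ if $u$ is a strict ancestor of $v$, or if, letting $w$ be their most recent common ancestor and $u',v'$ the children of $w$ that are ancestors-or-equal of $u,v$, $u'$ precedes $v'$. Labelled pointed trees $(t,\varrho;(x_v))$ are identified up to bijections preserving parent relation, child order, distinguished vertex and labels. IPGW$^+(\mu)$: $\varrho$ has ancestors $\varrho(p)$, $p\ge1$ ($\varrho(p+1)$ parent of $\varrho(p)$, $\varrho(0)=\varrho$); for each $p\ge1$, $\varrho(p)$ has $k$ children with probability $\bar\mu(k)=\sum_{l\ge k}\mu(l)$, $k\ge1$, and $\varrho(p-1)$ is its first child; these numbers are independent; the subtree of descendants of $\varrho$ and the subtrees of descendants of the other children of the $\varrho(p)$ are independent Galton–Watson($\mu$) trees. Branching random walk indexed by $(t,\varrho)$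 started at $o$: $X_\varrho=o$ and for every finite connected subset containing $\varrho$ the labels have joint law $\delta_o\prod_{v\neq\varrho}p_{\mathtt b}(x_{v'},dx_v)$, where $v'$ is the neighbour of $v$ on the path from $v$ to $\varrho$. Right-successor: for a labelled pointed tree $\Theta=(t,\varrho;(x_v))$, let $\varrho'$ be the smallest vertex strictly larger than $\varrho$ in lexicographical order; relabel $x'_v=\varphi_{|x_{\varrho'}|}(x_v)$; restrict to the set of ancestors of $\varrho'$ together with all vertices $v\ge\varrho'$, with induced parent relation and child order. The result, pointed at $\varrho'$, is $\mathtt{scc}^+(\Theta)$. *)

theory Defs
  imports "HOL-Probability.Probability"
begin

text \<open>An element (a_k)_{k<=m} of W*_b is encoded canonically as the pair (m, f) where
  m :: int is the height and f j = a_{m-j} (j = 0,1,2,...).\<close>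

type_synonym wstar = "int \<times> (nat \<Rightarrow> nat)"

definition wparent :: "wstar \<Rightarrow> wstar" where
  "wparent x = (fst x - 1, \<lambda>j. snd x (Suc j))"

definition wchild :: "wstar \<Rightarrow> nat \<Rightarrow> wstar" where
  "wchild x i = (fst x + 1, case_nat i (snd x))"

definition wshift :: "int \<Rightarrow> wstar \<Rightarrow> wstar" where
  "wshift l x = (fst x - l, snd x)"

text \<open>One step of the kernel p_b driven by a move variable z:
  z = 0 means "go to the parent" (probability 1/2), z = i in 1..b means "go to x*(i)"
  (probability 1/(2b) each).\<close>
definition wmove :: "wstar \<Rightarrow> nat \<Rightarrow> wstar" where
  "wmove x z = (if z = 0 then wparent x else wchild x z)"

text \<open>A vertex is addressed by (p, w): it is the descendant of the ancestor rho(p) of the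
  distinguished vertex (rho(0) = rho) reached by the child-index path w (children numbered
  0,1,... in their order), where p is minimal, i.e. for p >= 1 the path w does not start
  with the index of rho(p-1).  In the trees considered, rho(p-1) is the first child (index 0)
  of rho(p), so canonical addresses (p,w) with p >= 1 have w = [] or hd w >= 1.\<close>

type_synonym addr = "nat \<times> nat list"

definition canon :: "addr \<Rightarrow> bool" where
  "canon a \<longleftrightarrow> fst a = 0 \<or> snd a = [] \<or> hd (snd a) \<noteq> 0"

text \<open>A labelled pointed tree: (vertex indicator, heights of labels, letters of labels);
  outside the vertex set the labels are normalised to 0.\<close>
type_synonym ltree = "(addr \<Rightarrow> bool) \<times> (addr \<Rightarrow> int) \<times> (addr \<Rightarrow> nat \<Rightarrow> nat)"

definition TM :: "ltree measure" where
  "TM = PiM UNIV (\<lambda>_. count_space UNIV) \<Otimes>\<^sub>M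
        (PiM UNIV (\<lambda>_. count_space UNIV) \<Otimes>\<^sub>M PiM UNIV (\<lambda>_. PiM UNIV (\<lambda>_. count_space UNIV)))"

definition encode :: "addr set \<Rightarrow> (addr \<Rightarrow> wstar) \<Rightarrow> ltree" where
  "encode V X = ((\<lambda>a. a \<in> V),
                 (\<lambda>a. if a \<in> V then fst (X a) else 0),
                 (\<lambda>a. if a \<in> V then snd (X a) else (\<lambda>_. 0)))"

text \<open>Path from rho(N) (N >= p) to the vertex (p,w).\<close>
definition gpath :: "nat \<Rightarrow> addr \<Rightarrow> nat list" where
  "gpath N a = replicate (N - fst a) 0 @ snd a"

definition lexlt :: "nat list \<Rightarrow> nat list \<Rightarrow> bool" where
  "lexlt xs ys \<longleftrightarrow> (\<exists>zs. zs \<noteq> [] \<and> ys = xs @ zs) \<or>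
     (\<exists>k. k < length xs \<and> k < length ys \<and> take k xs = take k ys \<and> xs ! k < ys ! k)"

definition addr_less :: "addr \<Rightarrow> addr \<Rightarrow> bool" where
  "addr_less u v \<longleftrightarrow> lexlt (gpath (max (fst u) (fst v)) u) (gpath (max (fst u) (fst v)) v)"

definition addr_sanc :: "addr \<Rightarrow> addr \<Rightarrow> bool" where
  "addr_sanc u v \<longleftrightarrow> (\<exists>zs. zs \<noteq> [] \<and>
      gpath (max (fst u) (fst v)) v = gpath (max (fst u) (fst v)) u @ zs)"

definition root :: addr where "root = (0, [])"

definition lt_succ :: "(addr \<Rightarrow> bool) \<Rightarrow> addr \<Rightarrow> addr" where
  "lt_succ P r = (SOME v. P v \<and> addr_less r v \<and>
      (\<forall>u. P u \<and> addr_less r u \<longrightarrow> u = v \<or> addr_less v u))"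

definition gdecode :: "nat \<Rightarrow> nat list \<Rightarrow> addr" where
  "gdecode N g = (let z = length (takeWhile (\<lambda>x. x = 0) g) in
     if N \<le> z then (0, drop N g) else (N - z, drop z g))"

text \<open>The old vertex corresponding to the canonical address a in the tree re-pointed at r':
  go q = fst a generations up from r' (to the vertex at depth length g' - q below rho(N)),
  then down along snd a, where at that ancestor the child indices are renumbered so that the
  child towards r' gets index 0 (the children on its left being removed).\<close>
definition scc_old :: "addr \<Rightarrow> addr \<Rightarrow> addr" where
  "scc_old r' a = (let q = fst a; u = snd a; N = fst r' + q; g' = gpath N r';
                       c = length g' - q in
     gdecode N (if q = 0 then g' @ u
                else (case u of [] \<Rightarrow> take c g' | i # u' \<Rightarrow> take c g' @ [g' ! c + i] @ u')))"

definition scc :: "ltree \<Rightarrow> ltree" where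
  "scc T = (let P = fst T; H = fst (snd T); L = snd (snd T); r' = lt_succ P root;
     P' = (\<lambda>a. canon a \<and> P (scc_old r' a) \<and>
              (addr_sanc (scc_old r' a) r' \<or> scc_old r' a = r' \<or> addr_less r' (scc_old r' a)))
   in (P',
       (\<lambda>a. if P' a then fst (wshift (H r') (H (scc_old r' a), L (scc_old r' a))) else 0),
       (\<lambda>a. if P' a then snd (wshift (H r') (H (scc_old r' a), L (scc_old r' a))) else (\<lambda>_. 0))))"

definition enum_from :: "(addr \<Rightarrow> bool) \<Rightarrow> nat \<Rightarrow> addr" where
  "enum_from P n = (THE v. P v \<and> (v = root \<or> addr_less root v) \<and>
      finite {u. P u \<and> (u = root \<or> addr_less root u) \<and> addr_less u v} \<and>
      card {u. P u \<and> (u = root \<or> addr_less root u) \<and> addr_less u v} = n)"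

definition gw_set :: "(nat list \<Rightarrow> nat) \<Rightarrow> nat list set" where
  "gw_set N = {w. \<forall>k<length w. w ! k < N (take k w)}"

text \<open>IPGW+ vertex set: K p = number of children of rho(p) (p >= 1), rho(p-1) its first child;
  xi a = offspring numbers generating the GW subtrees.\<close>
definition ipgw_set :: "(nat \<Rightarrow> nat) \<Rightarrow> (addr \<Rightarrow> nat) \<Rightarrow> addr set" where
  "ipgw_set K xi = {(p, w). (p = 0 \<and> w \<in> gw_set (\<lambda>u. xi (0, u))) \<or> (1 \<le> p \<and> w = []) \<or>
      (1 \<le> p \<and> w \<noteq> [] \<and> 1 \<le> hd w \<and> hd w < K p \<and> tl w \<in> gw_set (\<lambda>u. xi (p, hd w # u)))}"

fun anc_lab :: "(addr \<Rightarrow> nat) \<Rightarrow> wstar \<Rightarrow> nat \<Rightarrow> wstar" where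
  "anc_lab Z x0 0 = x0"
| "anc_lab Z x0 (Suc p) = wmove (anc_lab Z x0 p) (Z (Suc p, []))"

fun walk :: "(addr \<Rightarrow> nat) \<Rightarrow> nat \<Rightarrow> nat list \<Rightarrow> wstar \<Rightarrow> nat list \<Rightarrow> wstar" where
  "walk Z p u x [] = x"
| "walk Z p u x (i # w) = walk Z p (u @ [i]) (wmove x (Z (p, u @ [i]))) w"

text \<open>Label of vertex a: each vertex v other than rho moves from the label of its neighbour
  towards rho using its own move variable Z v.\<close>
definition brw_lab :: "(addr \<Rightarrow> nat) \<Rightarrow> wstar \<Rightarrow> addr \<Rightarrow> wstar" where
  "brw_lab Z x0 a = walk Z (fst a) [] (anc_lab Z x0 (fst a)) (snd a)"

text \<open>Independent sources: SK p = number of children of rho(p), SXi a = GW offspring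
  numbers, SU j = letter a_{-j} of the starting point o, SZ a = move variable of vertex a.\<close>
datatype src = SK nat | SXi addr | SU nat | SZ addr

definition src_V :: "(src \<Rightarrow> 'a \<Rightarrow> nat) \<Rightarrow> 'a \<Rightarrow> addr set" where
  "src_V S \<omega> = ipgw_set (\<lambda>p. S (SK p) \<omega>) (\<lambda>a. S (SXi a) \<omega>)"

definition src_o :: "(src \<Rightarrow> 'a \<Rightarrow> nat) \<Rightarrow> 'a \<Rightarrow> wstar" where
  "src_o S \<omega> = (0, \<lambda>j. S (SU j) \<omega>)"

definition src_X :: "(src \<Rightarrow> 'a \<Rightarrow> nat) \<Rightarrow> 'a \<Rightarrow> addr \<Rightarrow> wstar" where
  "src_X S \<omega> = brw_lab (\<lambda>a. S (SZ a) \<omega>) (src_o S \<omega>)"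

definition theta :: "(src \<Rightarrow> 'a \<Rightarrow> nat) \<Rightarrow> 'a \<Rightarrow> ltree" where
  "theta S \<omega> = encode (src_V S \<omega>) (src_X S \<omega>)"

definition src_enum :: "(src \<Rightarrow> 'a \<Rightarrow> nat) \<Rightarrow> 'a \<Rightarrow> nat \<Rightarrow> addr" where
  "src_enum S \<omega> = enum_from (\<lambda>a. a \<in> src_V S \<omega>)"

end

theory Submission
  imports Defs
begin

text \<open>
  All sources together live on a product space. Re-pointing the labelled tree at the lexicographical
  successor is realised by a map \<open>Succ\<close> of the sources: it re-indexes them, reverses the edge
  that is crossed (which preserves the law, the letters of the starting point being uniform), and
  turns an offspring number \<open>k \<ge> 1\<close> of the root, or a number \<open>k + 1\<close> of children of the first
  branching ancestor, into the number \<open>k\<close> of children of the new parent. Since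
  \<open>\<mu>(k) + \<mu>{k+1..} = \<mu>{k..}\<close>, \<open>Succ\<close> preserves the product measure, which gives the invariance in law.

  The number of distinct labels among the first \<open>n\<close> vertices is squeezed between Birkhoff sums, along
  \<open>Succ\<close>, of the indicators that the label of the root is not repeated, respectively not repeated
  within the next \<open>m\<close> vertices. By the maximal ergodic inequality it is enough to see that upper and
  lower densities are almost surely constant. They do not change when finitely many vertices are removed,
  hence (critical trees being finite) are invariant under moving the root one step up the spine;
  such an event is a function of the starting point alone, is then shift invariant, and
  so has probability 0 or 1.

  For positivity, the function \<open>b\<^sup>-\<^sup>m\<close> of the depth \<open>m\<close> of the confluence with the starting
  point is superharmonic and dominates the Green function up to a factor 4. Along the spine \<open>m\<close> grows almost like the
  square root of the number of steps, while the moment condition keeps the logarithm of the number of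
  children of the ancestors below a smaller power; a first moment bound for the bushes
  far up the spine, together with the absence of bushes below, gives a positive probability of no return.
\<close>

subsection \<open>Measure preserving maps and product spaces\<close>

text \<open>Ergodicity of \<open>Succ\<close> itself is never shown. The zero-one law needs a map
  that drops sources for good at each step, and \<open>Succ\<close> does not: going down to a child
  keeps the edge just crossed as the move of the new ancestor. \<open>Spine\<close> does drop
  sources, and densities do not feel the finite part that it replaces. If \<mu> is the point mass at
  1, that part is an infinite ray; this case is split off and uses a map \<open>Line\<close> going
  down the ray.

  The condition s = 1 + \<beta> > 2 on the exponent of the logarithm comes from blocks of ancestors
  with index between 4^j and 4^(j+1). There the confluence should have depth at least 2 L_j, and no
  ancestor more than 2^(L_j) children. With L_j about a^j, the failure of the first is summable if a
  < 2; the second fails with probability of order 4^j L_j^(-s), which is summable if a^s > 4. Some a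
  satisfies both because s > 2.

  The potential depends on the starting point, so positivity is proved for a fixed starting point
  with a uniform bound, and integrated afterwards.\<close>

lemma measurable_iter [measurable]:
  "T \<in> M \<rightarrow>\<^sub>M M \<Longrightarrow> (T ^^ n) \<in> M \<rightarrow>\<^sub>M M"
  by (induction n) (auto intro: measurable_comp)

lemma distr_iter:
  assumes [measurable]: "T \<in> M \<rightarrow>\<^sub>M M" and "distr M M T = M"
  shows "distr M M (T ^^ n) = M"
proof (induction n)
  case 0
  then show ?case using distr_id2[of M M] by (simp add: id_def)
next
  case (Suc n)
  have "distr M M (T ^^ Suc n) = distr (distr M M (T ^^ n)) M T"
    by (subst distr_distr) auto
  also have "\<dots> = M" using Suc assms by simp
  finally show ?case .
qed

lemma AE_iter_invariant:
  assumes [measurable]: "T \<in> M \<rightarrow>\<^sub>M M" and "distr M M T = M" and "AE x in M. Q x"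
  shows "AE x in M. \<forall>n. Q ((T ^^ n) x)"
proof (subst AE_all_countable, rule allI)
  fix n
  show "AE x in M. Q ((T ^^ n) x)"
    by (rule AE_distrD[OF measurable_iter[OF assms(1)]]) (subst distr_iter[OF assms(1,2)], rule assms(3))
qed

text \<open>Garsia's argument. Where the running maximum \<open>g (Suc n)\<close> is positive,
  \<open>f x\<close> equals \<open>g (Suc n) x - g n (T x)\<close>, hence is at least
  \<open>g (Suc n) x - g (Suc n) (T x)\<close>, a difference of integral 0 which is nonpositive
  elsewhere. By \<open>pos\<close> the sets where the maximum is positive exhaust the space up to a
  null set.\<close>

lemma (in prob_space) maximal_ergodic:
  fixes f :: "'a \<Rightarrow> real"
  assumes T [measurable]: "T \<in> M \<rightarrow>\<^sub>M M" and TM: "distr M M T = M"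
    and f [measurable]: "f \<in> borel_measurable M" and bd: "\<And>x. \<bar>f x\<bar> \<le> B"
    and pos: "AE x in M. \<exists>n. (\<Sum>i<n. f ((T ^^ i) x)) > 0"
  shows "(\<integral>x. f x \<partial>M) \<ge> 0"
proof -
  \<comment> \<open>Unwound, \<open>g n x\<close> is the maximum of the Birkhoff sums of length at
    most \<open>n\<close>, the empty one included.\<close>
  define g where "g = rec_nat (\<lambda>x::'a. 0::real) (\<lambda>n g x. max 0 (f x + g (T x)))"
  have g0: "g 0 x = 0" and gS: "g (Suc n) x = max 0 (f x + g n (T x))" for n x
    by (auto simp: g_def)
  have [measurable]: "g n \<in> borel_measurable M" for n
  proof (induction n)
    case 0 then show ?case by (simp add: g0[abs_def])
  next
    case (Suc n)
    then have [measurable]: "g n \<in> borel_measurable M" .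
    show ?case unfolding gS[abs_def] by measurable
  qed
  have gnn: "g n x \<ge> 0" for n x by (cases n) (auto simp: g0 gS)
  have gmono: "g n x \<le> g (Suc n) x" for n x
  proof (induction n arbitrary: x)
    case 0 then show ?case by (simp add: g0 gnn)
  next
    case (Suc n)
    then show ?case unfolding gS[of "Suc n"] gS[of n] by (simp add: max.coboundedI2 max.mono)
  qed
  have gub: "g n x \<le> of_nat n * B" for n x
  proof (induction n arbitrary: x)
    case 0 then show ?case by (simp add: g0)
  next
    case (Suc n)
    have "f x \<le> B" "B \<ge> 0" using bd[of x] by auto
    then show ?case using Suc[of "T x"] by (auto simp: gS algebra_simps)
  qed
  have gS_ge: "g n x \<ge> (\<Sum>i<n. f ((T ^^ i) x))" for n x
  proof (induction n arbitrary: x)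
    case 0 then show ?case by (simp add: g0)
  next
    case (Suc n)
    have "(\<Sum>i<Suc n. f ((T ^^ i) x)) = f x + (\<Sum>i<n. f ((T ^^ i) (T x)))"
      by (subst sum.lessThan_Suc_shift) (simp add: funpow_swap1)
    then show ?case using Suc[of "T x"] by (auto simp: gS)
  qed
  have intg: "integrable M (g n)" for n
    by (rule integrable_const_bound[where B="of_nat n * B"]) (use gub gnn in auto)
  have intgT: "integrable M (\<lambda>x. g n (T x))" for n
    by (rule integrable_const_bound[where B="of_nat n * B"]) (use gub gnn in auto)
  have eqT: "(\<integral>x. g n (T x) \<partial>M) = (\<integral>x. g n x \<partial>M)" for n
    using integral_distr[OF T, of "g n"] TM by simp
  let ?h = "\<lambda>n x. f x * indicator {x. g (Suc n) x > 0} x"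
  have ge: "(\<integral>x. ?h n x \<partial>M) \<ge> 0" for n
  proof -
    have "(\<integral>x. g (Suc n) x - g (Suc n) (T x) \<partial>M) \<le> (\<integral>x. ?h n x \<partial>M)"
    proof (rule integral_mono)
      show "integrable M (\<lambda>x. g (Suc n) x - g (Suc n) (T x))"
        by (intro Bochner_Integration.integrable_diff intg intgT)
      show "integrable M (?h n)"
        by (rule integrable_const_bound[where B=B])
          (use bd in \<open>auto simp: indicator_def intro: order_trans[OF abs_ge_zero bd]\<close>)
      fix x
      show "g (Suc n) x - g (Suc n) (T x) \<le> ?h n x"
        using gmono[of n "T x"] gnn[of "Suc n" "T x"] gnn[of "Suc n" x]
        by (auto simp: indicator_def gS[of n x])
    qed
    then show ?thesis
      by (subst (asm) Bochner_Integration.integral_diff) (auto simp: intg intgT eqT)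
  qed
  have "(\<lambda>n. \<integral>x. ?h n x \<partial>M) \<longlonglongrightarrow> (\<integral>x. f x \<partial>M)"
  proof (rule integral_dominated_convergence[where w="\<lambda>_. B"])
    show "AE x in M. (\<lambda>n. ?h n x) \<longlonglongrightarrow> f x"
      using pos
    proof eventually_elim
      case (elim x)
      then obtain n where n: "(\<Sum>i<n. f ((T ^^ i) x)) > 0" by auto
      then have "g n x > 0" using gS_ge[of x n] by linarith
      moreover have "g n x \<le> g (Suc m) x" if "m \<ge> n" for m
        by (rule lift_Suc_mono_le[where f="\<lambda>n. g n x"]) (use gmono that in auto)
      ultimately have "?h m x = f x" if "m \<ge> n" for m
        using that by (fastforce simp: indicator_def dest: less_le_trans)
      then have "eventually (\<lambda>m. ?h m x = f x) sequentially"
        unfolding eventually_sequentially by blast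
      then show ?case by (rule tendsto_eventually)
    qed
  qed (use bd in \<open>auto simp: indicator_def intro: order_trans[OF abs_ge_zero bd]\<close>)
  then show ?thesis by (rule LIMSEQ_le_const) (use ge in auto)
qed

text \<open>To be read with \<open>g\<close> a conditional probability of \<open>A\<close>: if far
  iterates of the invariant event \<open>A\<close> decouple from approximations \<open>C\<close> of
  \<open>A\<close>, then the identity forces \<open>g = 1\<close> almost everywhere on
  \<open>A\<close>. Used with \<open>g\<close> the conditional probability given the letters, and
  then with the constant \<open>prob A'\<close>.\<close>

lemma (in prob_space) prob_eq_integral_of_approximation:
  assumes T [measurable]: "T \<in> M \<rightarrow>\<^sub>M M" and TM: "distr M M T = M"
    and A [measurable]: "A \<in> sets M" and inv: "AE x in M. x \<in> A \<longleftrightarrow> T x \<in> A"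
    and g [measurable]: "g \<in> borel_measurable M" and g01: "\<And>x. 0 \<le> g x \<and> g x \<le> (1::real)"
    and approx: "\<And>e. e > 0 \<Longrightarrow> \<exists>C\<in>sets M. prob ((A - C) \<union> (C - A)) < e \<and>
      (\<exists>p. prob (C \<inter> {x\<in>space M. (T ^^ p) x \<in> A}) = (\<integral>x. indicator C x * g ((T ^^ p) x) \<partial>M))"
  shows "prob A = (\<integral>x. indicator A x * g x \<partial>M)"
proof (rule antisym)
  have int: "integrable M (\<lambda>x. indicator C x * g ((T ^^ p) x))" if [measurable]: "C \<in> sets M" for C p
    by (rule integrable_const_bound[where B=1]) (use g01 in \<open>auto simp: indicator_def\<close>)
  have ii: "integrable M (indicator C :: 'a \<Rightarrow> real)" if "C \<in> sets M" for C
    using that by (intro integrable_real_indicator) (auto simp: less_top[symmetric])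
  have "(\<integral>x. indicator A x * g x \<partial>M) \<le> (\<integral>x. indicator A x \<partial>M)"
    by (rule integral_mono) (use int[OF A, of 0] g01 in \<open>auto simp: mult_left_le less_top[symmetric] intro!: integrable_real_indicator\<close>)
  then show "(\<integral>x. indicator A x * g x \<partial>M) \<le> prob A" by simp
  have invn: "AE x in M. x \<in> A \<longleftrightarrow> (T ^^ n) x \<in> A" for n
    using AE_iter_invariant[OF T TM inv]
  proof eventually_elim
    case (elim x)
    show ?case by (induction n) (use elim in auto)
  qed
  show "prob A \<le> (\<integral>x. indicator A x * g x \<partial>M)"
  proof (rule field_le_epsilon)
    fix e :: real assume "e > 0"
    then obtain C p where C [measurable]: "C \<in> sets M" and e: "prob ((A - C) \<union> (C - A)) < e / 2"
      and p: "prob (C \<inter> {x\<in>space M. (T ^^ p) x \<in> A}) = (\<integral>x. indicator C x * g ((T ^^ p) x) \<partial>M)"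
      using approx[of "e/2"] by auto
    let ?D = "(A - C) \<union> (C - A)"
    \<comment> \<open>Invariance lets \<open>A\<close> be intersected with its own p-fold preimage;
      one of the two copies is then exchanged for \<open>C\<close> and back, each time at cost
      \<open>e/2\<close>.\<close>
    have "prob A = prob (A \<inter> {x\<in>space M. (T ^^ p) x \<in> A})"
      by (rule finite_measure_eq_AE) (use invn[of p] in \<open>auto simp: Int_def\<close>)
    also have "\<dots> \<le> prob ((C \<inter> {x\<in>space M. (T ^^ p) x \<in> A}) \<union> ?D)"
      by (rule finite_measure_mono) auto
    also have "\<dots> \<le> prob (C \<inter> {x\<in>space M. (T ^^ p) x \<in> A}) + prob ?D"
      by (rule measure_Un_le) auto
    also have "\<dots> \<le> (\<integral>x. indicator C x * g ((T ^^ p) x) \<partial>M) + e/2"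
      using p e by simp
    also have "(\<integral>x. indicator C x * g ((T ^^ p) x) \<partial>M) \<le>
       (\<integral>x. indicator A x * g ((T ^^ p) x) + indicator ?D x \<partial>M)"
    proof (rule integral_mono)
      show "integrable M (\<lambda>x. indicator A x * g ((T ^^ p) x) + indicator ?D x)"
        by (intro Bochner_Integration.integrable_add int ii) auto
    qed (use int g01 in \<open>auto simp: indicator_def\<close>)
    also have "\<dots> = (\<integral>x. indicator A x * g ((T ^^ p) x) \<partial>M) + prob ?D"
      by (subst Bochner_Integration.integral_add) (use int ii in auto)
    also have "(\<integral>x. indicator A x * g ((T ^^ p) x) \<partial>M) = (\<integral>x. indicator A ((T ^^ p) x) * g ((T ^^ p) x) \<partial>M)"
      by (rule integral_cong_AE) (use invn[of p] in \<open>auto simp: indicator_def\<close>)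
    also have "\<dots> = (\<integral>x. indicator A x * g x \<partial>distr M M (T ^^ p))"
      by (subst integral_distr) auto
    also have "\<dots> = (\<integral>x. indicator A x * g x \<partial>M)" using distr_iter[OF T TM] by simp
    finally show "prob A \<le> (\<integral>x. indicator A x * g x \<partial>M) + e" using e by simp
  qed
qed

section \<open>Products of countable laws: independence by splicing two samples\<close>

definition dep_on :: "'i set \<Rightarrow> ('i \<Rightarrow> nat) set \<Rightarrow> bool" where
  "dep_on J A \<longleftrightarrow> (\<forall>\<omega> \<omega>'. (\<forall>j\<in>J. \<omega> j = \<omega>' j) \<longrightarrow> (\<omega> \<in> A \<longleftrightarrow> \<omega>' \<in> A))"

text \<open>Splicing two independent samples again gives the law \<open>Pr\<close>
  (\<open>mix_law\<close>), so integrating over \<omega>' with \<omega> fixed plays the role of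
  conditioning on the coordinates in \<open>J\<close>, without splitting the product space.\<close>

definition mix :: "'i set \<Rightarrow> ('i \<Rightarrow> nat) \<Rightarrow> ('i \<Rightarrow> nat) \<Rightarrow> 'i \<Rightarrow> nat" where
  "mix J \<omega> \<omega>' = (\<lambda>i. if i \<in> J then \<omega> i else \<omega>' i)"

lemma dep_onD: "dep_on J A \<Longrightarrow> (\<And>j. j \<in> J \<Longrightarrow> \<omega> j = \<omega>' j) \<Longrightarrow> \<omega> \<in> A \<longleftrightarrow> \<omega>' \<in> A"
  unfolding dep_on_def by blast

lemma dep_on_mono: "dep_on J A \<Longrightarrow> J \<subseteq> K \<Longrightarrow> dep_on K A"
  unfolding dep_on_def by blast

locale pmf_prod =
  fixes law :: "'i \<Rightarrow> nat pmf"
begin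

definition Pr :: "('i \<Rightarrow> nat) measure" where
  "Pr = PiM UNIV (\<lambda>i. measure_pmf (law i))"

sublocale PP: product_prob_space "\<lambda>i. measure_pmf (law i)" UNIV
  by (unfold_locales)

sublocale prob_space Pr
  unfolding Pr_def by (rule PP.prob_space_axioms)

lemma space_Pr [simp]: "space Pr = UNIV"
  by (simp add: Pr_def space_PiM)

lemma sets_Pr: "sets Pr = sets (PiM UNIV (\<lambda>_. count_space UNIV))"
  unfolding Pr_def by (rule sets_PiM_cong) auto

lemma Collect_in_sets [measurable (raw)]: "Measurable.pred Pr Q \<Longrightarrow> Collect Q \<in> sets Pr"
  by (simp add: pred_def)

lemma measurable_coord [measurable]: "(\<lambda>\<omega>. \<omega> i) \<in> Pr \<rightarrow>\<^sub>M count_space UNIV"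
  unfolding Pr_def
  using measurable_component_singleton[of i UNIV "\<lambda>i. measure_pmf (law i)"]
  by (simp cong: measurable_cong_sets)

lemma measurable_into_Pr:
  assumes "\<And>i. (\<lambda>x. f x i) \<in> N \<rightarrow>\<^sub>M count_space UNIV"
  shows "f \<in> N \<rightarrow>\<^sub>M Pr"
proof -
  have "f \<in> N \<rightarrow>\<^sub>M PiM UNIV (\<lambda>_. count_space UNIV)"
    by (rule measurable_PiM_single') (use assms in \<open>auto\<close>)
  then show ?thesis using measurable_cong_sets[OF refl sets_Pr] by blast
qed

lemma sets_Collect_fin [measurable]: "finite J \<Longrightarrow> {\<omega>. \<forall>j\<in>J. \<omega> j \<in> F j} \<in> sets Pr"
  using sets.sets_Collect_finite_All'[of J Pr "\<lambda>j \<omega>. \<omega> j \<in> F j"]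
  by (cases "J = {}") (use measurable_sets[OF measurable_coord] in \<open>auto simp: vimage_def sets.top[of Pr, simplified]\<close>)

lemma emeasure_cyl: "finite J \<Longrightarrow> emeasure Pr {\<omega>. \<forall>j\<in>J. \<omega> j \<in> F j} = (\<Prod>j\<in>J. emeasure (law j) (F j))"
  using PP.emeasure_PiM_Collect[of J F] unfolding Pr_def[symmetric] by simp

lemma prob_cyl: "finite J \<Longrightarrow> prob {\<omega>. \<forall>j\<in>J. \<omega> j \<in> F j} = (\<Prod>j\<in>J. measure_pmf.prob (law j) (F j))"
  using emeasure_cyl[of J F] unfolding emeasure_eq_measure measure_pmf.emeasure_eq_measure
  by (simp add: prod_ennreal prod_nonneg)

lemma prob_cyl1: "prob {\<omega>. \<omega> j \<in> F} = measure_pmf.prob (law j) F"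
  using prob_cyl[of "{j}" "\<lambda>_. F"] by simp

lemma prob_cyl_eq: "finite J \<Longrightarrow> prob {\<omega>. \<forall>j\<in>J. \<omega> j = s j} = (\<Prod>j\<in>J. pmf (law j) (s j))"
  using prob_cyl[of J "\<lambda>j. {s j}"] by (simp add: measure_pmf_single)

lemma AE_coord: "(\<And>k. k \<in> set_pmf (law j) \<Longrightarrow> Q k) \<Longrightarrow> AE \<omega> in Pr. Q (\<omega> j)"
  unfolding Pr_def by (rule PP.AE_component) (auto simp: AE_measure_pmf_iff)

text \<open>Coordinates are countable, so a cylinder is a countable disjoint union of point
  cylinders, and these need only be checked over a cofinal family of finite index sets. The freedom
  in the choice of the family serves \<open>exch\<close> (letters form an initial segment) and
  \<open>Succ\<close> (the set contains \<open>SK 1\<close>).\<close>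

lemma Pr_eqI:
  assumes N: "prob_space N" "sets N = sets Pr"
    and cof: "\<And>J0. finite J0 \<Longrightarrow> \<exists>J. J0 \<subseteq> J \<and> finite J \<and>
      (\<forall>s. measure N {\<omega>. \<forall>j\<in>J. \<omega> j = s j} = (\<Prod>j\<in>J. pmf (law j) (s j)))"
  shows "N = Pr"
proof -
  interpret N: prob_space N by fact
  have [simp]: "space N = UNIV" using sets_eq_imp_space_eq[OF N(2)] by simp
  show ?thesis unfolding Pr_def
  proof (rule PP.PiM_eq)
    show "sets N = sets (PiM UNIV (\<lambda>i. measure_pmf (law i)))" using N(2) unfolding Pr_def .
    fix J0 :: "'i set" and F :: "'i \<Rightarrow> nat set" assume J0: "finite J0"
    obtain J where J: "J0 \<subseteq> J" "finite J" and
      eq: "\<And>s. measure N {\<omega>. \<forall>j\<in>J. \<omega> j = s j} = (\<Prod>j\<in>J. pmf (law j) (s j))"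
      using cof[OF J0] by blast
    define F' where "F' j = (if j \<in> J0 then F j else UNIV)" for j
    define E where "E s = {\<omega>. \<forall>j\<in>J. \<omega> j = s j}" for s :: "'i \<Rightarrow> nat"
    have ev: "{\<omega>. \<forall>j\<in>J0. \<omega> j \<in> F j} = (\<Union>s\<in>PiE J F'. E s)"
    proof safe
      fix \<omega> assume "\<forall>j\<in>J0. \<omega> j \<in> F j"
      then show "\<omega> \<in> (\<Union>s\<in>PiE J F'. E s)"
        by (intro UN_I[of "restrict \<omega> J"]) (auto simp: F'_def E_def)
    next
      fix \<omega> s j assume "s \<in> PiE J F'" "\<omega> \<in> E s" "j \<in> J0"
      then show "\<omega> j \<in> F j" using J by (auto simp: E_def F'_def PiE_iff dest!: subsetD)
    qed
    have cnt: "countable (PiE J F')" by (rule countable_PiE) (use J in auto)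
    have disj: "disjoint_family_on E (PiE J F')"
      unfolding disjoint_family_on_def E_def
    proof safe
      fix s t \<omega> assume *: "s \<in> PiE J F'" "t \<in> PiE J F'" "\<forall>j\<in>J. \<omega> j = s j" "\<forall>j\<in>J. \<omega> j = t j" "s \<noteq> t"
      have "s = t" by (rule PiE_ext[OF *(1,2)]) (use * in auto)
      with * show "\<omega> \<in> {}" by auto
    qed
    have meas: "E s \<in> sets Pr" for s
      unfolding E_def using sets_Collect_fin[of J "\<lambda>j. {s j}"] J by simp
    have eqE: "emeasure N (E s) = emeasure Pr (E s)" for s
      using eq[of s] prob_cyl_eq[OF J(2), of s]
      by (simp add: emeasure_eq_measure N.emeasure_eq_measure E_def)
    have "emeasure N {\<omega>. \<forall>j\<in>J0. \<omega> j \<in> F j} = emeasure Pr {\<omega>. \<forall>j\<in>J0. \<omega> j \<in> F j}"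
      unfolding ev by (subst (1 2) emeasure_UN_countable) (use cnt disj meas eqE N(2) in auto)
    then have *: "emeasure N {\<omega>. \<forall>j\<in>J0. \<omega> j \<in> F j} = (\<Prod>j\<in>J0. emeasure (law j) (F j))"
      using emeasure_cyl[OF J0] by simp
    have "prod_emb UNIV (\<lambda>i. measure_pmf (law i)) J0 (PiE J0 F) = {\<omega>. \<forall>j\<in>J0. \<omega> j \<in> F j}"
      by (auto simp: prod_emb_def PiE_iff)
    with * show "emeasure N (prod_emb UNIV (\<lambda>i. measure_pmf (law i)) J0 (PiE J0 F)) =
      (\<Prod>j\<in>J0. emeasure (law j) (F j))" by simp
  qed
qed

lemma measurable_mix [measurable]: "(\<lambda>(\<omega>, \<omega>'). mix J \<omega> \<omega>') \<in> Pr \<Otimes>\<^sub>M Pr \<rightarrow>\<^sub>M Pr"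
proof (rule measurable_into_Pr)
  fix i
  have "(\<lambda>x. (case x of (\<omega>, \<omega>') \<Rightarrow> mix J \<omega> \<omega>') i) = (if i \<in> J then (\<lambda>x. fst x i) else (\<lambda>x. snd x i))"
    by (auto simp: mix_def)
  then show "(\<lambda>x. (case x of (\<omega>, \<omega>') \<Rightarrow> mix J \<omega> \<omega>') i) \<in> Pr \<Otimes>\<^sub>M Pr \<rightarrow>\<^sub>M count_space UNIV"
    by auto
qed

lemma measurable_mix1 [measurable]: "mix J \<omega> \<in> Pr \<rightarrow>\<^sub>M Pr"
  using measurable_compose[OF measurable_Pair1' measurable_mix, of \<omega> J] by simp

lemma mix_law: "distr (Pr \<Otimes>\<^sub>M Pr) Pr (\<lambda>(\<omega>, \<omega>'). mix J \<omega> \<omega>') = Pr"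
proof (rule Pr_eqI)
  interpret PQ: pair_prob_space Pr Pr ..
  show "prob_space (distr (Pr \<Otimes>\<^sub>M Pr) Pr (\<lambda>(\<omega>, \<omega>'). mix J \<omega> \<omega>'))"
    by (rule PQ.prob_space_distr) measurable
  fix K :: "'i set" assume K: "finite K"
  have "measure (distr (Pr \<Otimes>\<^sub>M Pr) Pr (\<lambda>(\<omega>, \<omega>'). mix J \<omega> \<omega>')) {\<omega>. \<forall>j\<in>K. \<omega> j = s j} = (\<Prod>j\<in>K. pmf (law j) (s j))" for s
  proof -
    have m1: "{\<omega>. \<forall>j\<in>K. \<omega> j = s j} \<in> sets Pr"
      using sets_Collect_fin[of K "\<lambda>j. {s j}"] K by simp
    have m2: "{\<omega>. \<forall>j\<in>K\<inter>J. \<omega> j = s j} \<in> sets Pr" "{\<omega>. \<forall>j\<in>K-J. \<omega> j = s j} \<in> sets Pr"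
      using sets_Collect_fin[of "K\<inter>J" "\<lambda>j. {s j}"] sets_Collect_fin[of "K-J" "\<lambda>j. {s j}"] K by simp_all
    have "(\<lambda>(\<omega>, \<omega>'). mix J \<omega> \<omega>') -` {\<omega>. \<forall>j\<in>K. \<omega> j = s j} \<inter> space (Pr \<Otimes>\<^sub>M Pr) =
      {\<omega>. \<forall>j\<in>K\<inter>J. \<omega> j = s j} \<times> {\<omega>. \<forall>j\<in>K-J. \<omega> j = s j}"
      by (auto simp: mix_def space_pair_measure)
    then have "measure (distr (Pr \<Otimes>\<^sub>M Pr) Pr (\<lambda>(\<omega>, \<omega>'). mix J \<omega> \<omega>')) {\<omega>. \<forall>j\<in>K. \<omega> j = s j} =
      measure (Pr \<Otimes>\<^sub>M Pr) ({\<omega>. \<forall>j\<in>K\<inter>J. \<omega> j = s j} \<times> {\<omega>. \<forall>j\<in>K-J. \<omega> j = s j})"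
      by (subst measure_distr) (use m1 in auto)
    also have "\<dots> = prob {\<omega>. \<forall>j\<in>K\<inter>J. \<omega> j = s j} * prob {\<omega>. \<forall>j\<in>K-J. \<omega> j = s j}"
      using emeasure_pair_measure_Times[OF m2]
      by (simp add: measure_def enn2real_mult)
    also have "\<dots> = (\<Prod>j\<in>K\<inter>J. pmf (law j) (s j)) * (\<Prod>j\<in>K-J. pmf (law j) (s j))"
      using K by (subst (1 2) prob_cyl_eq) auto
    also have "\<dots> = (\<Prod>j\<in>K. pmf (law j) (s j))"
      by (subst prod.union_disjoint[symmetric]) (use K in \<open>auto intro!: prod.cong\<close>)
    finally show ?thesis .
  qed
  then show "\<exists>J'. K \<subseteq> J' \<and> finite J' \<and> (\<forall>s. measure (distr (Pr \<Otimes>\<^sub>M Pr) Pr (\<lambda>(\<omega>, \<omega>'). mix J \<omega> \<omega>')) {\<omega>. \<forall>j\<in>J'. \<omega> j = s j} =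
     (\<Prod>j\<in>J'. pmf (law j) (s j)))"
    using K by blast
qed simp

lemma nn_integral_mix:
  assumes [measurable]: "f \<in> borel_measurable Pr"
  shows "(\<integral>\<^sup>+\<omega>. f \<omega> \<partial>Pr) = (\<integral>\<^sup>+\<omega>. \<integral>\<^sup>+\<omega>'. f (mix J \<omega> \<omega>') \<partial>Pr \<partial>Pr)"
proof -
  have "(\<integral>\<^sup>+\<omega>. f \<omega> \<partial>Pr) = (\<integral>\<^sup>+\<omega>. f \<omega> \<partial>distr (Pr \<Otimes>\<^sub>M Pr) Pr (\<lambda>(\<omega>, \<omega>'). mix J \<omega> \<omega>'))"
    by (simp add: mix_law)
  also have "\<dots> = (\<integral>\<^sup>+x. f (case x of (\<omega>, \<omega>') \<Rightarrow> mix J \<omega> \<omega>') \<partial>(Pr \<Otimes>\<^sub>M Pr))"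
    by (rule nn_integral_distr) measurable
  also have "\<dots> = (\<integral>\<^sup>+\<omega>. \<integral>\<^sup>+\<omega>'. f (mix J \<omega> \<omega>') \<partial>Pr \<partial>Pr)"
    by (subst nn_integral_fst[symmetric]) auto
  finally show ?thesis .
qed

lemma emeasure_mix:
  assumes [measurable]: "A \<in> sets Pr"
  shows "emeasure Pr A = (\<integral>\<^sup>+\<omega>. emeasure Pr {\<omega>'. mix J \<omega> \<omega>' \<in> A} \<partial>Pr)"
proof -
  have [measurable]: "{\<omega>'. mix J \<omega> \<omega>' \<in> A} \<in> sets Pr" for \<omega>
    using measurable_sets[OF measurable_mix1 assms, of J \<omega>] by (simp add: vimage_def)
  have "emeasure Pr A = (\<integral>\<^sup>+\<omega>. indicator A \<omega> \<partial>Pr)" by simp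
  also have "\<dots> = (\<integral>\<^sup>+\<omega>. \<integral>\<^sup>+\<omega>'. indicator A (mix J \<omega> \<omega>') \<partial>Pr \<partial>Pr)"
    by (rule nn_integral_mix) auto
  also have "\<dots> = (\<integral>\<^sup>+\<omega>. \<integral>\<^sup>+\<omega>'. indicator {\<omega>'. mix J \<omega> \<omega>' \<in> A} \<omega>' \<partial>Pr \<partial>Pr)"
    by (simp add: indicator_def)
  also have "\<dots> = (\<integral>\<^sup>+\<omega>. emeasure Pr {\<omega>'. mix J \<omega> \<omega>' \<in> A} \<partial>Pr)"
    by (subst nn_integral_indicator) auto
  finally show ?thesis .
qed

lemma prob_Int_dep:
  assumes A [measurable]: "A \<in> sets Pr" and B [measurable]: "B \<in> sets Pr"
    and dA: "dep_on J A" and dB: "dep_on K B" and JK: "J \<inter> K = {}"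
  shows "prob (A \<inter> B) = prob A * prob B"
proof -
  have *: "{\<omega>'. mix J \<omega> \<omega>' \<in> A \<inter> B} = (if \<omega> \<in> A then B else {})" for \<omega>
  proof -
    have "mix J \<omega> \<omega>' \<in> A \<longleftrightarrow> \<omega> \<in> A" for \<omega>'
      by (rule dep_onD[OF dA]) (auto simp: mix_def)
    moreover have "mix J \<omega> \<omega>' \<in> B \<longleftrightarrow> \<omega>' \<in> B" for \<omega>'
      by (rule dep_onD[OF dB]) (use JK in \<open>auto simp: mix_def\<close>)
    ultimately show ?thesis by auto
  qed
  have "emeasure Pr (A \<inter> B) = (\<integral>\<^sup>+\<omega>. emeasure Pr B * indicator A \<omega> \<partial>Pr)"
    by (subst emeasure_mix[where J=J]) (auto simp: *[simplified] indicator_def intro!: nn_integral_cong)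
  also have "\<dots> = emeasure Pr B * emeasure Pr A"
    by (subst nn_integral_cmult_indicator) auto
  finally show ?thesis by (simp add: measure_def enn2real_mult mult.commute)
qed

text \<open>The events that can be approximated contain the one-coordinate events and are closed
  under complements and countable unions.\<close>

lemma approx_finite_dim:
  assumes "A \<in> sets Pr" "e > 0"
  shows "\<exists>C\<in>sets Pr. \<exists>J. finite J \<and> dep_on J C \<and> prob ((A - C) \<union> (C - A)) < e"
proof -
  let ?G = "{{f. f i \<in> X} | i X. True} :: ('i \<Rightarrow> nat) set set"
  have eqs: "sets Pr = sigma_sets UNIV ?G"
    unfolding Pr_def sets_PiM_single by simp
  have "A \<in> sigma_sets UNIV ?G" using assms eqs by simp
  then show ?thesis using \<open>e > 0\<close>
  proof (induction arbitrary: e rule: sigma_sets.induct)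
    case (Basic a)
    then obtain i X where a: "a = {f. f i \<in> X}" by auto
    have "a \<in> sets Pr" unfolding eqs using Basic by blast
    then show ?case using Basic(2) by (intro bexI[of _ a] exI[of _ "{i}"]) (auto simp: a dep_on_def)
  next
    case Empty
    then show ?case by (intro bexI[of _ "{}"] exI[of _ "{}"]) (auto simp: dep_on_def)
  next
    case (Compl a)
    then obtain C J where C: "C \<in> sets Pr" "finite J" "dep_on J C" "prob ((a - C) \<union> (C - a)) < e"
      by blast
    have "((UNIV - a - (UNIV - C)) \<union> (UNIV - C - (UNIV - a))) = (a - C) \<union> (C - a)" by auto
    then show ?case using C sets.compl_sets[OF C(1)]
      by (intro bexI[of _ "UNIV - C"] exI[of _ J]) (auto simp: dep_on_def)
  next
    case (Union a)
    have a [measurable]: "a i \<in> sets Pr" for i using Union(1) eqs by auto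
    have "(\<lambda>n. prob (\<Union>i<n. a i)) \<longlonglongrightarrow> prob (\<Union>n. \<Union>i<n. a i)"
      by (rule finite_Lim_measure_incseq) (auto simp: incseq_def intro: order_less_le_trans)
    moreover have "(\<Union>n. \<Union>i<n. a i) = (\<Union>i. a i)" by blast
    ultimately have "eventually (\<lambda>n. prob (\<Union>i<n. a i) > prob (\<Union>i. a i) - e/2) sequentially"
      using order_tendstoD(1)[of _ "prob (\<Union>i. a i)" sequentially "prob (\<Union>i. a i) - e/2"] Union(3) by simp
    then obtain n where n: "prob (\<Union>i<n. a i) > prob (\<Union>i. a i) - e/2"
      by (auto simp: eventually_sequentially)
    \<comment> \<open>Truncating the union at \<open>n\<close> costs less than \<open>e/2\<close>;
      the \<open>n\<close> errors of this size add up to at most \<open>e/2\<close>.\<close>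
    have e': "e / (2 * (real n + 1)) > 0" using Union(3) by simp
    obtain C J where C: "\<And>i. C i \<in> sets Pr" "\<And>i. finite (J i)" "\<And>i. dep_on (J i) (C i)"
      "\<And>i. prob ((a i - C i) \<union> (C i - a i)) < e / (2 * (real n + 1))"
      using Union(2)[OF e'] by metis
    note [measurable] = C(1)
    let ?C = "\<Union>i<n. C i"
    let ?D = "\<lambda>i. (a i - C i) \<union> (C i - a i)"
    have "((\<Union>i. a i) - ?C) \<union> (?C - (\<Union>i. a i)) \<subseteq> ((\<Union>i. a i) - (\<Union>i<n. a i)) \<union> (\<Union>i<n. ?D i)"
      by blast
    then have "prob (((\<Union>i. a i) - ?C) \<union> (?C - (\<Union>i. a i))) \<le> prob (((\<Union>i. a i) - (\<Union>i<n. a i)) \<union> (\<Union>i<n. ?D i))"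
      by (rule finite_measure_mono) auto
    also have "\<dots> \<le> prob ((\<Union>i. a i) - (\<Union>i<n. a i)) + prob (\<Union>i<n. ?D i)"
      by (rule measure_Un_le) auto
    also have "prob ((\<Union>i. a i) - (\<Union>i<n. a i)) = prob (\<Union>i. a i) - prob (\<Union>i<n. a i)"
      by (rule finite_measure_Diff) auto
    also have "prob (\<Union>i<n. ?D i) \<le> (\<Sum>i<n. prob (?D i))"
      by (rule finite_measure_subadditive_finite) auto
    also have "\<dots> \<le> (\<Sum>i<n. e / (2 * (real n + 1)))"
      by (rule sum_mono) (use C(4) in \<open>auto intro: less_imp_le\<close>)
    also have "\<dots> \<le> e/2" using Union(3) by (simp add: field_simps)
    finally have "prob (((\<Union>i. a i) - ?C) \<union> (?C - (\<Union>i. a i))) < e" using n by linarith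
    moreover have "dep_on (\<Union>i<n. J i) ?C"
    proof -
      have "dep_on (\<Union>i<n. J i) (C i)" if "i < n" for i
        by (rule dep_on_mono[OF C(3)]) (use that in auto)
      then show ?thesis unfolding dep_on_def by blast
    qed
    ultimately show ?case
      by (intro bexI[of _ ?C] exI[of _ "\<Union>i<n. J i"]) (use C(2) in auto)
  qed
qed

end

subsection \<open>Re-rooting the sources\<close>

text \<open>The sources on which the labelled tree depends. The others are given a point mass, so that
  re-indexings need to be injective on the relevant sources only.\<close>

definition used :: "src set" where
  "used = {s. case s of SK p \<Rightarrow> 1 \<le> p | SXi a \<Rightarrow> fst a = 0 \<or> (snd a \<noteq> [] \<and> hd (snd a) \<noteq> 0)
     | SU j \<Rightarrow> True | SZ a \<Rightarrow> canon a \<and> a \<noteq> root}"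

lemma used_simps [simp]:
  "SK p \<in> used \<longleftrightarrow> 1 \<le> p" "SU j \<in> used"
  "SXi (p, w) \<in> used \<longleftrightarrow> p = 0 \<or> (w \<noteq> [] \<and> hd w \<noteq> 0)"
  "SZ (p, w) \<in> used \<longleftrightarrow> (p = 0 \<and> w \<noteq> []) \<or> (p \<ge> 1 \<and> (w = [] \<or> hd w \<noteq> 0))"
  by (auto simp: used_def canon_def root_def)

text \<open>Reversal of the edge from the starting point to the neighbour reached by the move \<open>SZ a\<close>:
  the starting point becomes that neighbour, and \<open>SZ a\<close> becomes the move leading back.\<close>

definition exch :: "addr \<Rightarrow> (src \<Rightarrow> nat) \<Rightarrow> src \<Rightarrow> nat" where
  "exch a \<omega> = (\<lambda>s. case s of
      SU j \<Rightarrow> if \<omega> (SZ a) = 0 then \<omega> (SU (Suc j)) else case_nat (\<omega> (SZ a)) (\<lambda>j. \<omega> (SU j)) j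
    | SZ a' \<Rightarrow> if a' = a then (if \<omega> (SZ a) = 0 then \<omega> (SU 0) else 0) else \<omega> (SZ a')
    | SK p \<Rightarrow> \<omega> (SK p) | SXi a' \<Rightarrow> \<omega> (SXi a'))"

lemma exch_simps [simp]:
  "exch a \<omega> (SK p) = \<omega> (SK p)" "exch a \<omega> (SXi a') = \<omega> (SXi a')"
  "exch a \<omega> (SZ a') = (if a' = a then (if \<omega> (SZ a) = 0 then \<omega> (SU 0) else 0) else \<omega> (SZ a'))"
  "exch a \<omega> (SU j) = (if \<omega> (SZ a) = 0 then \<omega> (SU (Suc j)) else case_nat (\<omega> (SZ a)) (\<lambda>j. \<omega> (SU j)) j)"
  by (auto simp: exch_def)

definition reindex :: "(src \<Rightarrow> src) \<Rightarrow> (src \<Rightarrow> nat) \<Rightarrow> src \<Rightarrow> nat" where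
  "reindex f \<omega> = (\<lambda>s. if s \<in> used then \<omega> (f s) else 0)"

text \<open>Each index map sends a source of the new configuration to the old source from which it
  is read. Here the root moves to its first child: the old root becomes the first ancestor, and its
  offspring number the new \<open>SK 1\<close>.\<close>

fun push_ix :: "src \<Rightarrow> src" where
  "push_ix (SK p) = (if p = 1 then SXi (0, []) else SK (p - 1))"
| "push_ix (SXi (p, w)) = (if p = 0 then SXi (0, 0 # w) else SXi (p - 1, w))"
| "push_ix (SU j) = SU j"
| "push_ix (SZ (p, w)) = (if p = 0 then SZ (0, 0 # w) else if p = 1 \<and> w = [] then SZ (0, [0]) else SZ (p - 1, w))"

text \<open>The root moves to the child of index 1 of the first ancestor. The branch of index 0,
  which held the old root, is discarded, and the later siblings move down by one index.\<close>

fun repl_ix :: "src \<Rightarrow> src" where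
  "repl_ix (SK p) = SK p"
| "repl_ix (SXi (p, w)) = (if p = 0 then SXi (1, 1 # w) else if p = 1 then SXi (1, Suc (hd w) # tl w) else SXi (p, w))"
| "repl_ix (SU j) = SU j"
| "repl_ix (SZ (p, w)) = (if p = 0 then SZ (1, 1 # w) else if p = 1 then (if w = [] then SZ (1, [1]) else SZ (1, Suc (hd w) # tl w))
     else SZ (p, w))"

text \<open>The spine is renumbered from the first ancestor on. The tree below the new root is not
  the one below the old first ancestor: its sources are borrowed from the branch of index 1, which
  keeps the law. \<open>Repl\<close> discards that tree, and the densities ignore it when it is
  finite.\<close>

fun spine_ix :: "src \<Rightarrow> src" where
  "spine_ix (SK p) = SK (Suc p)"
| "spine_ix (SXi (p, w)) = (if p = 0 then SXi (1, 1 # w) else SXi (Suc p, w))"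
| "spine_ix (SU j) = SU j"
| "spine_ix (SZ (p, w)) = (if p = 0 then SZ (1, 1 # w) else SZ (Suc p, w))"

definition Push :: "(src \<Rightarrow> nat) \<Rightarrow> src \<Rightarrow> nat" where
  "Push \<omega> = reindex push_ix (exch (0, [0]) \<omega>)"

text \<open>The two exchanges carry the starting point from the root to the first ancestor and on to
  its child of index 1; \<open>SK 1\<close> drops by one for the discarded branch.\<close>

definition Repl :: "(src \<Rightarrow> nat) \<Rightarrow> src \<Rightarrow> nat" where
  "Repl \<omega> = (let \<omega>' = reindex repl_ix (exch (1, [1]) (exch (1, []) \<omega>)) in \<omega>'(SK 1 := \<omega>' (SK 1) - 1))"

definition Spine :: "(src \<Rightarrow> nat) \<Rightarrow> src \<Rightarrow> nat" where
  "Spine \<omega> = reindex spine_ix (exch (1, []) \<omega>)"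

definition pop_n :: "(src \<Rightarrow> nat) \<Rightarrow> nat" where
  "pop_n \<omega> = (LEAST n. 2 \<le> \<omega> (SK (Suc n)))"

definition Pop :: "(src \<Rightarrow> nat) \<Rightarrow> src \<Rightarrow> nat" where
  "Pop \<omega> = Repl ((Spine ^^ pop_n \<omega>) \<omega>)"

definition Succ :: "(src \<Rightarrow> nat) \<Rightarrow> src \<Rightarrow> nat" where
  "Succ \<omega> = (if 1 \<le> \<omega> (SXi (0, [])) then Push \<omega> else Pop \<omega>)"

lemma inj_push_ix: "inj_on push_ix used"
proof (rule inj_onI)
  fix s t assume "s \<in> used" "t \<in> used" "push_ix s = push_ix t"
  then show "s = t"
    by (cases s rule: push_ix.cases; cases t rule: push_ix.cases) (auto split: if_splits)
qed

lemma inj_spine_ix: "inj_on spine_ix used"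
proof (rule inj_onI)
  fix s t assume "s \<in> used" "t \<in> used" "spine_ix s = spine_ix t"
  then show "s = t"
    by (cases s rule: push_ix.cases; cases t rule: push_ix.cases) (auto split: if_splits)
qed

lemma inj_repl_ix: "inj_on repl_ix used"
proof (rule inj_onI)
  fix s t assume "s \<in> used" "t \<in> used" "repl_ix s = repl_ix t"
  then show "s = t"
    by (cases s rule: push_ix.cases; cases t rule: push_ix.cases)
      (auto split: if_splits simp: neq_Nil_conv)
qed

locale brw_law =
  fixes b :: nat and \<mu> klaw :: "nat pmf"
  assumes b2: "b \<ge> 2" and mean: "((\<lambda>k. real k * pmf \<mu> k) has_sum 1) UNIV"
    and klaw: "\<And>k. pmf klaw k = (if 1 \<le> k then measure_pmf.prob \<mu> {k..} else 0)"
begin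

definition ulaw :: "nat pmf" where "ulaw = pmf_of_set {1..b}"

definition zlaw :: "nat pmf" where
  "zlaw = bind_pmf (bernoulli_pmf (1/2)) (\<lambda>c. if c then return_pmf 0 else ulaw)"

definition law :: "src \<Rightarrow> nat pmf" where
  "law s = (if s \<in> used then case s of SK _ \<Rightarrow> klaw | SXi _ \<Rightarrow> \<mu> | SU _ \<Rightarrow> ulaw | SZ _ \<Rightarrow> zlaw
     else return_pmf 0)"

sublocale pmf_prod law .

lemma pmf_ulaw: "pmf ulaw k = (if 1 \<le> k \<and> k \<le> b then 1 / real b else 0)"
  using b2 by (auto simp: ulaw_def indicator_def)

lemma pmf_zlaw: "pmf zlaw k = (if k = 0 then 1/2 else if k \<le> b then 1 / (2 * real b) else 0)"
  by (simp add: zlaw_def pmf_bind pmf_ulaw)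

lemma set_ulaw: "set_pmf ulaw = {1..b}"
  using b2 by (simp add: ulaw_def)

lemma set_zlaw: "set_pmf zlaw = {..b}"
  using b2 by (auto simp: set_pmf_iff pmf_zlaw split: if_splits)

lemma law_simps [simp]:
  "s \<notin> used \<Longrightarrow> law s = return_pmf 0"
  "1 \<le> p \<Longrightarrow> law (SK p) = klaw"
  "SXi a \<in> used \<Longrightarrow> law (SXi a) = \<mu>"
  "SZ a \<in> used \<Longrightarrow> law (SZ a) = zlaw"
  "law (SU j) = ulaw"
  by (auto simp: law_def)

lemma measurable_reindex [measurable]: "reindex f \<in> Pr \<rightarrow>\<^sub>M Pr"
  by (rule measurable_into_Pr) (auto simp: reindex_def)

lemma measurable_exch [measurable]: "exch a \<in> Pr \<rightarrow>\<^sub>M Pr"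
proof (rule measurable_into_Pr)
  fix s show "(\<lambda>\<omega>. exch a \<omega> s) \<in> Pr \<rightarrow>\<^sub>M count_space UNIV"
  proof (cases s)
    case (SU j)
    then show ?thesis by (cases j) simp_all
  qed auto
qed

lemma measurable_fun_upd [measurable]:
  assumes [measurable]: "f \<in> N \<rightarrow>\<^sub>M Pr" "g \<in> N \<rightarrow>\<^sub>M count_space UNIV"
  shows "(\<lambda>x. (f x)(s := g x)) \<in> N \<rightarrow>\<^sub>M Pr"
  by (rule measurable_into_Pr) (auto simp: fun_upd_def)

lemma measurable_Push [measurable]: "Push \<in> Pr \<rightarrow>\<^sub>M Pr"
  unfolding Push_def[abs_def] by measurable

lemma measurable_Spine [measurable]: "Spine \<in> Pr \<rightarrow>\<^sub>M Pr"
  unfolding Spine_def[abs_def] by measurable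

lemma measurable_Repl [measurable]: "Repl \<in> Pr \<rightarrow>\<^sub>M Pr"
  unfolding Repl_def[abs_def] Let_def by measurable

lemma measurable_pop_n [measurable]: "pop_n \<in> Pr \<rightarrow>\<^sub>M count_space UNIV"
  unfolding pop_n_def[abs_def] by measurable

lemma measurable_Pop [measurable]: "Pop \<in> Pr \<rightarrow>\<^sub>M Pr"
proof -
  have "(\<lambda>\<omega>. (\<lambda>n \<omega>. Repl ((Spine ^^ n) \<omega>)) (pop_n \<omega>) \<omega>) \<in> Pr \<rightarrow>\<^sub>M Pr"
    by (rule measurable_compose_countable) measurable
  then show ?thesis unfolding Pop_def[abs_def] .
qed

lemma measurable_Succ [measurable]: "Succ \<in> Pr \<rightarrow>\<^sub>M Pr"
  unfolding Succ_def[abs_def] by measurable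

text \<open>Laws are evaluated at \<open>f j\<close>, not at \<open>j\<close>, because
  \<open>push_ix\<close> does not respect them at \<open>SK 1\<close>, which it reads from an
  offspring number.\<close>

lemma prob_reindex_cyl:
  assumes J: "finite J" and inj: "inj_on f used"
  shows "prob {\<omega>. \<forall>j\<in>J. reindex f \<omega> j = s j} =
    (\<Prod>j\<in>J. if j \<in> used then pmf (law (f j)) (s j) else of_bool (s j = 0))"
proof (cases "\<exists>j\<in>J - used. s j \<noteq> 0")
  case True
  then have "{\<omega>. \<forall>j\<in>J. reindex f \<omega> j = s j} = {}" by (auto simp: reindex_def)
  moreover have "(\<Prod>j\<in>J. if j \<in> used then pmf (law (f j)) (s j) else of_bool (s j = 0)) = 0"
    using True J by auto
  ultimately show ?thesis by (simp only: measure_empty)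
next
  case False
  define t where "t i = s (the_inv_into used f i)" for i
  have t: "t (f j) = s j" if "j \<in> used" for j
    unfolding t_def using the_inv_into_f_f[OF inj that] by simp
  have "{\<omega>. \<forall>j\<in>J. reindex f \<omega> j = s j} = {\<omega>. \<forall>i\<in>f ` (J \<inter> used). \<omega> i = t i}"
    using False t by (auto simp: reindex_def)
  also have "prob \<dots> = (\<Prod>i\<in>f ` (J \<inter> used). pmf (law i) (t i))"
    by (rule prob_cyl_eq) (use J in auto)
  also have "\<dots> = (\<Prod>j\<in>J \<inter> used. pmf (law (f j)) (s j))"
    by (subst prod.reindex) (use inj t in \<open>auto intro: inj_on_subset\<close>)
  also have "\<dots> = (\<Prod>j\<in>J. if j \<in> used then pmf (law (f j)) (s j) else of_bool (s j = 0))"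
    using J False by (intro prod.mono_neutral_cong_left) auto
  finally show ?thesis .
qed

lemma distr_reindex:
  assumes inj: "inj_on f used" and eq: "\<And>s. s \<in> used \<Longrightarrow> law (f s) = law s"
  shows "distr Pr Pr (reindex f) = Pr"
proof (rule Pr_eqI)
  show "prob_space (distr Pr Pr (reindex f))" by (rule prob_space_distr) measurable
  fix J :: "src set" assume J: "finite J"
  have "measure (distr Pr Pr (reindex f)) {\<omega>. \<forall>j\<in>J. \<omega> j = s j} = (\<Prod>j\<in>J. pmf (law j) (s j))" for s
  proof -
    have "{\<omega>. \<forall>j\<in>J. \<omega> j = s j} \<in> sets Pr" using sets_Collect_fin[OF J, of "\<lambda>j. {s j}"] by simp
    then have "measure (distr Pr Pr (reindex f)) {\<omega>. \<forall>j\<in>J. \<omega> j = s j} = prob {\<omega>. \<forall>j\<in>J. reindex f \<omega> j = s j}"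
      by (subst measure_distr) (auto simp: vimage_def)
    also have "\<dots> = (\<Prod>j\<in>J. pmf (law j) (s j))"
      unfolding prob_reindex_cyl[OF J inj] by (rule prod.cong) (auto simp: eq)
    finally show ?thesis .
  qed
  then show "\<exists>J'. J \<subseteq> J' \<and> finite J' \<and>
    (\<forall>s. measure (distr Pr Pr (reindex f)) {\<omega>. \<forall>j\<in>J'. \<omega> j = s j} = (\<Prod>j\<in>J'. pmf (law j) (s j)))"
    using J by blast
qed simp

lemma AE_U: "AE \<omega> in Pr. \<forall>j. 1 \<le> \<omega> (SU j) \<and> \<omega> (SU j) \<le> b"
  unfolding AE_all_countable by (auto intro!: AE_coord simp: set_ulaw)

text \<open>Detailed balance: a move to the parent together with first letter u has weight
  (1/2)(1/b), a move to the child u has weight 1/(2b). The exchange swaps these two situations and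
  moves the remaining i.i.d. letters by one place.\<close>

lemma distr_exch:
  assumes a: "SZ a \<in> used"
  shows "distr Pr Pr (exch a) = Pr"
proof (rule Pr_eqI)
  show "prob_space (distr Pr Pr (exch a))" by (rule prob_space_distr) measurable
  fix J0 :: "src set" assume J0: "finite J0"
  define K where "K = J0 - (range SU \<union> {SZ a})"
  have K: "finite K" "SZ a \<notin> K" "\<And>j. SU j \<notin> K" using J0 by (auto simp: K_def)
  have "finite (SU -` J0)" by (rule finite_vimageI[OF J0]) (auto simp: inj_on_def)
  then obtain n where n: "\<And>j. SU j \<in> J0 \<Longrightarrow> j \<le> n"
    by (auto simp: finite_nat_set_iff_bounded_le)
  \<comment> \<open>When the letters form an initial segment, preimages of cylinders are, up to null
    sets, cylinders of the same kind with one letter fewer or one more.\<close>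
  define JJ where "JJ m = K \<union> {SZ a} \<union> SU ` {..<m}" for m
  have JJ: "finite (JJ m)" for m using K by (auto simp: JJ_def)
  have prodJJ: "(\<Prod>j\<in>JJ m. f j) = (\<Prod>j\<in>K. f j) * f (SZ a) * (\<Prod>j<m. f (SU j))" for m and f :: "src \<Rightarrow> real"
  proof -
    have "(\<Prod>j\<in>JJ m. f j) = (\<Prod>j\<in>K \<union> {SZ a}. f j) * (\<Prod>j\<in>SU ` {..<m}. f j)"
      unfolding JJ_def by (rule prod.union_disjoint) (use K in auto)
    also have "(\<Prod>j\<in>SU ` {..<m}. f j) = (\<Prod>j<m. f (SU j))"
      by (subst prod.reindex) (auto simp: inj_on_def)
    also have "(\<Prod>j\<in>K \<union> {SZ a}. f j) = (\<Prod>j\<in>K. f j) * f (SZ a)"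
      by (subst prod.union_disjoint) (use K in auto)
    finally show ?thesis .
  qed
  have exK: "exch a \<omega> j = \<omega> j" if "j \<in> K" for j \<omega>
    using that K by (cases j) auto
  have meas: "{\<omega>. \<forall>j\<in>JJ m. \<omega> j = s j} \<in> sets Pr" for m s
    using sets_Collect_fin[OF JJ, of m "\<lambda>j. {s j}"] by simp
  have meas': "{\<omega>. \<forall>j\<in>JJ m. exch a \<omega> j = s j} \<in> sets Pr" for m s
    using measurable_sets[OF measurable_exch meas, of a m s] by (simp add: vimage_def)
  have main: "prob {\<omega>. \<forall>j\<in>JJ (Suc n). exch a \<omega> j = s j} = (\<Prod>j\<in>JJ (Suc n). pmf (law j) (s j))" for s
  proof (cases "s (SZ a) = 0")
    case s0: True
    show ?thesis
    proof (cases "s (SU 0) = 0")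
      case True
      \<comment> \<open>Letters are almost surely nonzero, so after the exchange the move and the
        first letter are not both 0.\<close>
      have "AE \<omega> in Pr. \<omega> \<notin> {\<omega>. \<forall>j\<in>JJ (Suc n). exch a \<omega> j = s j}"
        using AE_U
      proof eventually_elim
        case (elim \<omega>)
        have "SZ a \<in> JJ (Suc n)" "SU 0 \<in> JJ (Suc n)" by (auto simp: JJ_def)
        moreover have "\<not> (exch a \<omega> (SZ a) = 0 \<and> exch a \<omega> (SU 0) = 0)"
          using elim[rule_format, of 0] by auto
        ultimately show ?case using s0 True by (metis (mono_tags, lifting) mem_Collect_eq)
      qed
      then have "prob {\<omega>. \<forall>j\<in>JJ (Suc n). exch a \<omega> j = s j} = prob {}"
        by (intro finite_measure_eq_AE) (use meas' in auto)
      moreover have "(\<Prod>j<Suc n. pmf (law (SU j)) (s (SU j))) = 0"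
        by (rule prod_zero) (use True in \<open>auto simp: pmf_ulaw intro!: bexI[of _ 0]\<close>)
      ultimately show ?thesis unfolding prodJJ by simp
    next
      case False
      \<comment> \<open>The old move was towards the child given by the new first letter; the old
        letters are the new ones without the first.\<close>
      define t where "t j = (case j of SZ a' \<Rightarrow> if a' = a then s (SU 0) else s j | SU j \<Rightarrow> s (SU (Suc j)) | _ \<Rightarrow> s j)" for j
      have tK: "t j = s j" if "j \<in> K" for j using that K by (cases j) (auto simp: t_def)
      have tS: "t (SZ a) = s (SU 0)" "t (SU j) = s (SU (Suc j))" for j by (auto simp: t_def)
      have "AE \<omega> in Pr. \<omega> \<in> {\<omega>. \<forall>j\<in>JJ (Suc n). exch a \<omega> j = s j} \<longleftrightarrow> \<omega> \<in> {\<omega>. \<forall>j\<in>JJ n. \<omega> j = t j}"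
        using AE_U
      proof eventually_elim
        case (elim \<omega>)
        have *: "(\<forall>j<Suc n. Q j) \<longleftrightarrow> Q 0 \<and> (\<forall>j<n. Q (Suc j))" for Q using All_less_Suc2 by blast
        show ?case
        proof (cases "\<omega> (SZ a) = 0")
          case True
          then show ?thesis using elim[rule_format, of 0] s0 False by (auto simp: JJ_def ball_Un tS)
        next
          case nz: False
          then show ?thesis using s0 False unfolding JJ_def ball_Un
            by (simp add: exK tK tS lessThan_def * conj_ac del: All_less_Suc2)
        qed
      qed
      then have "prob {\<omega>. \<forall>j\<in>JJ (Suc n). exch a \<omega> j = s j} = prob {\<omega>. \<forall>j\<in>JJ n. \<omega> j = t j}"
        by (intro finite_measure_eq_AE) (use meas meas' in auto)
      also have "\<dots> = (\<Prod>j\<in>JJ n. pmf (law j) (t j))" by (rule prob_cyl_eq[OF JJ])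
      also have "\<dots> = (\<Prod>j\<in>JJ (Suc n). pmf (law j) (s j))"
        using False s0 a by (simp add: prodJJ prod.lessThan_Suc_shift tK tS pmf_zlaw pmf_ulaw del: prod.lessThan_Suc)
      finally show ?thesis .
    qed
  next
    case s1: False
    \<comment> \<open>The old move was to the parent; the old first letter is the new move, and the
      new letters follow it.\<close>
    define t where "t j = (case j of SZ a' \<Rightarrow> if a' = a then 0 else s j | SU j \<Rightarrow> case_nat (s (SZ a)) (\<lambda>j. s (SU j)) j | _ \<Rightarrow> s j)" for j
    have tK: "t j = s j" if "j \<in> K" for j using that K by (cases j) (auto simp: t_def)
    have tS: "t (SZ a) = 0" "t (SU 0) = s (SZ a)" "t (SU (Suc j)) = s (SU j)" for j by (auto simp: t_def)
    have *: "(\<forall>j<Suc (Suc n). Q j) \<longleftrightarrow> Q 0 \<and> (\<forall>j<Suc n. Q (Suc j))" for Q using All_less_Suc2 by blast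
    have "{\<omega>. \<forall>j\<in>JJ (Suc n). exch a \<omega> j = s j} = {\<omega>. \<forall>j\<in>JJ (Suc (Suc n)). \<omega> j = t j}"
    proof (intro Collect_cong)
      fix \<omega>
      show "(\<forall>j\<in>JJ (Suc n). exch a \<omega> j = s j) \<longleftrightarrow> (\<forall>j\<in>JJ (Suc (Suc n)). \<omega> j = t j)"
      proof (cases "\<omega> (SZ a) = 0")
        case True
        then show ?thesis unfolding JJ_def ball_Un
          by (simp add: exK tK tS lessThan_def * conj_ac del: All_less_Suc2)
      next
        case False
        then show ?thesis using s1 by (auto simp: JJ_def ball_Un t_def)
      qed
    qed
    also have "prob \<dots> = (\<Prod>j\<in>JJ (Suc (Suc n)). pmf (law j) (t j))" by (rule prob_cyl_eq[OF JJ])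
    also have "\<dots> = (\<Prod>j\<in>JJ (Suc n). pmf (law j) (s j))"
      using s1 a by (simp add: prodJJ prod.lessThan_Suc_shift[of _ "Suc n"] tK tS pmf_zlaw pmf_ulaw del: prod.lessThan_Suc)
    finally show ?thesis .
  qed
  have "J0 \<subseteq> JJ (Suc n)"
  proof
    fix x assume "x \<in> J0"
    then show "x \<in> JJ (Suc n)" using n by (cases "x \<in> range SU") (auto simp: JJ_def K_def less_Suc_eq_le)
  qed
  moreover have "measure (distr Pr Pr (exch a)) {\<omega>. \<forall>j\<in>JJ (Suc n). \<omega> j = s j} =
     (\<Prod>j\<in>JJ (Suc n). pmf (law j) (s j))" for s
    using main[of s] by (subst measure_distr) (use meas in \<open>auto simp: vimage_def\<close>)
  ultimately show "\<exists>J'. J0 \<subseteq> J' \<and> finite J' \<and>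
    (\<forall>s. measure (distr Pr Pr (exch a)) {\<omega>. \<forall>j\<in>J'. \<omega> j = s j} = (\<Prod>j\<in>J'. pmf (law j) (s j)))"
    using JJ by blast
qed simp

lemma prob_exch:
  assumes "SZ a \<in> used" "A \<in> sets Pr"
  shows "prob {\<omega>. exch a \<omega> \<in> A} = prob A"
  using measure_distr[OF measurable_exch assms(2), of a] distr_exch[OF assms(1)]
  by (simp add: vimage_def)

lemma distr_comp:
  assumes [measurable]: "f \<in> Pr \<rightarrow>\<^sub>M Pr" "g \<in> Pr \<rightarrow>\<^sub>M Pr" and "distr Pr Pr f = Pr" "distr Pr Pr g = Pr"
  shows "distr Pr Pr (\<lambda>\<omega>. g (f \<omega>)) = Pr"
proof -
  have "distr Pr Pr (\<lambda>\<omega>. g (f \<omega>)) = distr (distr Pr Pr f) Pr g"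
    by (subst distr_distr) (auto simp: comp_def)
  then show ?thesis using assms by simp
qed

lemma distr_Spine: "distr Pr Pr Spine = Pr"
  unfolding Spine_def[abs_def]
proof (rule distr_comp[OF measurable_exch measurable_reindex distr_exch distr_reindex[OF inj_spine_ix]])
  fix s assume "s \<in> used"
  then show "law (spine_ix s) = law s" by (cases s rule: push_ix.cases) auto
qed simp

lemma klaw_rec: "k \<ge> 1 \<Longrightarrow> pmf klaw k = pmf \<mu> k + pmf klaw (Suc k)"
proof -
  assume "k \<ge> 1"
  have "{k..} = insert k {Suc k..}" by auto
  then have "measure_pmf.prob \<mu> {k..} = measure_pmf.prob \<mu> ({k} \<union> {Suc k..})" by simp
  also have "\<dots> = measure_pmf.prob \<mu> {k} + measure_pmf.prob \<mu> {Suc k..}"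
    by (rule measure_pmf.finite_measure_Union) auto
  finally show ?thesis using \<open>k \<ge> 1\<close> by (simp add: klaw measure_pmf_single)
qed

text \<open>Since \<open>klaw\<close> has total mass one and gives \<mu>{1..} to 1, an ancestor with
  a second child is exactly as likely as a childless root. This is the cancellation behind
  \<open>distr_Succ\<close>.\<close>

lemma klaw_ge2: "measure_pmf.prob klaw {2..} = pmf \<mu> 0"
proof -
  have ge1: "- {0} = {Suc 0..}" by auto
  have "1 = measure_pmf.prob klaw ({0, 1} \<union> {2..})"
  proof -
    have "{0, 1} \<union> {2..} = (UNIV :: nat set)" by auto
    then show ?thesis using measure_pmf.prob_space[of klaw] by (simp only: space_measure_pmf)
  qed
  also have "\<dots> = measure_pmf.prob klaw {0, 1} + measure_pmf.prob klaw {2..}"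
    by (rule measure_pmf.finite_measure_Union) auto
  also have "measure_pmf.prob klaw {0, 1} = measure_pmf.prob \<mu> {1..}"
    by (subst measure_measure_pmf_finite) (auto simp: klaw)
  also have "measure_pmf.prob \<mu> {1..} = 1 - pmf \<mu> 0"
    using measure_pmf.prob_compl[of "{0}" \<mu>]
    by (simp add: measure_pmf_single Compl_eq_Diff_UNIV[symmetric] flip: ge1)
  finally show ?thesis by simp
qed

lemma klaw_lt2: "measure_pmf.prob klaw {..<2} = 1 - pmf \<mu> 0"
proof -
  have "{..<2} = space (measure_pmf klaw) - {2..}" by auto
  then have "measure_pmf.prob klaw {..<2} = 1 - measure_pmf.prob klaw {2..}"
    by (simp only: measure_pmf.prob_compl[of "{2..}" klaw, simplified sets_measure_pmf, OF UNIV_I])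
  then show ?thesis by (simp add: klaw_ge2)
qed

lemma AE_branching_ancestors:
  assumes "pmf \<mu> 0 > 0"
  shows "AE \<omega> in Pr. \<forall>m. \<exists>n\<ge>m. 2 \<le> \<omega> (SK (Suc n))"
proof (subst AE_all_countable, rule allI)
  fix m
  let ?q = "1 - pmf \<mu> 0"
  have "prob {\<omega>. \<forall>n\<ge>m. \<omega> (SK (Suc n)) < 2} \<le> ?q ^ N" for N
  proof -
    let ?J = "(\<lambda>n. SK (Suc n)) ` {m..<m+N}"
    have "prob {\<omega>. \<forall>n\<ge>m. \<omega> (SK (Suc n)) < 2} \<le> prob {\<omega>. \<forall>j\<in>?J. \<omega> j \<in> {..<2}}"
      by (rule finite_measure_mono[OF _ sets_Collect_fin]) auto
    also have "\<dots> = (\<Prod>j\<in>?J. measure_pmf.prob (law j) {..<2})" by (rule prob_cyl) auto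
    also have "\<dots> = (\<Prod>j\<in>?J. ?q)" by (rule prod.cong) (auto simp: klaw_lt2)
    also have "\<dots> = ?q ^ N" by (subst prod_constant) (simp add: card_image inj_on_def)
    finally show ?thesis .
  qed
  moreover have "(\<lambda>N. ?q ^ N) \<longlonglongrightarrow> 0"
    by (rule LIMSEQ_power_zero) (use assms pmf_le_1[of \<mu> 0] in auto)
  ultimately have "prob {\<omega>. \<forall>n\<ge>m. \<omega> (SK (Suc n)) < 2} \<le> 0"
    by (intro LIMSEQ_le_const[where X="\<lambda>N. ?q ^ N"]) auto
  then have "prob {\<omega>. \<forall>n\<ge>m. \<omega> (SK (Suc n)) < 2} = 0" by (simp add: measure_le_0_iff)
  then have "AE \<omega> in Pr. \<omega> \<notin> {\<omega>. \<forall>n\<ge>m. \<omega> (SK (Suc n)) < 2}"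
    by (intro AE_not_in null_setsI) (auto simp: emeasure_eq_measure)
  then show "AE \<omega> in Pr. \<exists>n\<ge>m. 2 \<le> \<omega> (SK (Suc n))"
    by eventually_elim (auto simp: not_less)
qed

text \<open>\<open>Spine\<close> reads neither \<open>SK 1\<close> nor the offspring numbers below
  the root, so the outcome of a trial, which concerns \<open>SK 1\<close> only, is independent of
  the configuration passed on to the next trial.\<close>

lemma Spine_cong:
  assumes "\<And>s. s \<noteq> SK 1 \<Longrightarrow> (\<And>w. s \<noteq> SXi (0, w)) \<Longrightarrow> \<omega> s = \<omega>' s"
  shows "Spine \<omega> = Spine \<omega>'"
proof
  fix s show "Spine \<omega> s = Spine \<omega>' s"
    unfolding Spine_def reindex_def
    by (cases s rule: push_ix.cases) (auto simp: assms split: nat.splits)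
qed

lemma Repl_cong:
  assumes "\<And>s. (\<And>w. s \<noteq> SXi (0, w)) \<Longrightarrow> \<omega> s = \<omega>' s"
  shows "Repl \<omega> = Repl \<omega>'"
proof
  fix s show "Repl \<omega> s = Repl \<omega>' s"
    unfolding Repl_def reindex_def Let_def
    by (cases s rule: push_ix.cases) (auto simp: assms split: nat.splits)
qed

lemma Pop_cong:
  assumes "\<And>s. (\<And>w. s \<noteq> SXi (0, w)) \<Longrightarrow> \<omega> s = \<omega>' s"
  shows "Pop \<omega> = Pop \<omega>'"
proof -
  have n: "pop_n \<omega> = pop_n \<omega>'" unfolding pop_n_def using assms by simp
  have S: "Spine \<omega> = Spine \<omega>'" by (rule Spine_cong) (use assms in auto)
  show ?thesis
  proof (cases "pop_n \<omega>")
    case 0 then show ?thesis using n Repl_cong[OF assms] by (simp add: Pop_def)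
  next
    case (Suc k)
    then show ?thesis using n S by (simp add: Pop_def funpow_swap1 del: funpow.simps(2) add: funpow_Suc_right)
  qed
qed

lemma Pop_Spine:
  assumes "\<omega> (SK 1) < 2" "\<exists>n. 2 \<le> \<omega> (SK (Suc n))"
  shows "Pop \<omega> = Pop (Spine \<omega>)"
proof -
  obtain n where n: "2 \<le> \<omega> (SK (Suc n))" using assms(2) by auto
  have "pop_n \<omega> = Suc (LEAST m. 2 \<le> \<omega> (SK (Suc (Suc m))))"
    unfolding pop_n_def by (rule Least_Suc[where P="\<lambda>n. 2 \<le> \<omega> (SK (Suc n))", OF n]) (use assms in simp)
  also have "(LEAST m. 2 \<le> \<omega> (SK (Suc (Suc m)))) = pop_n (Spine \<omega>)"
    unfolding pop_n_def by (simp add: Spine_def reindex_def)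
  finally show ?thesis by (simp add: Pop_def funpow_Suc_right del: funpow.simps(2))
qed

text \<open>\<open>Pop\<close> repeats independent trials of success probability \<open>pmf \<mu> 0\<close> until an ancestor with a
  second child is found, hence its law is that of \<open>Repl\<close> conditioned on immediate success.\<close>

lemma prob_Pop:
  assumes B [measurable]: "B \<in> sets Pr"
  shows "pmf \<mu> 0 * prob {\<omega>. Pop \<omega> \<in> B} = prob {\<omega>. 2 \<le> \<omega> (SK 1) \<and> Repl \<omega> \<in> B}"
proof (cases "pmf \<mu> 0 = 0")
  case True
  have "prob {\<omega>. 2 \<le> \<omega> (SK 1) \<and> Repl \<omega> \<in> B} \<le> prob {\<omega>. \<omega> (SK 1) \<in> {2..}}"
    by (rule finite_measure_mono) auto
  also have "\<dots> = 0" using True by (simp add: prob_cyl1 klaw_ge2 del: atLeast_iff)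
  finally show ?thesis using True by (simp add: measure_le_0_iff)
next
  case False
  then have pos: "pmf \<mu> 0 > 0" by (simp add: pmf_pos)
  \<comment> \<open>Decomposition by the first trial: failure is independent of
    \<open>Spine \<omega>\<close>, which has law \<open>Pr\<close> again, so the unknown x solves x
    = r + (1 - p) x, with r the right-hand side of the claim and p =
    \<open>pmf \<mu> 0\<close>.\<close>
  have "prob {\<omega>. Pop \<omega> \<in> B} = prob ({\<omega>. 2 \<le> \<omega> (SK 1) \<and> Repl \<omega> \<in> B} \<union> {\<omega>. \<omega> (SK 1) < 2 \<and> Pop (Spine \<omega>) \<in> B})"
  proof (rule finite_measure_eq_AE)
    show "AE \<omega> in Pr. \<omega> \<in> {\<omega>. Pop \<omega> \<in> B} \<longleftrightarrow>
      \<omega> \<in> {\<omega>. 2 \<le> \<omega> (SK 1) \<and> Repl \<omega> \<in> B} \<union> {\<omega>. \<omega> (SK 1) < 2 \<and> Pop (Spine \<omega>) \<in> B}"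
      using AE_branching_ancestors[OF pos]
    proof eventually_elim
      case (elim \<omega>)
      show ?case
      proof (cases "\<omega> (SK 1) < 2")
        case True
        then show ?thesis using Pop_Spine[of \<omega>] elim by (metis (mono_tags, lifting) Un_iff mem_Collect_eq not_less)
      next
        case False
        then have "pop_n \<omega> = 0" unfolding pop_n_def by (intro Least_eq_0) auto
        then show ?thesis using False by (simp add: Pop_def)
      qed
    qed
  qed auto
  also have "\<dots> = prob {\<omega>. 2 \<le> \<omega> (SK 1) \<and> Repl \<omega> \<in> B} + prob {\<omega>. \<omega> (SK 1) < 2 \<and> Pop (Spine \<omega>) \<in> B}"
    by (rule finite_measure_Union) auto
  also have "{\<omega>. \<omega> (SK 1) < 2 \<and> Pop (Spine \<omega>) \<in> B} = {\<omega>. \<omega> (SK 1) \<in> {..<2}} \<inter> {\<omega>. Pop (Spine \<omega>) \<in> B}" by auto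
  also have "prob \<dots> = prob {\<omega>. \<omega> (SK 1) \<in> {..<2}} * prob {\<omega>. Pop (Spine \<omega>) \<in> B}"
  proof (rule prob_Int_dep[where J="{SK 1}" and K="-{SK 1}"])
    show "dep_on (- {SK 1}) {\<omega>. Pop (Spine \<omega>) \<in> B}"
      unfolding dep_on_def
    proof (intro allI impI)
      fix \<omega> \<omega>' :: "src \<Rightarrow> nat" assume "\<forall>j\<in>-{SK 1}. \<omega> j = \<omega>' j"
      then have "Spine \<omega> = Spine \<omega>'" by (intro Spine_cong) auto
      then show "\<omega> \<in> {\<omega>. Pop (Spine \<omega>) \<in> B} \<longleftrightarrow> \<omega>' \<in> {\<omega>. Pop (Spine \<omega>) \<in> B}" by simp
    qed
  qed (auto simp: dep_on_def)
  also have "prob {\<omega>. \<omega> (SK 1) \<in> {..<2}} = 1 - pmf \<mu> 0" by (simp only: prob_cyl1) (simp add: klaw_lt2)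
  also have "prob {\<omega>. Pop (Spine \<omega>) \<in> B} = prob {\<omega>. Pop \<omega> \<in> B}"
    using measure_distr[OF measurable_Spine, of "{\<omega>. Pop \<omega> \<in> B}"] by (simp add: distr_Spine vimage_def)
  finally show ?thesis by (simp add: algebra_simps)
qed

text \<open>On a cylinder with \<open>SK 1\<close> equal to k >= 1, both branches give the same
  factor \<open>R\<close> for the other coordinates; \<open>Push\<close> contributes \<mu>(k) and
  \<open>Pop\<close> contributes the mass of \<open>klaw\<close> at k + 1, and
  \<open>klaw_rec\<close> adds them to the mass of \<open>klaw\<close> at k.\<close>

lemma distr_Succ: "distr Pr Pr Succ = Pr"
proof (rule Pr_eqI)
  show "prob_space (distr Pr Pr Succ)" by (rule prob_space_distr) measurable
  fix J0 :: "src set" assume J0: "finite J0"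
  let ?J = "insert (SK 1) J0"
  have "measure (distr Pr Pr Succ) {\<omega>. \<forall>j\<in>?J. \<omega> j = s j} = (\<Prod>j\<in>?J. pmf (law j) (s j))" for s
  proof -
    define BB where "BB = {\<omega>. \<forall>j\<in>?J. \<omega> j = s j}"
    let ?k = "s (SK 1)"
    define R where "R = (\<Prod>j\<in>J0 - {SK 1}. pmf (law j) (s j))"
    have B [measurable]: "{\<omega>. \<forall>j\<in>?J. \<omega> j = s j} \<in> sets Pr" for s
      using sets_Collect_fin[of ?J "\<lambda>j. {s j}"] J0 by simp
    have BB [measurable]: "BB \<in> sets Pr" unfolding BB_def by (rule B)
    have prodR: "(\<Prod>j\<in>?J. f j) = f (SK 1) * R" if "\<And>j. j \<noteq> SK 1 \<Longrightarrow> f j = pmf (law j) (s j)" for f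
      using J0 that by (simp add: prod.insert_remove R_def)
    have "prob {\<omega>. Succ \<omega> \<in> BB} = prob ({\<omega>. 1 \<le> \<omega> (SXi (0, [])) \<and> Push \<omega> \<in> BB} \<union> {\<omega>. \<omega> (SXi (0, [])) = 0 \<and> Pop \<omega> \<in> BB})"
      by (rule arg_cong[where f=prob]) (auto simp: Succ_def)
    also have "\<dots> = prob {\<omega>. 1 \<le> \<omega> (SXi (0, [])) \<and> Push \<omega> \<in> BB} + prob {\<omega>. \<omega> (SXi (0, [])) = 0 \<and> Pop \<omega> \<in> BB}"
      by (rule finite_measure_Union) auto
    also have "{\<omega>. \<omega> (SXi (0, [])) = 0 \<and> Pop \<omega> \<in> BB} = {\<omega>. \<omega> (SXi (0, [])) \<in> {0}} \<inter> {\<omega>. Pop \<omega> \<in> BB}" by auto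
    also have "prob \<dots> = prob {\<omega>. \<omega> (SXi (0, [])) \<in> {0}} * prob {\<omega>. Pop \<omega> \<in> BB}"
    proof (rule prob_Int_dep[where J="{SXi (0, [])}" and K="-{SXi (0, [])}"])
      show "dep_on (-{SXi (0, [])}) {\<omega>. Pop \<omega> \<in> BB}"
        unfolding dep_on_def
      proof (intro allI impI)
        fix \<omega> \<omega>' :: "src \<Rightarrow> nat" assume "\<forall>j\<in>-{SXi (0, [])}. \<omega> j = \<omega>' j"
        then have "Pop \<omega> = Pop \<omega>'" by (intro Pop_cong) auto
        then show "\<omega> \<in> {\<omega>. Pop \<omega> \<in> BB} \<longleftrightarrow> \<omega>' \<in> {\<omega>. Pop \<omega> \<in> BB}" by simp
      qed
    qed (auto simp: dep_on_def)
    also have "prob {\<omega>. \<omega> (SXi (0, [])) \<in> {0}} = pmf \<mu> 0" by (simp only: prob_cyl1) (simp add: measure_pmf_single)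
    \<comment> \<open>The probability of a childless root cancels the normalisation of the
      conditional law of \<open>Pop\<close>.\<close>
    also have "pmf \<mu> 0 * prob {\<omega>. Pop \<omega> \<in> BB} = prob {\<omega>. 2 \<le> \<omega> (SK 1) \<and> Repl \<omega> \<in> BB}"
      by (rule prob_Pop) (rule BB)
    also have "prob {\<omega>. 1 \<le> \<omega> (SXi (0, [])) \<and> Push \<omega> \<in> BB} = (if 1 \<le> ?k then pmf \<mu> ?k * R else 0)"
    proof (cases "1 \<le> ?k")
      case True
      let ?C = "{\<omega>. \<forall>j\<in>?J. reindex push_ix \<omega> j = s j}"
      have [measurable]: "?C \<in> sets Pr"
        using measurable_sets[OF measurable_reindex B, of push_ix s] by (simp add: vimage_def)
      have "{\<omega>. 1 \<le> \<omega> (SXi (0, [])) \<and> Push \<omega> \<in> BB} = {\<omega>. exch (0, [0]) \<omega> \<in> ?C}"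
        using True by (auto simp: BB_def Push_def reindex_def)
      also have "prob \<dots> = prob ?C" by (rule prob_exch) (simp, measurable)
      also have "\<dots> = (\<Prod>j\<in>?J. if j \<in> used then pmf (law (push_ix j)) (s j) else of_bool (s j = 0))"
        using J0 by (intro prob_reindex_cyl inj_push_ix) auto
      also have "\<dots> = pmf \<mu> ?k * R"
      proof (subst prodR)
        fix j assume "j \<noteq> SK 1"
        moreover have "law (SZ (p - Suc 0, w)) = zlaw" if "w \<noteq> []" "0 < hd w" for p w
          by (rule law_simps(4)) (use that in auto)
        ultimately show "(if j \<in> used then pmf (law (push_ix j)) (s j) else of_bool (s j = 0)) = pmf (law j) (s j)"
          by (cases j rule: push_ix.cases) (auto simp: of_bool_def split: if_splits)
      qed simp
      finally show ?thesis using True by simp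
    next
      case False
      then have "{\<omega>. 1 \<le> \<omega> (SXi (0, [])) \<and> Push \<omega> \<in> BB} = {}" by (auto simp: BB_def Push_def reindex_def)
      then show ?thesis using False by (simp only: measure_empty if_False)
    qed
    also have "prob {\<omega>. 2 \<le> \<omega> (SK 1) \<and> Repl \<omega> \<in> BB} = (if 1 \<le> ?k then pmf klaw (Suc ?k) * R else 0)"
    proof (cases "1 \<le> ?k")
      case True
      \<comment> \<open>The value that \<open>SK 1\<close> must have before \<open>Repl\<close>
        lowers it by one.\<close>
      define s' where "s' = s(SK 1 := Suc ?k)"
      let ?C = "{\<omega>. \<forall>j\<in>?J. reindex repl_ix \<omega> j = s' j}"
      have [measurable]: "?C \<in> sets Pr"
        using measurable_sets[OF measurable_reindex B, of repl_ix s'] by (simp add: vimage_def)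
      have "{\<omega>. 2 \<le> \<omega> (SK 1) \<and> Repl \<omega> \<in> BB} = {\<omega>. exch (1, []) \<omega> \<in> {\<omega>. exch (1, [1]) \<omega> \<in> ?C}}"
        using True by (auto simp: BB_def Repl_def Let_def reindex_def s'_def split: if_splits)
      also have "prob \<dots> = prob {\<omega>. exch (1, [1]) \<omega> \<in> ?C}" by (rule prob_exch) (simp, measurable)
      also have "\<dots> = prob ?C" by (rule prob_exch) (simp, measurable)
      also have "\<dots> = (\<Prod>j\<in>?J. if j \<in> used then pmf (law (repl_ix j)) (s' j) else of_bool (s' j = 0))"
        using J0 by (intro prob_reindex_cyl inj_repl_ix) auto
      also have "\<dots> = pmf klaw (Suc ?k) * R"
      proof (subst prodR)
        fix j assume "j \<noteq> SK 1"
        then show "(if j \<in> used then pmf (law (repl_ix j)) (s' j) else of_bool (s' j = 0)) = pmf (law j) (s j)"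
          by (cases j rule: push_ix.cases) (auto simp: of_bool_def s'_def split: if_splits)
      qed (simp add: s'_def)
      finally show ?thesis using True by simp
    next
      case False
      then have "{\<omega>. 2 \<le> \<omega> (SK 1) \<and> Repl \<omega> \<in> BB} = {}" by (auto simp: BB_def Repl_def Let_def reindex_def)
      then show ?thesis using False by (simp only: measure_empty if_False)
    qed
    also have "(if 1 \<le> ?k then pmf \<mu> ?k * R else 0) + (if 1 \<le> ?k then pmf klaw (Suc ?k) * R else 0) = pmf klaw ?k * R"
      using klaw_rec[of ?k] klaw[of ?k] by (auto simp: algebra_simps)
    also have "\<dots> = (\<Prod>j\<in>?J. pmf (law j) (s j))" by (subst prodR) auto
    finally show ?thesis by (subst measure_distr) (use B in \<open>auto simp: vimage_def BB_def\<close>)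
  qed
  then show "\<exists>J'. J0 \<subseteq> J' \<and> finite J' \<and>
    (\<forall>s. measure (distr Pr Pr Succ) {\<omega>. \<forall>j\<in>J'. \<omega> j = s j} = (\<Prod>j\<in>J'. pmf (law j) (s j)))"
    using J0 by (intro exI[of _ ?J]) auto
qed simp

end

subsection \<open>Lexicographical order and enumeration\<close>

lemma lexlt_simps [simp]:
  "lexlt [] ys \<longleftrightarrow> ys \<noteq> []" "\<not> lexlt (x # xs) []"
  "lexlt (x # xs) (y # ys) \<longleftrightarrow> x < y \<or> (x = y \<and> lexlt xs ys)"
proof -
  show "lexlt [] ys \<longleftrightarrow> ys \<noteq> []" "\<not> lexlt (x # xs) []" by (auto simp: lexlt_def)
  have ex: "(\<exists>k. Q k) \<longleftrightarrow> Q 0 \<or> (\<exists>k. Q (Suc k))" for Q :: "nat \<Rightarrow> bool"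
    by (metis not0_implies_Suc)
  show "lexlt (x # xs) (y # ys) \<longleftrightarrow> x < y \<or> (x = y \<and> lexlt xs ys)"
    unfolding lexlt_def by (subst ex) auto
qed

lemma lexlt_irrefl [simp]: "\<not> lexlt xs xs"
  by (induction xs) auto

lemma lexlt_asym: "lexlt xs ys \<Longrightarrow> \<not> lexlt ys xs"
proof (induction xs arbitrary: ys)
  case Nil then show ?case by (cases ys) auto
next
  case (Cons x xs) then show ?case by (cases ys) auto
qed

lemma lexlt_trans: "lexlt xs ys \<Longrightarrow> lexlt ys zs \<Longrightarrow> lexlt xs zs"
proof (induction xs arbitrary: ys zs)
  case Nil then show ?case by (cases ys; cases zs) auto
next
  case (Cons x xs) then show ?case by (cases ys; cases zs) auto
qed

lemma lexlt_total: "xs \<noteq> ys \<Longrightarrow> lexlt xs ys \<or> lexlt ys xs"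
proof (induction xs arbitrary: ys)
  case Nil then show ?case by auto
next
  case (Cons x xs) then show ?case by (cases ys) (auto simp: neq_iff)
qed

lemma addr_less_asym: "addr_less u v \<Longrightarrow> \<not> addr_less v u"
  unfolding addr_less_def by (simp add: max.commute lexlt_asym)

text \<open>Among canonical addresses these are the ones that do not precede \<open>root\<close>,
  that is, all but its strict ancestors; see \<open>addr_less_root\<close>.\<close>

definition fwd :: "addr \<Rightarrow> bool" where
  "fwd a \<longleftrightarrow> fst a = 0 \<or> (snd a \<noteq> [] \<and> hd (snd a) \<noteq> 0)"

lemma fwd_canon: "fwd a \<Longrightarrow> canon a"
  by (auto simp: fwd_def canon_def)

text \<open>After padding with zeros, a forward address of higher level leaves the spine earlier,
  and with a nonzero index. So the levels (the tree below the root, then the bushes of the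
  successive ancestors) follow each other as blocks.\<close>

lemma addr_less_fwd:
  assumes "fwd u" "fwd v"
  shows "addr_less u v \<longleftrightarrow> fst u < fst v \<or> (fst u = fst v \<and> lexlt (snd u) (snd v))"
proof -
  obtain p w q x where uv: "u = (p, w)" "v = (q, x)" by (metis surj_pair)
  consider "p = q" | k where "q = Suc (p + k)" | k where "p = Suc (q + k)"
    by (metis less_imp_Suc_add linorder_neqE_nat)
  then show ?thesis
  proof cases
    case 1 then show ?thesis by (simp add: uv addr_less_def gpath_def)
  next
    case 2
    then have "x \<noteq> []" "hd x \<noteq> 0" using assms uv by (auto simp: fwd_def)
    then show ?thesis using 2 by (cases x) (auto simp: uv addr_less_def gpath_def)
  next
    case 3
    then have "w \<noteq> []" "hd w \<noteq> 0" using assms uv by (auto simp: fwd_def)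
    then show ?thesis using 3 by (cases w) (auto simp: uv addr_less_def gpath_def)
  qed
qed

lemma addr_less_root: "canon v \<Longrightarrow> addr_less root v \<longleftrightarrow> v \<noteq> root \<and> fwd v"
proof -
  assume c: "canon v"
  obtain q x where v: "v = (q, x)" by (metis surj_pair)
  show ?thesis
  proof (cases "fwd v")
    case True
    then show ?thesis using addr_less_fwd[of root v] by (auto simp: root_def fwd_def v)
  next
    case False
    then have "x = []" "q > 0" using c by (auto simp: v fwd_def canon_def)
    then show ?thesis using False
      by (cases q) (auto simp: v addr_less_def gpath_def root_def)
  qed
qed

lemma fwd_trans: "fwd u \<Longrightarrow> fwd v \<Longrightarrow> fwd w \<Longrightarrow> addr_less u v \<Longrightarrow> addr_less v w \<Longrightarrow> addr_less u w"
  by (auto simp: addr_less_fwd intro: lexlt_trans)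

lemma fwd_total: "fwd u \<Longrightarrow> fwd v \<Longrightarrow> u \<noteq> v \<Longrightarrow> addr_less u v \<or> addr_less v u"
  by (auto simp: addr_less_fwd prod_eq_iff) (metis lexlt_total linorder_neqE_nat)+

lemma fwd_irrefl: "\<not> addr_less u u"
  by (simp add: addr_less_def)

definition rank :: "addr set \<Rightarrow> addr \<Rightarrow> nat" where
  "rank F v = card {u \<in> F. addr_less u v}"

definition fenum :: "addr set \<Rightarrow> nat \<Rightarrow> addr" where
  "fenum F n = (THE v. v \<in> F \<and> finite {u \<in> F. addr_less u v} \<and> rank F v = n)"

text \<open>Order type of the natural numbers, which makes \<open>fenum\<close> a genuine
  enumeration.\<close>

definition wellenum :: "addr set \<Rightarrow> bool" where
  "wellenum F \<longleftrightarrow> F \<subseteq> Collect fwd \<and> infinite F \<and> (\<forall>v\<in>F. finite {u \<in> F. addr_less u v})"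

lemma rank_less:
  assumes "F \<subseteq> Collect fwd" "finite {u \<in> F. addr_less u v}" "u \<in> F" "v \<in> F" "addr_less u v"
  shows "rank F u < rank F v"
  unfolding rank_def
proof (rule psubset_card_mono[OF assms(2)], rule psubsetI)
  show "{x \<in> F. addr_less x u} \<subseteq> {x \<in> F. addr_less x v}"
  proof safe
    fix p w assume "(p, w) \<in> F" "addr_less (p, w) u"
    then show "addr_less (p, w) v" using assms fwd_trans[of "(p, w)" u v] by blast
  qed
  have "u \<in> {x \<in> F. addr_less x v}" "u \<notin> {x \<in> F. addr_less x u}" using assms fwd_irrefl by auto
  then show "{x \<in> F. addr_less x u} \<noteq> {x \<in> F. addr_less x v}" by metis
qed

lemma rank_inj:
  assumes "F \<subseteq> Collect fwd" "u \<in> F" "v \<in> F" "finite {x \<in> F. addr_less x u}" "finite {x \<in> F. addr_less x v}"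
    "rank F u = rank F v"
  shows "u = v"
proof (rule ccontr)
  assume "u \<noteq> v"
  then have "addr_less u v \<or> addr_less v u" using fwd_total[of u v] assms(1-3) by blast
  then show False using rank_less[OF assms(1)] assms by (metis less_irrefl)
qed

lemma fenum_rank:
  assumes "F \<subseteq> Collect fwd" "v \<in> F" "finite {u \<in> F. addr_less u v}"
  shows "fenum F (rank F v) = v"
  unfolding fenum_def by (rule the_equality) (use assms rank_inj in auto)

text \<open>No rank is skipped: the predecessors of a vertex of rank r have r distinct ranks below
  r, hence all of them, and r can be taken arbitrarily large because \<open>F\<close> is
  infinite.\<close>

lemma fenum_props:
  assumes F: "wellenum F"
  shows "fenum F n \<in> F \<and> rank F (fenum F n) = n"
proof -
  note W = F[unfolded wellenum_def]
  have inj: "inj_on (rank F) F" using rank_inj[of F] W by (auto simp: inj_on_def)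
  have "infinite (rank F ` F)" using W inj finite_imageD by blast
  then obtain m where m: "m \<ge> n" "m \<in> rank F ` F"
    by (metis (no_types, opaque_lifting) infinite_nat_iff_unbounded_le)
  then obtain v where v: "v \<in> F" "rank F v \<ge> n" by auto
  have "\<exists>u\<in>F. rank F u = n"
  proof (cases "rank F v = n")
    case True then show ?thesis using v by auto
  next
    case False
    let ?D = "{u \<in> F. addr_less u v}"
    have "rank F ` ?D = {..<rank F v}"
    proof (rule card_subset_eq)
      show "rank F ` ?D \<subseteq> {..<rank F v}" using rank_less[of F v] W v by auto
      have "card (rank F ` ?D) = card ?D" by (rule card_image) (use inj in \<open>auto intro: inj_on_subset\<close>)
      then show "card (rank F ` ?D) = card {..<rank F v}" by (simp add: rank_def)
    qed simp
    then have "n \<in> rank F ` ?D" using False v by auto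
    then show ?thesis by auto
  qed
  then obtain u where u: "u \<in> F" "rank F u = n" by auto
  then have "fenum F n = u" using fenum_rank[of F u] W by auto
  then show ?thesis using u by simp
qed

text \<open>Deleting a finite initial segment and renaming the rest monotonically only shifts the
  enumeration. Serves both for the root deleted by \<open>Succ\<close> and for the levels replaced
  by \<open>Spine\<close>.\<close>

lemma fenum_transfer:
  assumes F: "wellenum F" and A: "A \<subseteq> F" "finite A" "\<And>u v. u \<in> A \<Longrightarrow> v \<in> F - A \<Longrightarrow> addr_less u v"
    and bij: "bij_betw f B (F - A)" and B: "B \<subseteq> Collect fwd"
    and ord: "\<And>u v. u \<in> B \<Longrightarrow> v \<in> B \<Longrightarrow> addr_less u v \<longleftrightarrow> addr_less (f u) (f v)"
  shows "wellenum B" and "fenum F (card A + n) = f (fenum B n)"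
proof -
  note W = F[unfolded wellenum_def]
  have inj: "inj_on f B" and im: "f ` B = F - A" using bij by (auto simp: bij_betw_def)
  have pre: "{u \<in> F. addr_less u (f v)} = A \<union> f ` {u \<in> B. addr_less u v}" if "v \<in> B" for v
  proof -
    have "f v \<in> F - A" using im that by auto
    then have "addr_less u (f v)" if "u \<in> A" for u using A(3) that by blast
    moreover have "u \<in> A \<or> u \<in> f ` {u \<in> B. addr_less u v}" if u: "u \<in> F" "addr_less u (f v)" for u
    proof (cases "u \<in> A")
      case False
      then obtain x where "x \<in> B" "u = f x" using u im by (metis DiffI imageE)
      then show ?thesis using u ord \<open>v \<in> B\<close> by blast
    qed auto
    moreover have "f u \<in> F" "addr_less (f u) (f v)" if "u \<in> B" "addr_less u v" for u
      using that im ord \<open>v \<in> B\<close> by blast+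
    ultimately show ?thesis using A(1) by auto
  qed
  have finB: "finite {u \<in> B. addr_less u v}" if "v \<in> B" for v
  proof -
    have "finite {u \<in> F. addr_less u (f v)}" using W im that by auto
    then have "finite (f ` {u \<in> B. addr_less u v})" using pre[OF that] by simp
    then show ?thesis by (rule finite_imageD) (use inj in \<open>auto intro: inj_on_subset\<close>)
  qed
  have "infinite B"
    using W A im by (metis Diff_infinite_finite finite_imageI)
  then show WB: "wellenum B" using B finB by (auto simp: wellenum_def)
  have r: "rank F (f v) = card A + rank B v" if "v \<in> B" for v
  proof -
    have "card (A \<union> f ` {u \<in> B. addr_less u v}) = card A + card (f ` {u \<in> B. addr_less u v})"
      by (rule card_Un_disjoint) (use A finB[OF that] im in auto)
    moreover have "card (f ` {u \<in> B. addr_less u v}) = card {u \<in> B. addr_less u v}"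
      by (rule card_image) (use inj in \<open>auto intro: inj_on_subset\<close>)
    ultimately show ?thesis unfolding rank_def pre[OF that] by simp
  qed
  have p: "fenum B n \<in> B" "rank B (fenum B n) = n" using fenum_props[OF WB] by auto
  have "f (fenum B n) \<in> F" using p im by auto
  then have "fenum F (rank F (f (fenum B n))) = f (fenum B n)"
    by (intro fenum_rank) (use W in auto)
  then show "fenum F (card A + n) = f (fenum B n)" using r[OF p(1)] p by simp
qed

lemma enum_from_eq:
  "enum_from P n = fenum {v. P v \<and> (v = root \<or> addr_less root v)} n"
  unfolding enum_from_def fenum_def rank_def by (simp add: conj_ac)

subsection \<open>Labels of the re-rooted trees\<close>

lemma wmove_shift: "wmove (wshift l x) z = wshift l (wmove x z)"
  by (simp add: wmove_def wparent_def wchild_def wshift_def)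

lemma wshift_wshift [simp]: "wshift l (wshift k x) = wshift (k + l) x"
  by (simp add: wshift_def)

lemma wshift_inj [simp]: "wshift l x = wshift l y \<longleftrightarrow> x = y"
  by (auto simp: wshift_def prod_eq_iff)

lemma walk_shift: "walk Z p u (wshift l x) w = wshift l (walk Z p u x w)"
  by (induction w arbitrary: u x) (auto simp: wmove_shift)

lemma walk_cong:
  "(\<And>v v'. w = v @ v' \<Longrightarrow> v \<noteq> [] \<Longrightarrow> Z (p, u @ v) = Z' (p', u' @ v)) \<Longrightarrow> walk Z p u x w = walk Z' p' u' x w"
proof (induction w arbitrary: u u' x)
  case (Cons i w)
  have "Z (p, u @ [i]) = Z' (p', u' @ [i])" using Cons.prems[of "[i]" w] by simp
  moreover have "walk Z p (u @ [i]) y w = walk Z' p' (u' @ [i]) y w" for y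
    by (rule Cons.IH) (use Cons.prems[of "i # v" for v] in auto)
  ultimately show ?case by simp
qed simp

abbreviation (input) idS :: "src \<Rightarrow> (src \<Rightarrow> nat) \<Rightarrow> nat" where "idS \<equiv> (\<lambda>s \<omega>. \<omega> s)"

abbreviation tV :: "(src \<Rightarrow> nat) \<Rightarrow> addr set" where "tV \<equiv> src_V idS"

abbreviation tX :: "(src \<Rightarrow> nat) \<Rightarrow> addr \<Rightarrow> wstar" where "tX \<equiv> src_X idS"

abbreviation tO :: "(src \<Rightarrow> nat) \<Rightarrow> wstar" where "tO \<equiv> src_o idS"

abbreviation anc :: "(src \<Rightarrow> nat) \<Rightarrow> nat \<Rightarrow> wstar" where "anc \<omega> \<equiv> anc_lab (\<lambda>a. \<omega> (SZ a)) (tO \<omega>)"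

lemma tX_eq: "tX \<omega> (p, w) = walk (\<lambda>a. \<omega> (SZ a)) p [] (anc \<omega> p) w"
  by (simp add: src_X_def brw_lab_def)

lemma gw_set_Nil [simp]: "[] \<in> gw_set N" by (simp add: gw_set_def)

lemma gw_set_Cons [simp]: "i # w \<in> gw_set N \<longleftrightarrow> i < N [] \<and> w \<in> gw_set (\<lambda>u. N (i # u))"
  by (auto simp: gw_set_def less_Suc_eq_0_disj)

lemma tV_simps:
  "(0, w) \<in> tV \<omega> \<longleftrightarrow> w \<in> gw_set (\<lambda>u. \<omega> (SXi (0, u)))"
  "(Suc p, []) \<in> tV \<omega>"
  "(Suc p, i # w) \<in> tV \<omega> \<longleftrightarrow> 1 \<le> i \<and> i < \<omega> (SK (Suc p)) \<and> w \<in> gw_set (\<lambda>u. \<omega> (SXi (Suc p, i # u)))"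
  by (auto simp: src_V_def ipgw_set_def)

lemma tV_canon: "a \<in> tV \<omega> \<Longrightarrow> canon a"
  by (auto simp: src_V_def ipgw_set_def canon_def)

lemma gw_set_cong: "(\<And>u. N u = N' u) \<Longrightarrow> gw_set N = gw_set N'"
  by (simp add: gw_set_def)

section \<open>Vertices and labels under the elementary moves of the root\<close>

lemma exch_start:
  "tO (exch a \<omega>) = wshift (fst (wmove (tO \<omega>) (\<omega> (SZ a)))) (wmove (tO \<omega>) (\<omega> (SZ a)))"
  by (auto simp: src_o_def wmove_def wparent_def wchild_def wshift_def)

text \<open>The way back from the parent is the child given by the first letter; were this letter 0,
  the reversed move would be read as a second step up.\<close>

lemma exch_reverse:
  assumes "1 \<le> \<omega> (SU 0)"
  shows "wmove (tO (exch a \<omega>)) (exch a \<omega> (SZ a)) = wshift (fst (wmove (tO \<omega>) (\<omega> (SZ a)))) (tO \<omega>)"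
  using assms by (auto simp: src_o_def wmove_def wparent_def wchild_def wshift_def split: nat.splits)

lemma tO_reindex: "(\<And>j. f (SU j) = SU j) \<Longrightarrow> tO (reindex f \<omega>) = tO \<omega>"
  by (simp add: src_o_def reindex_def)

text \<open>\<open>old_push\<close>, \<open>old_repl\<close> and \<open>up\<close> translate an
  address in the new tree into the address of the same vertex in the old tree.\<close>

definition old_push :: "addr \<Rightarrow> addr" where
  "old_push a = (if fst a = 0 then (0, 0 # snd a) else (fst a - 1, snd a))"

definition old_repl :: "addr \<Rightarrow> addr" where
  "old_repl a = (if fst a = 0 then (1, 1 # snd a)
     else if fst a = 1 \<and> snd a \<noteq> [] then (1, Suc (hd (snd a)) # tl (snd a)) else a)"

definition up :: "nat \<Rightarrow> addr \<Rightarrow> addr" where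
  "up n a = (fst a + n, snd a)"

lemma Push_V:
  assumes "1 \<le> \<omega> (SXi (0, []))" "canon a"
  shows "a \<in> tV (Push \<omega>) \<longleftrightarrow> old_push a \<in> tV \<omega>"
proof -
  obtain p w where a: "a = (p, w)" by (metis surj_pair)
  have g: "gw_set (\<lambda>u. Push \<omega> (SXi (0, u))) = gw_set (\<lambda>u. \<omega> (SXi (0, 0 # u)))"
    by (rule gw_set_cong) (simp add: Push_def reindex_def)
  have g1: "gw_set (\<lambda>u. Push \<omega> (SXi (Suc q, i # u))) = gw_set (\<lambda>u. \<omega> (SXi (q, i # u)))" if "i \<noteq> 0" for q i
    by (rule gw_set_cong) (use that in \<open>simp add: Push_def reindex_def\<close>)
  have K: "Push \<omega> (SK (Suc (Suc q))) = \<omega> (SK (Suc q))" "Push \<omega> (SK (Suc 0)) = \<omega> (SXi (0, []))" for q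
    by (auto simp: Push_def reindex_def)
  show ?thesis
  proof (cases p)
    case 0 then show ?thesis using assms by (simp add: a old_push_def tV_simps g)
  next
    case (Suc q)
    show ?thesis
    proof (cases w)
      case Nil then show ?thesis using Suc by (cases q) (auto simp: a old_push_def tV_simps)
    next
      case (Cons i v)
      then have "i \<noteq> 0" using assms Suc by (auto simp: a canon_def)
      then show ?thesis using Suc Cons by (cases q) (auto simp: a old_push_def tV_simps g1 K)
    qed
  qed
qed

text \<open>Below the new root the old moves are followed as before. The reversed edge leads back to
  the old starting point, from which the ancestors are reached by their old moves, so one shift of
  heights serves for all vertices.\<close>

lemma Push_X:
  assumes U: "1 \<le> \<omega> (SU 0)" and c: "canon a"
  shows "tX (Push \<omega>) a = wshift (fst (tX \<omega> (0, [0]))) (tX \<omega> (old_push a))"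
proof -
  define l where "l = fst (wmove (tO \<omega>) (\<omega> (SZ (0, [0]))))"
  have l: "fst (tX \<omega> (0, [0])) = l" by (simp add: tX_eq l_def)
  have o: "tO (Push \<omega>) = wshift l (wmove (tO \<omega>) (\<omega> (SZ (0, [0]))))"
    unfolding Push_def l_def by (subst tO_reindex) (simp_all add: exch_start)
  have Z0: "Push \<omega> (SZ (0, v)) = \<omega> (SZ (0, 0 # v))" if "v \<noteq> []" for v
    using that by (simp add: Push_def reindex_def)
  have Z1: "Push \<omega> (SZ (Suc q, v)) = \<omega> (SZ (q, v))" if "v \<noteq> []" "hd v \<noteq> 0" for v q
    using that by (auto simp: Push_def reindex_def)
  have Zr: "Push \<omega> (SZ (Suc 0, [])) = exch (0, [0]) \<omega> (SZ (0, [0]))" by (simp add: Push_def reindex_def)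
  have Z2: "Push \<omega> (SZ (Suc (Suc q), [])) = \<omega> (SZ (Suc q, []))" for q by (simp add: Push_def reindex_def)
  have tr: "tO (Push \<omega>) = tO (exch (0, [0]) \<omega>)" unfolding Push_def by (rule tO_reindex) simp
  have A: "anc (Push \<omega>) (Suc q) = wshift l (anc \<omega> q)" for q
  proof (induction q)
    case 0
    have "anc (Push \<omega>) (Suc 0) = wmove (tO (exch (0, [0]) \<omega>)) (exch (0, [0]) \<omega> (SZ (0, [0])))"
      using tr Zr by simp
    also have "\<dots> = wshift l (tO \<omega>)" unfolding l_def by (rule exch_reverse[of \<omega>, OF U])
    finally show ?case by simp
  next
    case (Suc q)
    have "anc (Push \<omega>) (Suc (Suc q)) = wmove (anc (Push \<omega>) (Suc q)) (\<omega> (SZ (Suc q, [])))" by (simp add: Z2)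
    then show ?case by (simp add: Suc wmove_shift del: anc_lab.simps) simp
  qed
  obtain p w where a: "a = (p, w)" by (metis surj_pair)
  show ?thesis
  proof (cases p)
    case 0
    have "tX (Push \<omega>) a = wshift l (walk (\<lambda>a. Push \<omega> (SZ a)) 0 [] (wmove (tO \<omega>) (\<omega> (SZ (0, [0])))) w)"
      by (simp add: a 0 tX_eq o walk_shift)
    also have "walk (\<lambda>a. Push \<omega> (SZ a)) 0 [] (wmove (tO \<omega>) (\<omega> (SZ (0, [0])))) w =
      walk (\<lambda>a. \<omega> (SZ a)) 0 [0] (wmove (tO \<omega>) (\<omega> (SZ (0, [0])))) w"
      by (rule walk_cong) (auto simp: Z0)
    also have "\<dots> = tX \<omega> (old_push a)" by (simp add: a 0 old_push_def tX_eq)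
    finally show ?thesis unfolding l .
  next
    case (Suc q)
    have "tX (Push \<omega>) a = wshift l (walk (\<lambda>a. Push \<omega> (SZ a)) (Suc q) [] (anc \<omega> q) w)"
      by (simp only: a Suc tX_eq A walk_shift)
    also have "walk (\<lambda>a. Push \<omega> (SZ a)) (Suc q) [] (anc \<omega> q) w = walk (\<lambda>a. \<omega> (SZ a)) q [] (anc \<omega> q) w"
    proof (rule walk_cong)
      fix v v' assume "w = v @ v'" "v \<noteq> []"
      then show "Push \<omega> (SZ (Suc q, [] @ v)) = \<omega> (SZ (q, [] @ v))"
        using Z1[of v q] c Suc a by (auto simp: canon_def)
    qed
    also have "\<dots> = tX \<omega> (old_push a)" by (simp add: a Suc old_push_def tX_eq)
    finally show ?thesis unfolding l .
  qed
qed

text \<open>Restricted to level at least 1: below its new root, \<open>Spine\<close> plants a tree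
  unrelated to the old first ancestor.\<close>

lemma Spine_V: "1 \<le> fst a \<Longrightarrow> a \<in> tV (Spine \<omega>) \<longleftrightarrow> up 1 a \<in> tV \<omega>"
proof -
  assume "1 \<le> fst a"
  then obtain p w where a: "a = (Suc p, w)" by (metis Suc_le_D One_nat_def prod.collapse)
  have g1: "gw_set (\<lambda>u. Spine \<omega> (SXi (Suc p, i # u))) = gw_set (\<lambda>u. \<omega> (SXi (Suc (Suc p), i # u)))" if "1 \<le> i" for i
    by (rule gw_set_cong) (use that in \<open>simp add: Spine_def reindex_def\<close>)
  have K: "Spine \<omega> (SK (Suc p)) = \<omega> (SK (Suc (Suc p)))" by (simp add: Spine_def reindex_def)
  show ?thesis by (cases w) (auto simp: a up_def tV_simps g1 K)
qed

lemma Spine_X: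
  assumes "1 \<le> fst a" and c: "canon a"
  shows "tX (Spine \<omega>) a = wshift (fst (anc \<omega> 1)) (tX \<omega> (up 1 a))"
proof -
  obtain p w where a: "a = (Suc p, w)" using assms(1) by (metis Suc_le_D One_nat_def prod.collapse)
  have Z: "Spine \<omega> (SZ (Suc p, v)) = \<omega> (SZ (Suc (Suc p), v))" if "v = [] \<or> hd v \<noteq> 0" for p v
    using that by (simp add: Spine_def reindex_def)
  have o: "tO (Spine \<omega>) = wshift (fst (anc \<omega> 1)) (anc \<omega> 1)"
    unfolding Spine_def by (subst tO_reindex) (simp_all add: exch_start)
  have A: "anc (Spine \<omega>) q = wshift (fst (anc \<omega> 1)) (anc \<omega> (Suc q))" for q
    by (induction q) (simp_all add: o Z wmove_shift)
  have "tX (Spine \<omega>) a = wshift (fst (anc \<omega> 1)) (walk (\<lambda>a. Spine \<omega> (SZ a)) (Suc p) [] (anc \<omega> (Suc (Suc p))) w)"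
    by (simp only: a tX_eq A walk_shift)
  also have "walk (\<lambda>a. Spine \<omega> (SZ a)) (Suc p) [] (anc \<omega> (Suc (Suc p))) w =
     walk (\<lambda>a. \<omega> (SZ a)) (Suc (Suc p)) [] (anc \<omega> (Suc (Suc p))) w"
  proof (rule walk_cong)
    fix v v' assume "w = v @ v'" "v \<noteq> []"
    then show "Spine \<omega> (SZ (Suc p, [] @ v)) = \<omega> (SZ (Suc (Suc p), [] @ v))"
      using Z[of v p] c a by (auto simp: canon_def)
  qed
  also have "\<dots> = tX \<omega> (up 1 a)" by (simp only: a up_def tX_eq fst_conv snd_conv add_Suc_right add_0_right One_nat_def)
  finally show ?thesis .
qed

lemma canon_up: "1 \<le> fst a \<Longrightarrow> canon (up n a) \<longleftrightarrow> canon a"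
  by (auto simp: canon_def up_def)

lemma Spine_pow_V: "1 \<le> fst a \<Longrightarrow> a \<in> tV ((Spine ^^ n) \<omega>) \<longleftrightarrow> up n a \<in> tV \<omega>"
proof (induction n arbitrary: a)
  case (Suc n)
  have "a \<in> tV ((Spine ^^ Suc n) \<omega>) \<longleftrightarrow> up 1 a \<in> tV ((Spine ^^ n) \<omega>)"
    using Spine_V[OF Suc.prems, of "(Spine ^^ n) \<omega>"] by simp
  also have "\<dots> \<longleftrightarrow> up n (up 1 a) \<in> tV \<omega>" by (rule Suc.IH) (simp add: up_def)
  finally show ?case by (simp add: up_def)
qed (simp add: up_def)

lemma Spine_pow_X:
  "\<exists>l. \<forall>a. 1 \<le> fst a \<longrightarrow> canon a \<longrightarrow> tX ((Spine ^^ n) \<omega>) a = wshift l (tX \<omega> (up n a))"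
proof (induction n)
  case 0
  then show ?case by (intro exI[of _ 0]) (auto simp: up_def wshift_def)
next
  case (Suc n)
  then obtain l where l: "\<And>a. 1 \<le> fst a \<Longrightarrow> canon a \<Longrightarrow> tX ((Spine ^^ n) \<omega>) a = wshift l (tX \<omega> (up n a))" by auto
  show ?case
  proof (intro exI allI impI)
    fix a assume a: "1 \<le> fst a" "canon a"
    show "tX ((Spine ^^ Suc n) \<omega>) a = wshift (l + fst (anc ((Spine ^^ n) \<omega>) 1)) (tX \<omega> (up (Suc n) a))"
      using Spine_X[OF a, of "(Spine ^^ n) \<omega>"] l[of "up 1 a"] a canon_up[of a 1] by (simp add: up_def)
  qed
qed

lemma Repl_V:
  assumes K2: "2 \<le> \<omega> (SK 1)" and c: "canon a"
  shows "a \<in> tV (Repl \<omega>) \<longleftrightarrow> old_repl a \<in> tV \<omega>"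
proof -
  obtain p w where a: "a = (p, w)" by (metis surj_pair)
  have g: "gw_set (\<lambda>u. Repl \<omega> (SXi (0, u))) = gw_set (\<lambda>u. \<omega> (SXi (Suc 0, Suc 0 # u)))"
    by (rule gw_set_cong) (simp add: Repl_def reindex_def Let_def)
  have g1: "gw_set (\<lambda>u. Repl \<omega> (SXi (Suc q, i # u))) = gw_set (\<lambda>u. \<omega> (SXi (Suc q, (if q = 0 then Suc i else i) # u)))" if "i \<noteq> 0" for q i
    by (rule gw_set_cong) (use that in \<open>simp add: Repl_def reindex_def Let_def\<close>)
  have K: "Repl \<omega> (SK (Suc (Suc q))) = \<omega> (SK (Suc (Suc q)))" "Repl \<omega> (SK (Suc 0)) = \<omega> (SK (Suc 0)) - 1" for q
    by (auto simp: Repl_def reindex_def Let_def)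
  show ?thesis
  proof (cases p)
    case 0 then show ?thesis using K2 by (auto simp: a old_repl_def tV_simps g)
  next
    case (Suc q)
    show ?thesis
    proof (cases w)
      case Nil then show ?thesis using Suc by (auto simp: a old_repl_def tV_simps)
    next
      case (Cons i v)
      then have "i \<noteq> 0" using c Suc by (auto simp: a canon_def)
      then show ?thesis using Suc Cons by (cases q) (auto simp: a old_repl_def tV_simps g1 K)
    qed
  qed
qed

text \<open>Of the two exchanged edges only the second survives, as the move of the first ancestor
  seen from its child of index 1. The first leads into the discarded branch and is never read
  again.\<close>

lemma Repl_X:
  assumes U: "\<And>j. 1 \<le> \<omega> (SU j)" and c: "canon a"
  shows "tX (Repl \<omega>) a = wshift (fst (tX \<omega> (1, [1]))) (tX \<omega> (old_repl a))"
proof -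
  define \<omega>1 where "\<omega>1 = exch (1, []) \<omega>"
  define \<omega>2 where "\<omega>2 = exch (1, [1]) \<omega>1"
  define l where "l = fst (tX \<omega> (1, [1]))"
  define l1 where "l1 = fst (anc \<omega> 1)"
  define l2 where "l2 = fst (wmove (tO \<omega>1) (\<omega>1 (SZ (1, [1]))))"
  have R: "Repl \<omega> s = reindex repl_ix \<omega>2 s" if "s \<noteq> SK 1" for s
    using that by (simp add: Repl_def Let_def \<omega>1_def \<omega>2_def)
  have o1: "tO \<omega>1 = wshift l1 (anc \<omega> 1)" unfolding \<omega>1_def l1_def exch_start by simp
  have z1: "\<omega>1 (SZ (1, [1])) = \<omega> (SZ (1, [1]))" by (simp add: \<omega>1_def)
  have y: "tX \<omega> (1, [1]) = wmove (anc \<omega> 1) (\<omega> (SZ (1, [1])))" by (simp add: tX_eq)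
  have l2: "l2 = l - l1" unfolding l2_def o1 z1 wmove_shift y[symmetric] by (simp add: wshift_def l_def)
  have o2: "tO \<omega>2 = wshift l (tX \<omega> (1, [1]))"
    unfolding \<omega>2_def exch_start l2_def[symmetric] unfolding o1 z1 wmove_shift y[symmetric] by (simp add: l2)
  have U1: "1 \<le> \<omega>1 (SU 0)" using U[of 1] by (auto simp: \<omega>1_def)
  have rev: "wmove (tO \<omega>2) (\<omega>2 (SZ (1, [1]))) = wshift l (anc \<omega> 1)"
    unfolding \<omega>2_def exch_reverse[of \<omega>1, OF U1] l2_def[symmetric] unfolding o1 by (simp add: l2)
  have o: "tO (Repl \<omega>) = tO \<omega>2"
    by (simp add: src_o_def R reindex_def)
  have Z0: "Repl \<omega> (SZ (0, v)) = \<omega> (SZ (1, 1 # v))" if "v \<noteq> []" for v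
    using that by (simp add: R reindex_def \<omega>1_def \<omega>2_def)
  have Z1: "Repl \<omega> (SZ (Suc 0, i # v)) = \<omega> (SZ (1, Suc i # v))" if "i \<noteq> 0" for i v
    using that by (simp add: R reindex_def \<omega>1_def \<omega>2_def)
  have Zr: "Repl \<omega> (SZ (Suc 0, [])) = \<omega>2 (SZ (1, [1]))" by (simp add: R reindex_def)
  have Z2: "Repl \<omega> (SZ (Suc (Suc q), v)) = \<omega> (SZ (Suc (Suc q), v))" if "v = [] \<or> hd v \<noteq> 0" for q v
    using that by (simp add: R reindex_def \<omega>1_def \<omega>2_def)
  have A: "anc (Repl \<omega>) (Suc q) = wshift l (anc \<omega> (Suc q))" for q
  proof (induction q)
    case 0
    then show ?case using rev by (simp add: o Zr)
  next
    case (Suc q)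
    have "anc (Repl \<omega>) (Suc (Suc q)) = wmove (anc (Repl \<omega>) (Suc q)) (\<omega> (SZ (Suc (Suc q), [])))" by (simp add: Z2)
    also have "\<dots> = wshift l (wmove (anc \<omega> (Suc q)) (\<omega> (SZ (Suc (Suc q), []))))" by (simp only: Suc wmove_shift)
    finally show ?case by simp
  qed
  obtain p w where a: "a = (p, w)" by (metis surj_pair)
  consider "p = 0" | i v where "p = 1" "w = i # v" | "p = Suc 0" "w = []" | q where "p = Suc (Suc q)"
    by (metis One_nat_def neq_Nil_conv not0_implies_Suc)
  then have "tX (Repl \<omega>) a = wshift l (tX \<omega> (old_repl a))"
  proof cases
    case 1
    have "tX (Repl \<omega>) a = wshift l (walk (\<lambda>a. Repl \<omega> (SZ a)) 0 [] (tX \<omega> (1, [1])) w)"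
      by (simp add: a 1 tX_eq[of "Repl \<omega>"] o o2 walk_shift)
    also have "walk (\<lambda>a. Repl \<omega> (SZ a)) 0 [] (tX \<omega> (1, [1])) w = walk (\<lambda>a. \<omega> (SZ a)) 1 [1] (tX \<omega> (1, [1])) w"
      by (rule walk_cong) (auto simp: Z0)
    also have "\<dots> = tX \<omega> (old_repl a)" by (simp add: a 1 old_repl_def tX_eq)
    finally show ?thesis .
  next
    case 2
    have i: "i \<noteq> 0" using c 2 by (auto simp: a canon_def)
    have "tX (Repl \<omega>) a = wshift l (walk (\<lambda>a. Repl \<omega> (SZ a)) 1 [i] (wmove (anc \<omega> 1) (Repl \<omega> (SZ (1, [i])))) v)"
      using A[of 0] by (simp add: a 2 tX_eq walk_shift wmove_shift del: anc_lab.simps)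
    also have "walk (\<lambda>a. Repl \<omega> (SZ a)) 1 [i] (wmove (anc \<omega> 1) (Repl \<omega> (SZ (1, [i])))) v =
       walk (\<lambda>a. \<omega> (SZ a)) 1 [Suc i] (wmove (anc \<omega> 1) (Repl \<omega> (SZ (1, [i])))) v"
      by (rule walk_cong) (use i in \<open>auto simp: Z1\<close>)
    also have "Repl \<omega> (SZ (1, [i])) = \<omega> (SZ (1, [Suc i]))" using Z1[OF i, of "[]"] by simp
    also have "walk (\<lambda>a. \<omega> (SZ a)) 1 [Suc i] (wmove (anc \<omega> 1) (\<omega> (SZ (1, [Suc i])))) v = tX \<omega> (old_repl a)"
      by (simp add: a 2 old_repl_def tX_eq)
    finally show ?thesis .
  next
    case 3
    then show ?thesis using A[of 0] by (simp add: a old_repl_def tX_eq)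
  next
    case (4 q)
    have "tX (Repl \<omega>) a = wshift l (walk (\<lambda>a. Repl \<omega> (SZ a)) (Suc (Suc q)) [] (anc \<omega> (Suc (Suc q))) w)"
      by (simp only: a 4 tX_eq A walk_shift)
    also have "walk (\<lambda>a. Repl \<omega> (SZ a)) (Suc (Suc q)) [] (anc \<omega> (Suc (Suc q))) w =
       walk (\<lambda>a. \<omega> (SZ a)) (Suc (Suc q)) [] (anc \<omega> (Suc (Suc q))) w"
    proof (rule walk_cong)
      fix v v' assume "w = v @ v'" "v \<noteq> []"
      then show "Repl \<omega> (SZ (Suc (Suc q), [] @ v)) = \<omega> (SZ (Suc (Suc q), [] @ v))"
        using Z2[of v q] c 4 a by (auto simp: canon_def)
    qed
    also have "\<dots> = tX \<omega> (old_repl a)" by (simp add: a 4 old_repl_def tX_eq)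
    finally show ?thesis .
  qed
  then show ?thesis unfolding l_def .
qed

abbreviation tF :: "(src \<Rightarrow> nat) \<Rightarrow> addr set" where "tF \<omega> \<equiv> {v \<in> tV \<omega>. fwd v}"

lemma fwd_root [simp]: "fwd root" by (simp add: fwd_def root_def)

lemma root_tV [simp]: "root \<in> tV \<omega>" by (simp add: root_def tV_simps)

lemma src_enum_eq: "src_enum idS \<omega> n = fenum (tF \<omega>) n"
proof -
  have "v \<in> tV \<omega> \<and> (v = root \<or> addr_less root v) \<longleftrightarrow> v \<in> tV \<omega> \<and> fwd v" for v
    using addr_less_root[OF tV_canon, of v \<omega>] by (cases "v \<in> tV \<omega>") auto
  then show ?thesis unfolding src_enum_def enum_from_eq by simp
qed

definition Y :: "(src \<Rightarrow> nat) \<Rightarrow> nat \<Rightarrow> wstar" where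
  "Y \<omega> n = tX \<omega> (fenum (tF \<omega>) n)"

lemma lt_succ_eqI:
  assumes "P r" "addr_less root r" "\<And>u. P u \<Longrightarrow> addr_less root u \<Longrightarrow> u = r \<or> addr_less r u"
  shows "lt_succ P root = r"
  unfolding lt_succ_def
proof (rule some_equality)
  fix v assume v: "P v \<and> addr_less root v \<and> (\<forall>u. P u \<and> addr_less root u \<longrightarrow> u = v \<or> addr_less v u)"
  then show "v = r" using assms addr_less_asym by metis
qed (use assms in auto)

lemma scc_theta:
  assumes r: "r \<in> tV \<omega>" "lt_succ (\<lambda>a. a \<in> tV \<omega>) root = r"
    and old: "\<And>a. canon a \<Longrightarrow> scc_old r a = old a"
    and V: "\<And>a. canon a \<Longrightarrow> a \<in> tV \<omega>' \<longleftrightarrow> old a \<in> tV \<omega>"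
    and X: "\<And>a. canon a \<Longrightarrow> tX \<omega>' a = wshift (fst (tX \<omega> r)) (tX \<omega> (old a))"
    and right: "\<And>a. canon a \<Longrightarrow> addr_sanc (old a) r \<or> old a = r \<or> addr_less r (old a)"
  shows "scc (theta idS \<omega>) = theta idS \<omega>'"
proof -
  have P: "canon a \<and> scc_old r a \<in> tV \<omega> \<and> (addr_sanc (scc_old r a) r \<or> scc_old r a = r \<or> addr_less r (scc_old r a))
     \<longleftrightarrow> a \<in> tV \<omega>'" for a
    using old[of a] V[of a] right[of a] tV_canon[of a \<omega>'] by (cases "canon a") auto
  have fs: "fst (theta idS \<omega>) = (\<lambda>a. a \<in> tV \<omega>)" by (simp add: theta_def encode_def)
  have "scc (theta idS \<omega>) = ((\<lambda>a. a \<in> tV \<omega>'),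
      (\<lambda>a. if a \<in> tV \<omega>' then fst (wshift (fst (snd (theta idS \<omega>)) r) (fst (snd (theta idS \<omega>)) (scc_old r a), snd (snd (theta idS \<omega>)) (scc_old r a))) else 0),
      (\<lambda>a. if a \<in> tV \<omega>' then snd (wshift (fst (snd (theta idS \<omega>)) r) (fst (snd (theta idS \<omega>)) (scc_old r a), snd (snd (theta idS \<omega>)) (scc_old r a))) else (\<lambda>_. 0)))"
    unfolding scc_def Let_def fs r P ..
  also have "\<dots> = theta idS \<omega>'"
  proof -
    have "scc_old r a = old a" "old a \<in> tV \<omega>" "tX \<omega>' a = wshift (fst (tX \<omega> r)) (tX \<omega> (old a))"
      if "a \<in> tV \<omega>'" for a
      using old V X tV_canon[OF that] that by auto
    then show ?thesis
      unfolding theta_def encode_def using r(1) by (auto simp: fun_eq_iff wshift_def)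
  qed
  finally show ?thesis .
qed

lemma rev_cases_addr:
  assumes "canon a"
  obtains w where "a = (0, w)" | q where "a = (Suc q, [])" | q i w where "a = (Suc q, i # w)" "i \<noteq> 0"
proof -
  obtain p w where a: "a = (p, w)" by (metis surj_pair)
  show thesis
    using that assms by (cases p; cases w) (auto simp: a canon_def)
qed

lemma fwd_simps [simp]: "fwd (0, w)" "fwd (p, []) \<longleftrightarrow> p = 0" "fwd (p, i # w) \<longleftrightarrow> p = 0 \<or> i \<noteq> 0"
  by (auto simp: fwd_def)

lemma canon_simps [simp]: "canon (0, w)" "canon (p, [])" "canon (p, i # w) \<longleftrightarrow> p = 0 \<or> i \<noteq> 0"
  by (auto simp: canon_def)

lemma scc_old_push:
  assumes c: "canon a"
  shows "scc_old (0, [0]) a = old_push a"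
proof (cases rule: rev_cases_addr[OF c, case_names own anc bush])
  case (own w) then show ?thesis by (simp add: scc_old_def gdecode_def gpath_def old_push_def Let_def)
next
  case (anc q) then show ?thesis
    by (cases q) (auto simp: scc_old_def gdecode_def gpath_def old_push_def Let_def)
next
  case (bush q i w) then show ?thesis
    by (cases q) (auto simp: scc_old_def gdecode_def gpath_def old_push_def Let_def)
qed

lemma scc_old_repl:
  assumes c: "canon a"
  shows "scc_old (Suc n, [1]) a = up n (old_repl a)"
proof (cases rule: rev_cases_addr[OF c, case_names own anc bush])
  case (own w) then show ?thesis by (simp add: scc_old_def gdecode_def gpath_def old_repl_def up_def Let_def)
next
  case (anc q) then show ?thesis
    by (cases q) (auto simp: scc_old_def gdecode_def gpath_def old_repl_def up_def Let_def)
next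
  case (bush q i w) then show ?thesis
    by (cases q) (auto simp: scc_old_def gdecode_def gpath_def old_repl_def up_def Let_def)
qed

lemma right_push:
  assumes c: "canon a"
  shows "addr_sanc (old_push a) (0, [0]) \<or> old_push a = (0, [0]) \<or> addr_less (0, [0]) (old_push a)"
proof (cases rule: rev_cases_addr[OF c, case_names own anc bush])
  case (own w) then show ?thesis by (auto simp: old_push_def addr_less_fwd)
next
  case (anc q) then show ?thesis by (auto simp: old_push_def addr_sanc_def gpath_def)
next
  case (bush q i w) then show ?thesis by (cases q) (auto simp: old_push_def addr_less_fwd)
qed

lemma right_repl:
  assumes c: "canon a"
  shows "addr_sanc (up n (old_repl a)) (Suc n, [1]) \<or> up n (old_repl a) = (Suc n, [1])
    \<or> addr_less (Suc n, [1]) (up n (old_repl a))"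
proof (cases rule: rev_cases_addr[OF c, case_names own anc bush])
  case (own w) then show ?thesis by (auto simp: old_repl_def up_def addr_less_fwd)
next
  case (anc q) then show ?thesis by (auto simp: old_repl_def up_def addr_sanc_def gpath_def)
next
  case (bush q i w) then show ?thesis by (cases q) (auto simp: old_repl_def up_def addr_less_fwd)
qed

lemma Spine_U: "(\<And>j. 1 \<le> \<omega> (SU j)) \<Longrightarrow> 1 \<le> (Spine ^^ n) \<omega> (SU j)"
proof (induction n arbitrary: j)
  case (Suc n)
  define \<omega>1 where "\<omega>1 = (Spine ^^ n) \<omega>"
  have "1 \<le> \<omega>1 (SU j)" for j unfolding \<omega>1_def using Suc by blast
  then have "1 \<le> Spine \<omega>1 (SU j)" by (auto simp: Spine_def reindex_def split: nat.splits)
  then show ?case by (simp add: \<omega>1_def)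
qed simp

lemma Spine_pow_K: "1 \<le> p \<Longrightarrow> (Spine ^^ n) \<omega> (SK p) = \<omega> (SK (p + n))"
proof (induction n arbitrary: p)
  case (Suc n)
  have "(Spine ^^ Suc n) \<omega> (SK p) = (Spine ^^ n) \<omega> (SK (Suc p))"
    using Suc.prems by (simp add: Spine_def reindex_def)
  then show ?case using Suc.IH[of "Suc p"] by simp
qed simp

text \<open>The common interface of \<open>Push\<close> and \<open>Pop\<close>. The clauses on
  canonical addresses identify the new tree with the image under \<open>scc\<close>; the last three
  say that \<open>old\<close> embeds the forward addresses monotonically and reaches every forward
  vertex but the root, as the enumeration requires.\<close>

definition rerooted :: "(src \<Rightarrow> nat) \<Rightarrow> (src \<Rightarrow> nat) \<Rightarrow> addr \<Rightarrow> (addr \<Rightarrow> addr) \<Rightarrow> bool" where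
  "rerooted \<omega> \<omega>' r old \<longleftrightarrow> r \<in> tV \<omega> \<and> lt_succ (\<lambda>a. a \<in> tV \<omega>) root = r \<and>
    (\<forall>a. canon a \<longrightarrow> scc_old r a = old a \<and> (a \<in> tV \<omega>' \<longleftrightarrow> old a \<in> tV \<omega>) \<and>
       tX \<omega>' a = wshift (fst (tX \<omega> r)) (tX \<omega> (old a)) \<and>
       (addr_sanc (old a) r \<or> old a = r \<or> addr_less r (old a))) \<and>
    (\<forall>u v. fwd u \<longrightarrow> fwd v \<longrightarrow> (addr_less u v \<longleftrightarrow> addr_less (old u) (old v))) \<and>
    (\<forall>u. fwd u \<longrightarrow> fwd (old u) \<and> old u \<noteq> root) \<and>
    (\<forall>v\<in>tF \<omega> - {root}. \<exists>u. fwd u \<and> old u = v)"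

lemma rerooted_Push:
  assumes U: "\<And>j. 1 \<le> \<omega> (SU j)" and k: "1 \<le> \<omega> (SXi (0, []))"
  shows "rerooted \<omega> (Push \<omega>) (0, [0]) old_push"
  unfolding rerooted_def
proof (intro conjI allI impI ballI)
  show r: "(0, [0]) \<in> tV \<omega>" using k by (simp add: tV_simps)
  show "lt_succ (\<lambda>a. a \<in> tV \<omega>) root = (0, [0])"
  proof (rule lt_succ_eqI)
    show "addr_less root (0, [0])" by (simp add: addr_less_fwd root_def)
    fix u assume u: "u \<in> tV \<omega>" "addr_less root u"
    then have c: "canon u" and "u \<noteq> root" "fwd u" using tV_canon[of u \<omega>] addr_less_root[of u] by auto
    from c show "u = (0, [0]) \<or> addr_less (0, [0]) u"
    proof (cases rule: rev_cases_addr[case_names own anc bush, consumes 1])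
      case (own w)
      then show ?thesis using \<open>u \<noteq> root\<close> by (cases w) (auto simp: root_def addr_less_fwd neq_Nil_conv)
    qed (use \<open>fwd u\<close> in \<open>auto simp: addr_less_fwd\<close>)
  qed (rule r)
next
  fix u v assume uv: "fwd u" "fwd v"
  show "addr_less u v \<longleftrightarrow> addr_less (old_push u) (old_push v)"
    by (rule rev_cases_addr[OF fwd_canon[OF uv(1)]]; rule rev_cases_addr[OF fwd_canon[OF uv(2)]])
       (use uv in \<open>auto simp: old_push_def addr_less_fwd\<close>)
next
  fix u assume u: "fwd u"
  show "fwd (old_push u)" "old_push u \<noteq> root"
    by (rule rev_cases_addr[OF fwd_canon[OF u]]; use u in \<open>auto simp: old_push_def root_def\<close>)+
next
  fix v assume v: "v \<in> tF \<omega> - {root}"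
  then have "canon v" using tV_canon[of v \<omega>] by auto
  then show "\<exists>u. fwd u \<and> old_push u = v"
  proof (cases rule: rev_cases_addr[case_names own anc bush, consumes 1])
    case (own w)
    then obtain i x where w: "w = i # x" using v by (cases w) (auto simp: root_def)
    then show ?thesis
      using own by (intro exI[of _ "if i = 0 then (0, x) else (1, w)"]) (auto simp: old_push_def)
  next
    case (anc q) then show ?thesis using v by auto
  next
    case (bush q i w)
    then show ?thesis by (intro exI[of _ "(Suc (Suc q), i # w)"]) (auto simp: old_push_def)
  qed
qed (use U k in \<open>auto simp: scc_old_push Push_V Push_X right_push\<close>)

text \<open>With a childless root, the first forward vertex after it lies in the first nonempty
  bush; minimality in \<open>pop_n\<close> locates that bush, and its least vertex is the child of
  index 1.\<close>

lemma rerooted_Pop: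
  assumes U: "\<And>j. 1 \<le> \<omega> (SU j)" and k: "\<omega> (SXi (0, [])) = 0" and ex: "\<exists>n. 2 \<le> \<omega> (SK (Suc n))"
  shows "rerooted \<omega> (Pop \<omega>) (Suc (pop_n \<omega>), [1]) (\<lambda>a. up (pop_n \<omega>) (old_repl a))"
proof -
  define n where "n = pop_n \<omega>"
  define \<omega>1 where "\<omega>1 = (Spine ^^ n) \<omega>"
  have n2: "2 \<le> \<omega> (SK (Suc n))" unfolding n_def pop_n_def by (rule LeastI_ex[OF ex])
  have nl: "n \<le> m" if "2 \<le> \<omega> (SK (Suc m))" for m unfolding n_def pop_n_def by (rule Least_le[where P="\<lambda>n. 2 \<le> \<omega> (SK (Suc n))", OF that])
  have K2: "2 \<le> \<omega>1 (SK 1)" using n2 Spine_pow_K[of 1 n \<omega>] by (simp add: \<omega>1_def)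
  have U1: "1 \<le> \<omega>1 (SU j)" for j unfolding \<omega>1_def by (rule Spine_U) (rule U)
  have P: "Pop \<omega> = Repl \<omega>1" by (simp add: Pop_def \<omega>1_def n_def)
  have f1: "1 \<le> fst (old_repl a)" for a by (auto simp: old_repl_def)
  have c1: "canon (old_repl a)" if "canon a" for a
    by (rule rev_cases_addr[OF that]) (auto simp: old_repl_def)
  obtain l where l: "\<And>a. 1 \<le> fst a \<Longrightarrow> canon a \<Longrightarrow> tX \<omega>1 a = wshift l (tX \<omega> (up n a))"
    using Spine_pow_X[of n \<omega>] unfolding \<omega>1_def by auto
  have r1: "tX \<omega>1 (1, [1]) = wshift l (tX \<omega> (Suc n, [1]))" using l[of "(1, [1])"] by (simp add: up_def)
  have ls: "l + fst (tX \<omega>1 (1, [1])) = fst (tX \<omega> (Suc n, [1]))" unfolding r1 by (simp add: wshift_def)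
  show ?thesis unfolding rerooted_def n_def[symmetric] P
  proof (intro conjI allI impI ballI)
    show r: "(Suc n, [1]) \<in> tV \<omega>" using n2 by (simp add: tV_simps)
    show "lt_succ (\<lambda>a. a \<in> tV \<omega>) root = (Suc n, [1])"
    proof (rule lt_succ_eqI)
      show "addr_less root (Suc n, [1])" by (simp add: addr_less_fwd root_def)
      fix u assume u: "u \<in> tV \<omega>" "addr_less root u"
      then have c: "canon u" and "u \<noteq> root" "fwd u" using tV_canon[of u \<omega>] addr_less_root[of u] by auto
      from c show "u = (Suc n, [1]) \<or> addr_less (Suc n, [1]) u"
      proof (cases rule: rev_cases_addr[case_names own anc bush, consumes 1])
        case (own w)
        then show ?thesis using \<open>u \<noteq> root\<close> u k by (cases w) (auto simp: root_def tV_simps)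
      next
        case (bush q i w)
        then have "n \<le> q" using u by (intro nl) (auto simp: tV_simps)
        then show ?thesis using bush by (cases w) (auto simp: addr_less_fwd)
      qed (use \<open>fwd u\<close> in auto)
    qed (rule r)
  next
    fix a assume a: "canon a"
    show "scc_old (Suc n, [1]) a = up n (old_repl a)" by (rule scc_old_repl[OF a])
    show "a \<in> tV (Repl \<omega>1) \<longleftrightarrow> up n (old_repl a) \<in> tV \<omega>"
      unfolding Repl_V[of \<omega>1, OF K2 a] unfolding \<omega>1_def by (rule Spine_pow_V[OF f1])
    have "tX (Repl \<omega>1) a = wshift (fst (tX \<omega>1 (1, [1]))) (tX \<omega>1 (old_repl a))" by (rule Repl_X[of \<omega>1, OF U1 a])
    also have "tX \<omega>1 (old_repl a) = wshift l (tX \<omega> (up n (old_repl a)))" by (rule l[OF f1 c1[OF a]])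
    finally show "tX (Repl \<omega>1) a = wshift (fst (tX \<omega> (Suc n, [1]))) (tX \<omega> (up n (old_repl a)))"
      by (simp only: ls wshift_wshift)
    show "addr_sanc (up n (old_repl a)) (Suc n, [1]) \<or> up n (old_repl a) = (Suc n, [1])
       \<or> addr_less (Suc n, [1]) (up n (old_repl a))" by (rule right_repl[OF a])
  next
    fix u v assume uv: "fwd u" "fwd v"
    show "addr_less u v \<longleftrightarrow> addr_less (up n (old_repl u)) (up n (old_repl v))"
      by (rule rev_cases_addr[OF fwd_canon[OF uv(1)]]; rule rev_cases_addr[OF fwd_canon[OF uv(2)]])
         (use uv in \<open>auto simp: old_repl_def up_def addr_less_fwd\<close>)
  next
    fix u assume u: "fwd u"
    show "fwd (up n (old_repl u))" "up n (old_repl u) \<noteq> root"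
      by (rule rev_cases_addr[OF fwd_canon[OF u]]; use u in \<open>auto simp: old_repl_def up_def root_def\<close>)+
  next
    fix v assume v: "v \<in> tF \<omega> - {root}"
    then have "canon v" using tV_canon[of v \<omega>] by auto
    then show "\<exists>u. fwd u \<and> up n (old_repl u) = v"
    proof (cases rule: rev_cases_addr[case_names own anc bush, consumes 1])
      case (own w)
      then show ?thesis using v k by (cases w) (auto simp: root_def tV_simps)
    next
      case (anc q) then show ?thesis using v by auto
    next
      case (bush q i w)
      then have nq: "n \<le> q" using v by (intro nl) (auto simp: tV_simps)
      show ?thesis
      proof (cases "q = n")
        case True
        then show ?thesis using bush
          by (intro exI[of _ "if i = 1 then (0, w) else (1, (i - 1) # w)"]) (auto simp: old_repl_def up_def)
      next
        case False
        then show ?thesis using bush nq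
          by (intro exI[of _ "(Suc (q - n), i # w)"]) (auto simp: old_repl_def up_def)
      qed
    qed
  qed
qed

lemma rerooted_Succ:
  assumes "\<And>j. 1 \<le> \<omega> (SU j)" "1 \<le> \<omega> (SXi (0, [])) \<or> (\<exists>n. 2 \<le> \<omega> (SK (Suc n)))"
  shows "\<exists>r old. rerooted \<omega> (Succ \<omega>) r old"
proof (cases "1 \<le> \<omega> (SXi (0, []))")
  case True
  then show ?thesis using rerooted_Push[of \<omega>, OF assms(1)] by (auto simp: Succ_def)
next
  case False
  then show ?thesis using rerooted_Pop[of \<omega>, OF assms(1)] assms(2) by (auto simp: Succ_def)
qed

lemma rerootedD:
  assumes "rerooted \<omega> \<omega>' r old"
  shows "r \<in> tV \<omega>" "lt_succ (\<lambda>a. a \<in> tV \<omega>) root = r"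
    and "canon a \<Longrightarrow> scc_old r a = old a" "canon a \<Longrightarrow> a \<in> tV \<omega>' \<longleftrightarrow> old a \<in> tV \<omega>"
    and "canon a \<Longrightarrow> tX \<omega>' a = wshift (fst (tX \<omega> r)) (tX \<omega> (old a))"
    and "canon a \<Longrightarrow> addr_sanc (old a) r \<or> old a = r \<or> addr_less r (old a)"
    and "fwd u \<Longrightarrow> fwd v \<Longrightarrow> addr_less u v \<longleftrightarrow> addr_less (old u) (old v)"
    and "fwd u \<Longrightarrow> fwd (old u)" "fwd u \<Longrightarrow> old u \<noteq> root"
    and "v \<in> tF \<omega> - {root} \<Longrightarrow> \<exists>u. fwd u \<and> old u = v"
proof -
  note R = assms[unfolded rerooted_def]
  note R3 = R[THEN conjunct2, THEN conjunct2, THEN conjunct1, rule_format]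
  note R4 = R[THEN conjunct2, THEN conjunct2, THEN conjunct2, THEN conjunct1, rule_format]
  note R5 = R[THEN conjunct2, THEN conjunct2, THEN conjunct2, THEN conjunct2, THEN conjunct1, rule_format]
  note R6 = R[THEN conjunct2, THEN conjunct2, THEN conjunct2, THEN conjunct2, THEN conjunct2, rule_format]
  show "r \<in> tV \<omega>" "lt_succ (\<lambda>a. a \<in> tV \<omega>) root = r"
    by (fact R[THEN conjunct1] R[THEN conjunct2, THEN conjunct1])+
  show "canon a \<Longrightarrow> scc_old r a = old a" "canon a \<Longrightarrow> a \<in> tV \<omega>' \<longleftrightarrow> old a \<in> tV \<omega>"
    "canon a \<Longrightarrow> tX \<omega>' a = wshift (fst (tX \<omega> r)) (tX \<omega> (old a))"
    "canon a \<Longrightarrow> addr_sanc (old a) r \<or> old a = r \<or> addr_less r (old a)"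
    using R3[of a] by simp_all
  show "fwd u \<Longrightarrow> fwd v \<Longrightarrow> addr_less u v \<longleftrightarrow> addr_less (old u) (old v)" by (rule R4)
  show "fwd u \<Longrightarrow> fwd (old u)" "fwd u \<Longrightarrow> old u \<noteq> root" using R5[of u] by simp_all
  show "v \<in> tF \<omega> - {root} \<Longrightarrow> \<exists>u. fwd u \<and> old u = v" by (rule R6)
qed

lemma rerooted_scc:
  assumes "rerooted \<omega> \<omega>' r old"
  shows "scc (theta idS \<omega>) = theta idS \<omega>'"
  by (rule scc_theta[where r=r and old=old]) (fact rerootedD[OF assms])+

text \<open>The root is the initial segment that disappears. The shift of heights is common to all
  indices, so coincidences between labels are those of the old sequence started at index 1.\<close>

lemma rerooted_enum:
  assumes R: "rerooted \<omega> \<omega>' r old" and W: "wellenum (tF \<omega>)"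
  shows "\<exists>l. \<forall>n. Y \<omega>' n = wshift l (Y \<omega> (Suc n))"
proof -
  note V = rerootedD(4)[OF R] and X = rerootedD(5)[OF R] and ord = rerootedD(7)[OF R]
    and fo = rerootedD(8,9)[OF R] and sj = rerootedD(10)[OF R]
  have bij: "bij_betw old (tF \<omega>') (tF \<omega> - {root})"
    unfolding bij_betw_def
  proof
    show "inj_on old (tF \<omega>')"
    proof (rule inj_onI, rule ccontr)
      fix u v assume uv: "u \<in> tF \<omega>'" "v \<in> tF \<omega>'" "old u = old v" "u \<noteq> v"
      then have "addr_less (old u) (old v) \<or> addr_less (old v) (old u)"
        using fwd_total[of u v] ord[of u v] ord[of v u] by auto
      then show False using uv fwd_irrefl by auto
    qed
    show "old ` tF \<omega>' = tF \<omega> - {root}"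
    proof (intro equalityI subsetI)
      fix v assume "v \<in> old ` tF \<omega>'"
      then obtain u where u: "u \<in> tV \<omega>'" "fwd u" "v = old u" by auto
      then show "v \<in> tF \<omega> - {root}" using fo[OF u(2)] V[OF fwd_canon[OF u(2)]] by simp
    next
      fix v assume v: "v \<in> tF \<omega> - {root}"
      then obtain u where u: "fwd u" "old u = v" using sj[OF v] by blast
      then have "u \<in> tF \<omega>'" using V[OF fwd_canon[OF u(1)]] v by auto
      then show "v \<in> old ` tF \<omega>'" using u by blast
    qed
  qed
  have less: "addr_less u v" if "u \<in> {root}" "v \<in> tF \<omega> - {root}" for u v
    using that addr_less_root[OF fwd_canon, of v] by auto
  have W': "wellenum (tF \<omega>')"
    by (rule fenum_transfer(1)[OF W _ _ less bij]) (use ord in auto)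
  have tr: "fenum (tF \<omega>) (card {root} + n) = old (fenum (tF \<omega>') n)" for n
    by (rule fenum_transfer(2)[OF W _ _ less bij]) (use ord in auto)
  have "Y \<omega>' n = wshift (fst (tX \<omega> r)) (Y \<omega> (Suc n))" for n
  proof -
    have "canon (fenum (tF \<omega>') n)" using fenum_props[OF W', of n] fwd_canon by auto
    then show ?thesis unfolding Y_def using tr[of n] by (simp add: X)
  qed
  then show ?thesis by blast
qed

text \<open>Outside levels 0 and 1 of the old tree and level 0 of the new one, the forward vertices
  correspond to each other with a common shift of heights; the levels left out are finite.\<close>

lemma Spine_enum:
  assumes W: "wellenum (tF \<omega>)" and W': "wellenum (tF (Spine \<omega>))"
    and fin: "finite {v \<in> tF \<omega>. fst v \<le> 1}" "finite {v \<in> tF (Spine \<omega>). fst v = 0}"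
  shows "\<exists>l N N'. \<forall>n. Y (Spine \<omega>) (N' + n) = wshift l (Y \<omega> (N + n))"
proof -
  let ?A = "{v \<in> tF \<omega>. fst v \<le> 1}" and ?A' = "{v \<in> tF (Spine \<omega>). fst v = 0}"
  let ?B = "{v \<in> tF (Spine \<omega>). 1 \<le> fst v}"
  have fu: "fwd (up 1 v) \<longleftrightarrow> fwd v" if "1 \<le> fst v" for v using that by (auto simp: fwd_def up_def)
  have bij: "bij_betw (up 1) ?B (tF \<omega> - ?A)"
    unfolding bij_betw_def
  proof
    show "inj_on (up 1) ?B" by (auto simp: inj_on_def up_def)
    show "up 1 ` ?B = tF \<omega> - ?A"
    proof (intro equalityI subsetI)
      fix v assume "v \<in> up 1 ` ?B"
      then obtain u where u: "u \<in> ?B" "v = up 1 u" by blast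
      then show "v \<in> tF \<omega> - ?A" using Spine_V[of u \<omega>] fu[of u] by (auto simp: up_def)
    next
      fix v assume v: "v \<in> tF \<omega> - ?A"
      define u where "u = (fst v - 1, snd v)"
      have u: "v = up 1 u" "1 \<le> fst u" using v by (auto simp: u_def up_def)
      then have "u \<in> ?B" using v Spine_V[of u \<omega>] fu[of u] by auto
      then show "v \<in> up 1 ` ?B" using u by blast
    qed
  qed
  have ord: "addr_less u v \<longleftrightarrow> addr_less (up 1 u) (up 1 v)" if "u \<in> ?B" "v \<in> ?B" for u v
    using that fu[of u] fu[of v] by (simp add: addr_less_fwd) (auto simp: up_def)
  have less: "addr_less u v" if "u \<in> ?A" "v \<in> tF \<omega> - ?A" for u v using that by (auto simp: addr_less_fwd)
  have WB: "wellenum ?B" by (rule fenum_transfer(1)[OF W _ fin(1) less bij _ ord]) auto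
  have t1: "fenum (tF \<omega>) (card ?A + n) = up 1 (fenum ?B n)" for n
    by (rule fenum_transfer(2)[OF W _ fin(1) less bij _ ord]) auto
  have eq: "tF (Spine \<omega>) - ?A' = ?B" by auto
  have less': "addr_less u v" if "u \<in> ?A'" "v \<in> tF (Spine \<omega>) - ?A'" for u v using that by (auto simp: addr_less_fwd)
  have bij': "bij_betw (\<lambda>x. x) ?B (tF (Spine \<omega>) - ?A')" unfolding eq by (simp add: bij_betw_def)
  have t2: "fenum (tF (Spine \<omega>)) (card ?A' + n) = fenum ?B n" for n
    by (rule fenum_transfer(2)[OF W' _ fin(2) less' bij']) auto
  have "Y (Spine \<omega>) (card ?A' + n) = wshift (fst (anc \<omega> 1)) (Y \<omega> (card ?A + n))" for n
  proof -
    have "fenum ?B n \<in> ?B" using fenum_props[OF WB, of n] by auto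
    then have "1 \<le> fst (fenum ?B n)" "canon (fenum ?B n)" using fwd_canon by auto
    then show ?thesis unfolding Y_def t1 t2 by (rule Spine_X)
  qed
  then show ?thesis by blast
qed

subsection \<open>Measurability\<close>

text \<open>Labels carry an infinite sequence of letters and form an uncountable type, so
  measurability is stated for the height and for each letter.\<close>

definition wmeas :: "'a measure \<Rightarrow> ('a \<Rightarrow> wstar) \<Rightarrow> bool" where
  "wmeas M f \<longleftrightarrow> (\<lambda>\<omega>. fst (f \<omega>)) \<in> M \<rightarrow>\<^sub>M count_space UNIV \<and>
     (\<forall>j. (\<lambda>\<omega>. snd (f \<omega>) j) \<in> M \<rightarrow>\<^sub>M count_space UNIV)"

lemma wmeasI: "(\<lambda>\<omega>. fst (f \<omega>)) \<in> M \<rightarrow>\<^sub>M count_space UNIV \<Longrightarrow>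
    (\<And>j. (\<lambda>\<omega>. snd (f \<omega>) j) \<in> M \<rightarrow>\<^sub>M count_space UNIV) \<Longrightarrow> wmeas M f"
  by (simp add: wmeas_def)

lemma wmeasD: "wmeas M f \<Longrightarrow> (\<lambda>\<omega>. fst (f \<omega>)) \<in> M \<rightarrow>\<^sub>M count_space UNIV"
    "wmeas M f \<Longrightarrow> (\<lambda>\<omega>. snd (f \<omega>) j) \<in> M \<rightarrow>\<^sub>M count_space UNIV"
  by (simp_all add: wmeas_def)

lemma wmeas_wmove:
  assumes f: "wmeas M f" and z [measurable]: "z \<in> M \<rightarrow>\<^sub>M count_space UNIV"
  shows "wmeas M (\<lambda>\<omega>. wmove (f \<omega>) (z \<omega>))"
proof (rule wmeasI)
  note [measurable] = wmeasD[OF f]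
  have "(\<lambda>\<omega>. fst (wmove (f \<omega>) (z \<omega>))) = (\<lambda>\<omega>. if z \<omega> = 0 then fst (f \<omega>) - 1 else fst (f \<omega>) + 1)"
    by (auto simp: wmove_def wparent_def wchild_def)
  then show "(\<lambda>\<omega>. fst (wmove (f \<omega>) (z \<omega>))) \<in> M \<rightarrow>\<^sub>M count_space UNIV" by simp
  fix j
  have "(\<lambda>\<omega>. snd (wmove (f \<omega>) (z \<omega>)) j) =
     (\<lambda>\<omega>. if z \<omega> = 0 then snd (f \<omega>) (Suc j) else if j = 0 then z \<omega> else snd (f \<omega>) (j - 1))"
    by (auto simp: wmove_def wparent_def wchild_def split: nat.splits)
  then show "(\<lambda>\<omega>. snd (wmove (f \<omega>) (z \<omega>)) j) \<in> M \<rightarrow>\<^sub>M count_space UNIV" by simp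
qed

lemma pred_eq_countable:
  fixes u v :: "'a \<Rightarrow> 'b::countable"
  assumes [measurable]: "u \<in> M \<rightarrow>\<^sub>M count_space UNIV" "v \<in> M \<rightarrow>\<^sub>M count_space UNIV"
  shows "Measurable.pred M (\<lambda>\<omega>. u \<omega> = v \<omega>)"
  by measurable

lemma pred_wmeas_eq:
  assumes "wmeas M f" "wmeas M g"
  shows "Measurable.pred M (\<lambda>\<omega>. f \<omega> = g \<omega>)"
proof -
  have "(\<lambda>\<omega>. f \<omega> = g \<omega>) = (\<lambda>\<omega>. fst (f \<omega>) = fst (g \<omega>) \<and> (\<forall>j. snd (f \<omega>) j = snd (g \<omega>) j))"
    by (auto simp: prod_eq_iff fun_eq_iff)
  also have "Measurable.pred M \<dots>"
    by (intro pred_intros_logic pred_intros_countable pred_eq_countable wmeasD assms)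
  finally show ?thesis .
qed

lemma wmeas_countable:
  fixes f :: "'i::countable \<Rightarrow> 'a \<Rightarrow> wstar"
  assumes f: "\<And>a. wmeas M (f a)" and g: "g \<in> M \<rightarrow>\<^sub>M count_space UNIV"
  shows "wmeas M (\<lambda>\<omega>. f (g \<omega>) \<omega>)"
proof (rule wmeasI)
  show "(\<lambda>\<omega>. fst (f (g \<omega>) \<omega>)) \<in> M \<rightarrow>\<^sub>M count_space UNIV"
    by (rule measurable_compose_countable[where f="\<lambda>a \<omega>. fst (f a \<omega>)", OF wmeasD(1)[OF f] g])
  show "(\<lambda>\<omega>. snd (f (g \<omega>) \<omega>) j) \<in> M \<rightarrow>\<^sub>M count_space UNIV" for j
    by (rule measurable_compose_countable[where f="\<lambda>a \<omega>. snd (f a \<omega>) j", OF wmeasD(2)[OF f] g])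
qed

locale src_meas =
  fixes M :: "'a measure" and S :: "src \<Rightarrow> 'a \<Rightarrow> nat"
  assumes S_meas [measurable]: "\<And>s. S s \<in> M \<rightarrow>\<^sub>M count_space UNIV"
begin

lemma pred_src_V [measurable]: "Measurable.pred M (\<lambda>\<omega>. a \<in> src_V S \<omega>)"
  unfolding src_V_def ipgw_set_def gw_set_def by (cases a) simp

lemma wmeas_src_o: "wmeas M (src_o S)"
  by (rule wmeasI) (auto simp: src_o_def)

lemma wmeas_anc: "wmeas M (\<lambda>\<omega>. anc_lab (\<lambda>a. S (SZ a) \<omega>) (src_o S \<omega>) p)"
  by (induction p) (auto intro!: wmeas_wmove wmeas_src_o)

lemma wmeas_walk: "wmeas M f \<Longrightarrow> wmeas M (\<lambda>\<omega>. walk (\<lambda>a. S (SZ a) \<omega>) p u (f \<omega>) w)"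
proof (induction w arbitrary: u f)
  case (Cons i w)
  then show ?case using Cons.IH[OF wmeas_wmove[OF Cons.prems S_meas]] by simp
qed simp

lemma wmeas_src_X: "wmeas M (\<lambda>\<omega>. src_X S \<omega> a)"
  unfolding src_X_def brw_lab_def by (intro wmeas_walk wmeas_anc)

lemma measurable_theta [measurable]: "theta S \<in> M \<rightarrow>\<^sub>M TM"
proof -
  note [measurable] = wmeasD[OF wmeas_src_X]
  have "(\<lambda>\<omega> a. a \<in> src_V S \<omega>) \<in> M \<rightarrow>\<^sub>M PiM UNIV (\<lambda>_. count_space UNIV)"
    by (rule measurable_PiM_single') auto
  moreover have "(\<lambda>\<omega> a. if a \<in> src_V S \<omega> then fst (src_X S \<omega> a) else 0) \<in> M \<rightarrow>\<^sub>M PiM UNIV (\<lambda>_. count_space UNIV)"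
    by (rule measurable_PiM_single') auto
  moreover have "(\<lambda>\<omega> a. if a \<in> src_V S \<omega> then snd (src_X S \<omega> a) else (\<lambda>_. 0)) \<in> M \<rightarrow>\<^sub>M PiM UNIV (\<lambda>_. PiM UNIV (\<lambda>_. count_space UNIV))"
  proof (rule measurable_PiM_single')
    fix a
    have "(\<lambda>\<omega> j. if a \<in> src_V S \<omega> then snd (src_X S \<omega> a) j else 0) \<in> M \<rightarrow>\<^sub>M PiM UNIV (\<lambda>_. count_space UNIV)"
      by (rule measurable_PiM_single') auto
    also have "(\<lambda>\<omega> j. if a \<in> src_V S \<omega> then snd (src_X S \<omega> a) j else 0) = (\<lambda>\<omega>. if a \<in> src_V S \<omega> then snd (src_X S \<omega> a) else (\<lambda>_. 0))"
      by (auto simp: fun_eq_iff)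
    finally show "(\<lambda>\<omega>. if a \<in> src_V S \<omega> then snd (src_X S \<omega> a) else (\<lambda>_. 0)) \<in> M \<rightarrow>\<^sub>M PiM UNIV (\<lambda>_. count_space UNIV)" .
  qed (auto simp: space_PiM)
  ultimately show ?thesis
    unfolding theta_def[abs_def] encode_def TM_def by (intro measurable_Pair)
qed

lemma measurable_src_enum [measurable]: "(\<lambda>\<omega>. src_enum S \<omega> n) \<in> M \<rightarrow>\<^sub>M count_space UNIV"
  unfolding src_enum_def enum_from_def
proof (rule measurable_THE[where I=UNIV])
  fix v
  \<comment> \<open>Lists turn finiteness and cardinality into a quantifier over a countable
    type.\<close>
  have eq: "finite A \<and> card A = n \<longleftrightarrow> (\<exists>xs. distinct xs \<and> length xs = n \<and> (\<forall>u. u \<in> A \<longleftrightarrow> u \<in> set xs))" for A :: "addr set"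
    by (metis List.finite_set distinct_card finite_distinct_list set_eqI)
  show "Measurable.pred M (\<lambda>\<omega>. v \<in> src_V S \<omega> \<and> (v = root \<or> addr_less root v) \<and>
      finite {u. u \<in> src_V S \<omega> \<and> (u = root \<or> addr_less root u) \<and> addr_less u v} \<and>
      card {u. u \<in> src_V S \<omega> \<and> (u = root \<or> addr_less root u) \<and> addr_less u v} = n)"
    unfolding eq mem_Collect_eq by measurable
next
  fix \<omega> u v
  let ?F = "{u. u \<in> src_V S \<omega> \<and> (u = root \<or> addr_less root u)}"
  have c: "canon a" if "a \<in> src_V S \<omega>" for a
    using that by (auto simp: src_V_def ipgw_set_def canon_def)
  have F: "?F \<subseteq> Collect fwd" using c addr_less_root by auto
  have eq: "{u. u \<in> src_V S \<omega> \<and> (u = root \<or> addr_less root u) \<and> addr_less u v} = {u \<in> ?F. addr_less u v}" for v by auto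
  assume "u \<in> src_V S \<omega> \<and> (u = root \<or> addr_less root u) \<and>
      finite {x. x \<in> src_V S \<omega> \<and> (x = root \<or> addr_less root x) \<and> addr_less x u} \<and>
      card {x. x \<in> src_V S \<omega> \<and> (x = root \<or> addr_less root x) \<and> addr_less x u} = n"
    "v \<in> src_V S \<omega> \<and> (v = root \<or> addr_less root v) \<and>
      finite {x. x \<in> src_V S \<omega> \<and> (x = root \<or> addr_less root x) \<and> addr_less x v} \<and>
      card {x. x \<in> src_V S \<omega> \<and> (x = root \<or> addr_less root x) \<and> addr_less x v} = n"
  then show "u = v" unfolding eq by (intro rank_inj[OF F]) (auto simp: rank_def)
qed auto

lemma wmeas_enum: "wmeas M (\<lambda>\<omega>. src_X S \<omega> (src_enum S \<omega> n))"
  by (rule wmeas_countable[where f="\<lambda>a \<omega>. src_X S \<omega> a"]) (auto intro: wmeas_src_X)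

lemma pred_no_return:
  "Measurable.pred M (\<lambda>\<omega>. \<forall>n\<ge>1. src_X S \<omega> (src_enum S \<omega> n) \<noteq> src_o S \<omega>)"
proof -
  note [measurable] = pred_wmeas_eq[OF wmeas_enum wmeas_src_o]
  show ?thesis by measurable
qed

end

lemma TM_coord [measurable]:
  "(\<lambda>T. fst T a) \<in> TM \<rightarrow>\<^sub>M count_space UNIV"
  "(\<lambda>T. fst (snd T) a) \<in> TM \<rightarrow>\<^sub>M count_space UNIV"
  "(\<lambda>T. snd (snd T) a j) \<in> TM \<rightarrow>\<^sub>M count_space UNIV"
proof -
  have c: "(\<lambda>f. f i) \<in> PiM UNIV (\<lambda>_. N) \<rightarrow>\<^sub>M N" for i and N :: "'b measure"
    by (rule measurable_component_singleton) simp
  show "(\<lambda>T. fst T a) \<in> TM \<rightarrow>\<^sub>M count_space UNIV"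
    unfolding TM_def by (rule measurable_compose[OF measurable_fst c])
  show "(\<lambda>T. fst (snd T) a) \<in> TM \<rightarrow>\<^sub>M count_space UNIV"
    unfolding TM_def by (rule measurable_compose[OF measurable_snd measurable_compose[OF measurable_fst c]])
  show "(\<lambda>T. snd (snd T) a j) \<in> TM \<rightarrow>\<^sub>M count_space UNIV"
    unfolding TM_def
    by (rule measurable_compose[OF measurable_snd measurable_compose[OF measurable_snd measurable_compose[OF c c]]])
qed

lemma measurable_scc [measurable]: "scc \<in> TM \<rightarrow>\<^sub>M TM"
proof -
  define r where "r T = lt_succ (fst T) root" for T :: ltree
  have [measurable]: "r \<in> TM \<rightarrow>\<^sub>M count_space UNIV"
  proof -
    define Q where "Q v T \<longleftrightarrow> fst T v \<and> addr_less root v \<and> (\<forall>u. fst T u \<and> addr_less root u \<longrightarrow> u = v \<or> addr_less v u)"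
      for v and T :: ltree
    have [measurable]: "Measurable.pred TM (Q v)" for v unfolding Q_def[abs_def] by measurable
    have u: "u = v" if "Q u T" "Q v T" for u v T
      using that addr_less_asym unfolding Q_def by blast
    have "(\<lambda>T. THE v. Q v T) \<in> TM \<rightarrow>\<^sub>M count_space UNIV"
      by (rule measurable_THE[where I=UNIV]) (use u in auto)
    \<comment> \<open>A successor is unique, so the choice in \<open>lt_succ\<close> is a definite
      description where a successor exists, and a fixed constant elsewhere.\<close>
    then have "(\<lambda>T. if \<exists>v. Q v T then THE v. Q v T else SOME v. False) \<in> TM \<rightarrow>\<^sub>M count_space UNIV"
      by measurable
    also have "(\<lambda>T. if \<exists>v. Q v T then THE v. Q v T else SOME v. False) = r"
    proof
      fix T
      have r: "r T = (SOME v. Q v T)" unfolding r_def lt_succ_def Q_def ..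
      show "(if \<exists>v. Q v T then THE v. Q v T else SOME v. False) = r T"
      proof (cases "\<exists>v. Q v T")
        case True
        then obtain v where v: "Q v T" by auto
        have "(THE v. Q v T) = v" by (rule the_equality[where P="\<lambda>v. Q v T", OF v]) (rule u[OF _ v])
        moreover have "(SOME v. Q v T) = v" by (rule some_equality[where P="\<lambda>v. Q v T", OF v]) (rule u[OF _ v])
        ultimately show ?thesis using True r by simp
      next
        case False
        then have "(\<lambda>v. Q v T) = (\<lambda>v. False)" by blast
        then show ?thesis using False r by simp
      qed
    qed
    finally show ?thesis .
  qed
  define PP where "PP a r T \<longleftrightarrow> canon a \<and> fst T (scc_old r a) \<and>
      (addr_sanc (scc_old r a) r \<or> scc_old r a = r \<or> addr_less r (scc_old r a))" for a r and T :: ltree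
  have [measurable]: "Measurable.pred TM (\<lambda>T. PP a (r T) T)" for a
    by (rule measurable_compose_countable[where g=r]) (auto simp: PP_def)
  have [measurable]: "(\<lambda>T. fst (snd T) (r T)) \<in> TM \<rightarrow>\<^sub>M count_space UNIV"
    by (rule measurable_compose_countable[where g=r and f="\<lambda>r T. fst (snd T) r"]) auto
  have [measurable]: "(\<lambda>T. fst (snd T) (scc_old (r T) a)) \<in> TM \<rightarrow>\<^sub>M count_space UNIV" for a
    by (rule measurable_compose_countable[where g=r and f="\<lambda>r T. fst (snd T) (scc_old r a)"]) auto
  have [measurable]: "(\<lambda>T. snd (snd T) (scc_old (r T) a) j) \<in> TM \<rightarrow>\<^sub>M count_space UNIV" for a j
    by (rule measurable_compose_countable[where g=r and f="\<lambda>r T. snd (snd T) (scc_old r a) j"]) auto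
  have m1: "(\<lambda>T a. PP a (r T) T) \<in> TM \<rightarrow>\<^sub>M PiM UNIV (\<lambda>_. count_space UNIV)"
    by (rule measurable_PiM_single') auto
  have m2: "(\<lambda>T a. if PP a (r T) T then fst (snd T) (scc_old (r T) a) - fst (snd T) (r T) else 0) \<in> TM \<rightarrow>\<^sub>M PiM UNIV (\<lambda>_. count_space UNIV)"
    by (rule measurable_PiM_single') auto
  have m3: "(\<lambda>T a. if PP a (r T) T then snd (snd T) (scc_old (r T) a) else (\<lambda>_. 0)) \<in> TM \<rightarrow>\<^sub>M PiM UNIV (\<lambda>_. PiM UNIV (\<lambda>_. count_space UNIV))"
  proof (rule measurable_PiM_single')
    fix a
    have "(\<lambda>T j. if PP a (r T) T then snd (snd T) (scc_old (r T) a) j else 0) \<in> TM \<rightarrow>\<^sub>M PiM UNIV (\<lambda>_. count_space UNIV)"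
      by (rule measurable_PiM_single') auto
    also have "(\<lambda>T j. if PP a (r T) T then snd (snd T) (scc_old (r T) a) j else 0) = (\<lambda>T. if PP a (r T) T then snd (snd T) (scc_old (r T) a) else (\<lambda>_. 0))"
      by (auto simp: fun_eq_iff)
    finally show "(\<lambda>T. if PP a (r T) T then snd (snd T) (scc_old (r T) a) else (\<lambda>_. 0)) \<in> TM \<rightarrow>\<^sub>M PiM UNIV (\<lambda>_. count_space UNIV)" .
  qed (auto simp: space_PiM)
  have eq: "scc = (\<lambda>T. (\<lambda>a. PP a (r T) T, \<lambda>a. if PP a (r T) T then fst (snd T) (scc_old (r T) a) - fst (snd T) (r T) else 0,
     \<lambda>a. if PP a (r T) T then snd (snd T) (scc_old (r T) a) else (\<lambda>_. 0)))"
    by (rule ext) (simp only: scc_def Let_def r_def PP_def wshift_def fst_conv snd_conv)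
  show ?thesis unfolding eq
    using measurable_Pair[OF m1 measurable_Pair[OF m2 m3]] unfolding TM_def[symmetric] .
qed

text \<open>Allows given sources to be compared with those of \<open>Pr\<close>, which are 0 outside
  \<open>used\<close>.\<close>

lemma tV_cong_used:
  assumes "\<And>s. s \<in> used \<Longrightarrow> \<omega> s = \<omega>' s"
  shows "tV \<omega> = tV \<omega>'"
proof -
  have "a \<in> tV \<omega> \<longleftrightarrow> a \<in> tV \<omega>'" if "canon a" for a
  proof (cases rule: rev_cases_addr[OF that, case_names own anc bush])
    case (own w) then show ?thesis using assms by (simp add: tV_simps)
  next
    case (bush q i w)
    have "gw_set (\<lambda>u. \<omega> (SXi (Suc q, i # u))) = gw_set (\<lambda>u. \<omega>' (SXi (Suc q, i # u)))"
      by (rule gw_set_cong) (use assms bush in auto)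
    then show ?thesis using bush assms by (simp add: tV_simps)
  qed (simp add: tV_simps)
  then show ?thesis using tV_canon by blast
qed

lemma tX_cong_used:
  assumes eq: "\<And>s. s \<in> used \<Longrightarrow> \<omega> s = \<omega>' s" and c: "canon a"
  shows "tX \<omega> a = tX \<omega>' a"
proof -
  have o: "tO \<omega> = tO \<omega>'" using eq by (simp add: src_o_def)
  have A: "anc \<omega> p = anc \<omega>' p" for p by (induction p) (use eq in \<open>auto simp: o\<close>)
  obtain p w where a: "a = (p, w)" by (metis surj_pair)
  have "walk (\<lambda>a. \<omega> (SZ a)) p [] (anc \<omega>' p) w = walk (\<lambda>a. \<omega>' (SZ a)) p [] (anc \<omega>' p) w"
  proof (rule walk_cong)
    fix v v' assume "w = v @ v'" "v \<noteq> []"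
    then have "SZ (p, v) \<in> used" using c by (auto simp: a canon_def)
    then show "\<omega> (SZ (p, [] @ v)) = \<omega>' (SZ (p, [] @ v))" using eq by simp
  qed
  then show ?thesis by (simp add: a tX_eq A)
qed

lemma theta_cong_used:
  assumes "\<And>s. s \<in> used \<Longrightarrow> \<omega> s = \<omega>' s"
  shows "theta idS \<omega> = theta idS \<omega>'"
proof -
  have V: "tV \<omega> = tV \<omega>'" by (rule tV_cong_used) (rule assms)
  have "tX \<omega> a = tX \<omega>' a" if "a \<in> tV \<omega>'" for a
    by (rule tX_cong_used[OF assms tV_canon[OF that]])
  then show ?thesis unfolding theta_def encode_def V by (auto simp: fun_eq_iff)
qed

context brw_law
begin

lemma mean_nn: "(\<integral>\<^sup>+k. ennreal (real k) \<partial>measure_pmf \<mu>) = 1"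
proof -
  have s: "(\<lambda>k. real k * pmf \<mu> k) sums 1" using has_sum_imp_sums[OF mean] by simp
  have "(\<integral>\<^sup>+k. ennreal (real k) \<partial>measure_pmf \<mu>) = (\<integral>\<^sup>+k. ennreal (real k * pmf \<mu> k) \<partial>count_space UNIV)"
    unfolding nn_integral_measure_pmf by (rule nn_integral_cong) (simp add: ennreal_mult mult.commute)
  also have "\<dots> = (\<Sum>k. ennreal (real k * pmf \<mu> k))" by (rule nn_integral_count_space_nat)
  also have "\<dots> = ennreal (\<Sum>k. real k * pmf \<mu> k)"
    by (rule suminf_ennreal2) (use s in \<open>auto simp: sums_iff\<close>)
  also have "\<dots> = 1" using s by (simp add: sums_iff)
  finally show ?thesis .
qed

lemma mean_integrable: "integrable (measure_pmf \<mu>) real"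
  by (rule integrableI_nonneg) (auto simp: mean_nn)

lemma mean_expectation: "measure_pmf.expectation \<mu> real = 1"
  using integral_eq_nn_integral[of real "measure_pmf \<mu>"] by (simp add: mean_nn)

text \<open>As k dominates the sum of the indicators of {1..} and {2..}, a mean of one gives
  \<mu>{1..} + \<mu>{2..} <= 1. Hence mass on {2..} forces mass at 0; without such mass, the mean
  leaves only the point mass at 1.\<close>

lemma offspring_cases:
  obtains "pmf \<mu> 0 > 0" "measure_pmf.prob \<mu> {2..} > 0" | "pmf \<mu> 1 = 1" "pmf \<mu> 0 = 0"
proof -
  let ?m = "measure_pmf.prob \<mu>"
  have ii: "integrable (measure_pmf \<mu>) (\<lambda>k. indicator A k :: real)" for A :: "nat set"
    by (rule measure_pmf.integrable_const_bound[where B=1]) (auto simp: indicator_def)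
  have "measure_pmf.expectation \<mu> (\<lambda>k. indicator {1..} k + indicator {2..} k) \<le> measure_pmf.expectation \<mu> real"
  proof (rule integral_mono)
    show "integrable (measure_pmf \<mu>) (\<lambda>k. indicator {1..} k + indicator {2..} k :: real)"
      by (intro Bochner_Integration.integrable_add ii)
  qed (auto simp: mean_integrable indicator_def)
  then have le: "?m {1..} + ?m {2..} \<le> 1" using ii by (simp add: mean_expectation)
  have UNI: "?m {0} + ?m {1..} = 1"
  proof -
    have "{0} \<union> {1..} = (UNIV :: nat set)" by auto
    then have "?m ({0} \<union> {1..}) = 1" using measure_pmf.prob_space[of \<mu>] by simp
    then show ?thesis by (subst (asm) measure_pmf.finite_measure_Union) auto
  qed
  have U1: "?m {1..} = pmf \<mu> 1 + ?m {2..}"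
  proof -
    have "{1..} = {1} \<union> ({2..} :: nat set)" by auto
    then have "?m {1..} = ?m ({1} \<union> {2..})" by (simp only:)
    also have "\<dots> = ?m {1} + ?m {2..}" by (rule measure_pmf.finite_measure_Union) auto
    finally have "?m {1..} = ?m {1} + ?m {2..}" .
    then show ?thesis by (simp add: measure_pmf_single)
  qed
  show thesis
  proof (cases "?m {2..} = 0")
    case True
    have "AE k in measure_pmf \<mu>. k \<notin> {2..}" using True
      by (intro AE_not_in) (auto simp: null_sets_def measure_pmf.emeasure_eq_measure)
    then have "measure_pmf.expectation \<mu> real = measure_pmf.expectation \<mu> (\<lambda>k. indicator {1} k)"
      by (intro integral_cong_AE) (auto simp: indicator_def elim!: eventually_mono)
    then have p1: "pmf \<mu> 1 = 1" by (simp add: mean_expectation measure_pmf_single)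
    then have "pmf \<mu> 0 = 0" using UNI U1 True by (simp add: measure_pmf_single)
    then show thesis using that(2) p1 by blast
  next
    case False
    then have "?m {2..} > 0" by (simp add: zero_less_measure_iff)
    moreover from this have "pmf \<mu> 0 > 0" using UNI le by (simp add: measure_pmf_single)
    ultimately show thesis using that(1) by blast
  qed
qed

lemma nn_integral_coord: "(\<integral>\<^sup>+\<omega>. f (\<omega> j) \<partial>Pr) = (\<integral>\<^sup>+k. f k \<partial>measure_pmf (law j))"
proof -
  have m: "(\<lambda>\<omega>. \<omega> j) \<in> Pr \<rightarrow>\<^sub>M measure_pmf (law j)"
    using measurable_coord[of j] by (simp cong: measurable_cong_sets)
  have "distr Pr (measure_pmf (law j)) (\<lambda>\<omega>. \<omega> j) = measure_pmf (law j)"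
    using PP.PiM_component[of j] by (simp add: Pr_def)
  then have "(\<integral>\<^sup>+k. f k \<partial>measure_pmf (law j)) = (\<integral>\<^sup>+k. f k \<partial>distr Pr (measure_pmf (law j)) (\<lambda>\<omega>. \<omega> j))" by simp
  also have "\<dots> = (\<integral>\<^sup>+\<omega>. f (\<omega> j) \<partial>Pr)" by (rule nn_integral_distr[OF m]) simp
  finally show ?thesis by simp
qed

subsection \<open>Extinction\<close>

text \<open>Generation \<open>n\<close> is empty. The offspring sources are passed as a map
  \<open>f\<close>, so that the subtrees of the children give instances of the same event.\<close>

definition ext :: "nat \<Rightarrow> (nat list \<Rightarrow> src) \<Rightarrow> (src \<Rightarrow> nat) set" where
  "ext n f = {\<omega>. \<forall>w\<in>gw_set (\<lambda>u. \<omega> (f u)). length w \<noteq> n}"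

lemma ext_0: "ext 0 f = {}" by (auto simp: ext_def intro: bexI[of _ "[]"])

lemma ext_Suc: "ext (Suc n) f = {\<omega>. \<forall>i<\<omega> (f []). \<omega> \<in> ext n (\<lambda>u. f (i # u))}"
proof (intro set_eqI iffI)
  fix \<omega> assume "\<omega> \<in> ext (Suc n) f"
  then have L: "length w \<noteq> Suc n" if "w \<in> gw_set (\<lambda>u. \<omega> (f u))" for w using that by (simp add: ext_def)
  show "\<omega> \<in> {\<omega>. \<forall>i<\<omega> (f []). \<omega> \<in> ext n (\<lambda>u. f (i # u))}"
  proof (intro CollectI allI impI)
    fix i assume "i < \<omega> (f [])"
    then show "\<omega> \<in> ext n (\<lambda>u. f (i # u))"
      unfolding ext_def using L[of "i # w" for w] by auto
  qed
next
  fix \<omega> assume R: "\<omega> \<in> {\<omega>. \<forall>i<\<omega> (f []). \<omega> \<in> ext n (\<lambda>u. f (i # u))}"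
  show "\<omega> \<in> ext (Suc n) f" unfolding ext_def
  proof (intro CollectI ballI)
    fix w assume "w \<in> gw_set (\<lambda>u. \<omega> (f u))"
    then show "length w \<noteq> Suc n" using R by (cases w) (auto simp: ext_def)
  qed
qed

lemma sets_ext [measurable]: "ext n f \<in> sets Pr"
proof (induction n arbitrary: f)
  case (Suc n)
  note [measurable] = Suc
  show ?case unfolding ext_Suc by measurable
qed (simp add: ext_0)

lemma dep_on_ext: "dep_on (range f) (ext n f)"
proof -
  have "gw_set (\<lambda>u. \<omega> (f u)) = gw_set (\<lambda>u. \<omega>' (f u))" if "\<forall>j\<in>range f. \<omega> j = \<omega>' j" for \<omega> \<omega>' :: "src \<Rightarrow> nat"
    by (rule gw_set_cong) (use that in auto)
  then show ?thesis unfolding dep_on_def ext_def by simp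
qed

text \<open>The iterates, started from 0, of the generating function of \<mu>.\<close>

primrec extp :: "nat \<Rightarrow> real" where
  "extp 0 = 0"
| "extp (Suc n) = measure_pmf.expectation \<mu> (\<lambda>k. extp n ^ k)"

lemma extp_bounds: "0 \<le> extp n \<and> extp n \<le> 1"
proof (induction n)
  case (Suc n)
  have "measure_pmf.expectation \<mu> (\<lambda>k. extp n ^ k) \<le> measure_pmf.expectation \<mu> (\<lambda>k. 1)"
    by (rule integral_mono) (use Suc in \<open>auto intro!: measure_pmf.integrable_const_bound[where B=1] simp: power_le_one\<close>)
  then show ?case using Suc by (auto intro!: integral_nonneg_AE)
qed simp

text \<open>Given that the first vertex has k children, their subtrees depend on disjoint sets of
  sources, whence the k-th power.\<close>

lemma prob_ext:
  assumes "inj f" "\<And>u. law (f u) = \<mu>"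
  shows "prob (ext n f) = extp n"
  using assms
proof (induction n arbitrary: f)
  case (Suc n)
  have IH: "prob (ext n (\<lambda>u. f (i # u))) = extp n" for i
    by (rule Suc.IH) (use Suc.prems in \<open>auto simp: inj_def\<close>)
  have all: "prob {\<omega>. \<forall>i<k. \<omega> \<in> ext n (\<lambda>u. f (i # u))} = extp n ^ k" for k
  proof (induction k)
    case 0 then show ?case using prob_space by simp
  next
    case (Suc k)
    have "{\<omega>. \<forall>i<Suc k. \<omega> \<in> ext n (\<lambda>u. f (i # u))} = {\<omega>. \<forall>i<k. \<omega> \<in> ext n (\<lambda>u. f (i # u))} \<inter> ext n (\<lambda>u. f (k # u))"
      by (auto simp: less_Suc_eq)
    also have "prob \<dots> = prob {\<omega>. \<forall>i<k. \<omega> \<in> ext n (\<lambda>u. f (i # u))} * prob (ext n (\<lambda>u. f (k # u)))"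
    proof (rule prob_Int_dep)
      show "dep_on (\<Union>i<k. range (\<lambda>u. f (i # u))) {\<omega>. \<forall>i<k. \<omega> \<in> ext n (\<lambda>u. f (i # u))}"
        unfolding dep_on_def
      proof (intro allI impI)
        fix \<omega> \<omega>' assume eq: "\<forall>j\<in>(\<Union>i<k. range (\<lambda>u. f (i # u))). \<omega> j = (\<omega>' j :: nat)"
        have "\<omega> \<in> ext n (\<lambda>u. f (i # u)) \<longleftrightarrow> \<omega>' \<in> ext n (\<lambda>u. f (i # u))" if "i < k" for i
          by (rule dep_onD[OF dep_on_ext]) (use eq that in auto)
        then show "\<omega> \<in> {\<omega>. \<forall>i<k. \<omega> \<in> ext n (\<lambda>u. f (i # u))} \<longleftrightarrow> \<omega>' \<in> {\<omega>. \<forall>i<k. \<omega> \<in> ext n (\<lambda>u. f (i # u))}"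
          by auto
      qed
      show "dep_on (range (\<lambda>u. f (k # u))) (ext n (\<lambda>u. f (k # u)))" by (rule dep_on_ext)
      show "(\<Union>i<k. range (\<lambda>u. f (i # u))) \<inter> range (\<lambda>u. f (k # u)) = {}"
        using \<open>inj f\<close> by (auto dest: injD)
    qed measurable
    finally show ?case using Suc IH by simp
  qed
  have mix_eq: "{\<omega>'. mix {f []} \<omega> \<omega>' \<in> ext (Suc n) f} = {\<omega>'. \<forall>i<\<omega> (f []). \<omega>' \<in> ext n (\<lambda>u. f (i # u))}" for \<omega>
  proof -
    have "mix {f []} \<omega> \<omega>' \<in> ext n (\<lambda>u. f (i # u)) \<longleftrightarrow> \<omega>' \<in> ext n (\<lambda>u. f (i # u))" for \<omega>' i
      by (rule dep_onD[OF dep_on_ext]) (use \<open>inj f\<close> in \<open>auto simp: mix_def dest: injD\<close>)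
    then show ?thesis unfolding ext_Suc by (auto simp: mix_def)
  qed
  have "ennreal (prob (ext (Suc n) f)) = (\<integral>\<^sup>+\<omega>. ennreal (extp n ^ \<omega> (f [])) \<partial>Pr)"
    unfolding emeasure_eq_measure[symmetric]
    by (subst emeasure_mix[where J="{f []}"]) (auto simp: mix_eq emeasure_eq_measure all)
  also have "\<dots> = (\<integral>\<^sup>+k. ennreal (extp n ^ k) \<partial>measure_pmf \<mu>)"
    using nn_integral_coord[of "\<lambda>k. ennreal (extp n ^ k)" "f []"] Suc.prems by simp
  also have "\<dots> = ennreal (extp (Suc n))"
    unfolding extp.simps
    by (rule nn_integral_eq_integral)
       (use extp_bounds[of n] in \<open>auto intro!: measure_pmf.integrable_const_bound[where B=1] simp: power_le_one\<close>)
  finally show ?case using extp_bounds[of "Suc n"] by (simp add: ennreal_inj del: extp.simps)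
qed (simp add: ext_0)

text \<open>Union bound with a second order gain: there is equality at k = 2, and each further trial
  raises the left side by at most \<open>q\<close>.\<close>

lemma pow_gap:
  fixes q :: real assumes "0 \<le> q" "q \<le> 1"
  shows "1 - (1 - q) ^ k \<le> real k * q - q\<^sup>2 * indicator {2..} k"
proof -
  have base: "1 - (1 - q) ^ (k + 2) \<le> real (k + 2) * q - q\<^sup>2" for k
  proof (induction k)
    case 0 then show ?case by (simp add: power2_eq_square algebra_simps)
  next
    case (Suc k)
    have "1 - (1 - q) ^ (Suc k + 2) = q + (1 - q) * (1 - (1 - q) ^ (k + 2))" by (simp add: algebra_simps)
    also have "\<dots> \<le> q + 1 * (1 - (1 - q) ^ (k + 2))"
      using assms by (intro add_left_mono mult_right_mono) (auto simp: power_le_one simp del: power_Suc power_Suc2 add_2_eq_Suc')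
    finally show ?case using Suc by (simp add: algebra_simps)
  qed
  consider "k = 0" | "k = 1" | "k \<ge> 2" by linarith
  then show ?thesis
  proof cases
    case 3
    then obtain j where "k = j + 2" by (metis add.commute le_Suc_ex)
    then show ?thesis using base[of j] by (simp add: indicator_def)
  qed auto
qed

text \<open>\<open>pow_gap\<close> integrated over the offspring number; the linear term reproduces
  itself because the mean is one.\<close>

lemma extp_step: "1 - extp (Suc n) \<le> (1 - extp n) - (1 - extp n)\<^sup>2 * measure_pmf.prob \<mu> {2..}"
proof -
  define q where "q = 1 - extp n"
  have q: "0 \<le> q" "q \<le> 1" using extp_bounds[of n] by (auto simp: q_def)
  have i1: "integrable (measure_pmf \<mu>) (\<lambda>k. (1 - q) ^ k)"
    by (rule measure_pmf.integrable_const_bound[where B=1]) (use q in \<open>auto simp: power_le_one\<close>)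
  have i2: "integrable (measure_pmf \<mu>) (\<lambda>k. indicator {2..} k :: real)"
    by (rule measure_pmf.integrable_const_bound[where B=1]) (auto simp: indicator_def)
  have "1 - extp (Suc n) = measure_pmf.expectation \<mu> (\<lambda>k. 1 - (1 - q) ^ k)"
    using i1 by (simp add: q_def)
  also have "\<dots> \<le> measure_pmf.expectation \<mu> (\<lambda>k. real k * q - q\<^sup>2 * indicator {2..} k)"
    by (rule integral_mono) (use i1 i2 mean_integrable pow_gap[OF q] in auto)
  also have "\<dots> = q - q\<^sup>2 * measure_pmf.prob \<mu> {2..}"
    using i2 mean_integrable by (simp add: mean_expectation)
  finally show ?thesis by (simp add: q_def)
qed

text \<open>The survival probability q is below every \<open>1 - extp n\<close>, so by
  \<open>extp_step\<close> each generation lowers this bound by at least q^2 times the mass of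
  {2..}. As the bound stays nonnegative, q = 0. Then some generation is empty and all generations
  are finite.\<close>

lemma AE_extinct:
  assumes m2: "measure_pmf.prob \<mu> {2..} > 0" and f: "inj f" "\<And>u. law (f u) = \<mu>"
  shows "AE \<omega> in Pr. finite (gw_set (\<lambda>u. \<omega> (f u)))"
proof -
  let ?m = "measure_pmf.prob \<mu> {2..}"
  define A where "A = {\<omega>. \<forall>n. \<omega> \<notin> ext n f}"
  have [measurable]: "A \<in> sets Pr" unfolding A_def by measurable
  define q where "q = prob A"
  have qn: "q \<le> 1 - extp n" for n
  proof -
    have "q \<le> prob (space Pr - ext n f)" unfolding q_def by (rule finite_measure_mono) (use sets.compl_sets[OF sets_ext, of n f] in \<open>auto simp: A_def\<close>)
    also have "\<dots> = 1 - extp n" by (subst prob_compl) (auto simp: prob_ext[OF f] simp del: space_Pr)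
    finally show ?thesis .
  qed
  have q0: "q \<ge> 0" by (simp add: q_def)
  have "1 - extp n \<le> 1 - real n * (q\<^sup>2 * ?m)" for n
  proof (induction n)
    case (Suc n)
    have "q\<^sup>2 * ?m \<le> (1 - extp n)\<^sup>2 * ?m" using qn[of n] q0 by (intro mult_right_mono power_mono) auto
    then show ?case using extp_step[of n] Suc by (simp add: algebra_simps del: extp.simps)
  qed simp
  then have "real n * (q\<^sup>2 * ?m) \<le> 1" for n using qn[of n] q0 by (smt (verit))
  then have "q\<^sup>2 * ?m \<le> 0"
    by (metis linorder_not_le reals_Archimedean3)
  then have "q = 0" using m2 by (simp add: mult_le_0_iff)
  then have "AE \<omega> in Pr. \<omega> \<notin> A"
    by (intro AE_not_in null_setsI) (auto simp: emeasure_eq_measure q_def)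
  then show ?thesis
  proof eventually_elim
    case (elim \<omega>)
    then obtain n where n: "\<omega> \<in> ext n f" by (auto simp: A_def)
    let ?G = "gw_set (\<lambda>u. \<omega> (f u))"
    have fin: "finite {w \<in> gw_set N. length w = m}" for m N
    proof (induction m arbitrary: N)
      case 0
      have "{w \<in> gw_set N. length w = 0} \<subseteq> {[]}" by auto
      then show ?case by (rule finite_subset) simp
    next
      case (Suc m)
      have "{w \<in> gw_set N. length w = Suc m} \<subseteq> (\<Union>i<N []. (#) i ` {w \<in> gw_set (\<lambda>u. N (i # u)). length w = m})"
      proof
        fix w assume "w \<in> {w \<in> gw_set N. length w = Suc m}"
        then show "w \<in> (\<Union>i<N []. (#) i ` {w \<in> gw_set (\<lambda>u. N (i # u)). length w = m})" by (cases w) auto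
      qed
      then show ?case by (rule finite_subset) (use Suc in auto)
    qed
    have "length w < n" if "w \<in> ?G" for w
    proof (rule ccontr)
      assume "\<not> length w < n"
      then have "take n w \<in> ?G" "length (take n w) = n" using that by (auto simp: gw_set_def min_def)
      then show False using n by (auto simp: ext_def)
    qed
    then have "?G \<subseteq> (\<Union>m<n. {w \<in> ?G. length w = m})" by auto
    then show ?case by (rule finite_subset) (use fin in auto)
  qed
qed

lemma AE_finite_blocks:
  assumes m2: "measure_pmf.prob \<mu> {2..} > 0"
  shows "AE \<omega> in Pr. \<forall>p. finite {v \<in> tF \<omega>. fst v = p}"
proof -
  have a0: "AE \<omega> in Pr. finite (gw_set (\<lambda>u. \<omega> (SXi (0, u))))"
    by (rule AE_extinct[OF m2]) (auto simp: inj_def)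
  have a1: "AE \<omega> in Pr. \<forall>p i. finite (gw_set (\<lambda>u. \<omega> (SXi (Suc p, Suc i # u))))"
    unfolding AE_all_countable by (intro allI AE_extinct[OF m2]) (auto simp: inj_def)
  from a0 a1 show ?thesis
  proof eventually_elim
    case (elim \<omega>)
    show ?case
    proof
      fix p
      show "finite {v \<in> tF \<omega>. fst v = p}"
      proof (cases p)
        case 0
        have "{v \<in> tF \<omega>. fst v = 0} \<subseteq> Pair 0 ` gw_set (\<lambda>u. \<omega> (SXi (0, u)))"
          by (auto simp: tV_simps)
        then show ?thesis unfolding 0 by (rule finite_subset) (use elim in auto)
      next
        case (Suc q)
        have "{v \<in> tF \<omega>. fst v = Suc q} \<subseteq> (\<Union>i<\<omega> (SK (Suc q)). (\<lambda>w. (Suc q, Suc i # w)) ` gw_set (\<lambda>u. \<omega> (SXi (Suc q, Suc i # u))))"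
        proof
          fix v assume v: "v \<in> {v \<in> tF \<omega>. fst v = Suc q}"
          then obtain w where w: "v = (Suc q, w)" by (cases v) auto
          then obtain i u where iu: "w = i # u" using v by (cases w) auto
          then obtain i' where "i = Suc i'" using v w by (cases i) auto
          then show "v \<in> (\<Union>i<\<omega> (SK (Suc q)). (\<lambda>w. (Suc q, Suc i # w)) ` gw_set (\<lambda>u. \<omega> (SXi (Suc q, Suc i # u))))"
            using v w iu by (intro UN_I[of i']) (auto simp: tV_simps)
        qed
        then show ?thesis unfolding Suc by (rule finite_subset) (use elim in auto)
      qed
    qed
  qed
qed

text \<open>Infinitely many branching ancestors give infinitely many nonempty bushes, while the
  predecessors of a vertex lie in the finitely many finite blocks up to its own.\<close>

lemma wellenum_blocks:
  assumes fin: "\<And>p. finite {v \<in> tF \<omega>. fst v = p}" and inf: "\<And>m. \<exists>n\<ge>m. 2 \<le> \<omega> (SK (Suc n))"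
  shows "wellenum (tF \<omega>)"
  unfolding wellenum_def
proof (intro conjI ballI)
  show "infinite (tF \<omega>)"
  proof
    assume "finite (tF \<omega>)"
    then have "finite (fst ` tF \<omega>)" by simp
    then obtain m where m: "\<And>v. v \<in> tF \<omega> \<Longrightarrow> fst v < m"
      by (metis finite_nat_set_iff_bounded image_eqI)
    obtain n where "n \<ge> m" "2 \<le> \<omega> (SK (Suc n))" using inf by auto
    then have "(Suc n, [1]) \<in> tF \<omega>" by (simp add: tV_simps)
    from m[OF this] \<open>n \<ge> m\<close> show False by simp
  qed
  fix v assume v: "v \<in> tF \<omega>"
  have "{u \<in> tF \<omega>. addr_less u v} \<subseteq> (\<Union>p\<le>fst v. {v \<in> tF \<omega>. fst v = p})"
    using v by (auto simp: addr_less_fwd)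
  then show "finite {u \<in> tF \<omega>. addr_less u v}" by (rule finite_subset) (use fin in auto)
qed auto

lemma set_pmf_line:
  assumes "pmf \<mu> 1 = 1"
  shows "set_pmf \<mu> = {1}"
proof -
  have "measure_pmf.prob \<mu> {1} = 1" using assms by (simp add: measure_pmf_single)
  then have "set_pmf \<mu> \<subseteq> {1}" by (simp add: measure_pmf.prob_eq_1 AE_measure_pmf_iff subset_iff)
  then show ?thesis using set_pmf_not_empty by (metis subset_singletonD)
qed

text \<open>The tails of \<mu> vanish above 1, so no ancestor has a second child, and below the root
  every vertex has exactly one.\<close>

lemma AE_line:
  assumes "pmf \<mu> 1 = 1"
  shows "AE \<omega> in Pr. tF \<omega> = range (\<lambda>n. (0, replicate n 0))"
proof -
  note m = set_pmf_line[OF assms]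
  have k: "set_pmf klaw \<subseteq> {..1}"
  proof
    fix k assume "k \<in> set_pmf klaw"
    then have "measure_pmf.prob \<mu> {k..} \<noteq> 0" by (auto simp: set_pmf_iff klaw split: if_splits)
    then have "set_pmf \<mu> \<inter> {k..} \<noteq> {}" using measure_Int_set_pmf[of \<mu> "{k..}"] by (auto simp: Int_commute)
    then show "k \<in> {..1}" using m by auto
  qed
  have a1: "AE \<omega> in Pr. \<forall>w. \<omega> (SXi (0, w)) = 1"
    unfolding AE_all_countable by (intro allI AE_coord) (auto simp: m)
  have a2: "AE \<omega> in Pr. \<forall>p. \<omega> (SK (Suc p)) \<le> 1"
    unfolding AE_all_countable by (intro allI AE_coord) (use k in auto)
  from a1 a2 show ?thesis
  proof eventually_elim
    case (elim \<omega>)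
    have g: "w \<in> gw_set (\<lambda>u. 1) \<longleftrightarrow> w = replicate (length w) 0" for w by (induction w) auto
    have g': "gw_set (\<lambda>u. \<omega> (SXi (0, u))) = gw_set (\<lambda>u. 1)" by (rule gw_set_cong) (use elim in auto)
    show ?case
    proof (intro equalityI subsetI)
      fix v assume v: "v \<in> tF \<omega>"
      then have "canon v" using tV_canon[of v \<omega>] by auto
      then show "v \<in> range (\<lambda>n. (0, replicate n 0))"
      proof (cases rule: rev_cases_addr[case_names own anc bush, consumes 1])
        case (own w)
        then have "w = replicate (length w) 0" using v g[of w] by (simp add: tV_simps g')
        then show ?thesis using own by blast
      next
        case (anc q) then show ?thesis using v by auto
      next
        case (bush q i w)
        then have "1 \<le> i" "i < \<omega> (SK (Suc q))" using v by (auto simp: tV_simps)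
        then show ?thesis using elim(2)[rule_format, of q] by auto
      qed
    next
      fix v :: addr assume "v \<in> range (\<lambda>n. (0, replicate n 0))"
      then show "v \<in> tF \<omega>" using g by (auto simp: tV_simps g')
    qed
  qed
qed

lemma line_enum:
  assumes F: "F = range (\<lambda>n. (0, replicate n 0))"
  shows "wellenum F" "fenum F n = (0, replicate n 0)"
proof -
  have less: "lexlt (replicate m (0::nat)) (replicate n 0) \<longleftrightarrow> m < n" for m n
  proof (induction m arbitrary: n)
    case 0 then show ?case by (cases n) auto
  next
    case (Suc m) then show ?case by (cases n) auto
  qed
  have D: "{u \<in> F. addr_less u (0, replicate n 0)} = (\<lambda>m. (0, replicate m 0)) ` {..<n}" for n
    by (auto simp: F addr_less_fwd less)
  have inj: "inj (\<lambda>n. (0::nat, replicate n (0::nat)))" by (auto simp: inj_def dest: arg_cong[where f=length])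
  show W: "wellenum F"
    unfolding wellenum_def
  proof (intro conjI ballI)
    show "infinite F" unfolding F using inj finite_imageD by (metis infinite_UNIV_nat)
    fix v assume "v \<in> F"
    then show "finite {u \<in> F. addr_less u v}" using D by (auto simp: F)
  qed (auto simp: F)
  have "rank F (0, replicate n 0) = n"
    unfolding rank_def D by (subst card_image) (use inj in \<open>auto intro: inj_on_subset\<close>)
  then show "fenum F n = (0, replicate n 0)"
    using fenum_rank[of F "(0, replicate n 0)"] D W unfolding wellenum_def by (auto simp: F)
qed

lemma AE_good:
  "AE \<omega> in Pr. wellenum (tF \<omega>) \<and> (\<exists>r old. rerooted \<omega> (Succ \<omega>) r old)"
proof (cases rule: offspring_cases)
  case 1
  from AE_finite_blocks[OF 1(2)] AE_branching_ancestors[OF 1(1)] AE_U show ?thesis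
  proof eventually_elim
    case (elim \<omega>)
    then show ?case using wellenum_blocks[of \<omega>] rerooted_Succ[of \<omega>] by blast
  qed
next
  case 2
  have "AE \<omega> in Pr. \<omega> (SXi (0, [])) = 1"
  proof (rule AE_coord)
    fix k assume "k \<in> set_pmf (law (SXi (0, [])))"
    then show "k = 1" using set_pmf_line[OF 2(1)] by simp
  qed
  with AE_line[OF 2(1)] AE_U show ?thesis
  proof eventually_elim
    case (elim \<omega>)
    then show ?case using line_enum(1)[of "tF \<omega>"] rerooted_Succ[of \<omega>] by auto
  qed
qed

end

subsection \<open>Zero-one laws\<close>

context pmf_prod
begin

lemma sets_mix1 [measurable]: "A \<in> sets Pr \<Longrightarrow> {\<omega>'. mix J \<omega> \<omega>' \<in> A} \<in> sets Pr"
  using measurable_sets[OF measurable_mix1, of A J \<omega>] by (simp add: vimage_def)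

lemma measurable_prob_mix:
  assumes A [measurable]: "A \<in> sets Pr"
  shows "(\<lambda>\<omega>. prob {\<omega>'. mix J \<omega> \<omega>' \<in> A}) \<in> borel_measurable Pr"
proof -
  have "(\<lambda>\<omega>. \<integral>\<^sup>+\<omega>'. indicator A (case (\<omega>, \<omega>') of (\<omega>, \<omega>') \<Rightarrow> mix J \<omega> \<omega>') \<partial>Pr) \<in> borel_measurable Pr"
    by measurable
  also have "(\<lambda>\<omega>. \<integral>\<^sup>+\<omega>'. indicator A (case (\<omega>, \<omega>') of (\<omega>, \<omega>') \<Rightarrow> mix J \<omega> \<omega>') \<partial>Pr) =
    (\<lambda>\<omega>. emeasure Pr {\<omega>'. mix J \<omega> \<omega>' \<in> A})"
  proof
    fix \<omega>
    have "(\<integral>\<^sup>+\<omega>'. indicator A (case (\<omega>, \<omega>') of (\<omega>, \<omega>') \<Rightarrow> mix J \<omega> \<omega>') \<partial>Pr) =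
      (\<integral>\<^sup>+\<omega>'. indicator {\<omega>'. mix J \<omega> \<omega>' \<in> A} \<omega>' \<partial>Pr)"
      by (simp add: indicator_def)
    also have "\<dots> = emeasure Pr {\<omega>'. mix J \<omega> \<omega>' \<in> A}" by (rule nn_integral_indicator) measurable
    finally show "(\<integral>\<^sup>+\<omega>'. indicator A (case (\<omega>, \<omega>') of (\<omega>, \<omega>') \<Rightarrow> mix J \<omega> \<omega>') \<partial>Pr) = emeasure Pr {\<omega>'. mix J \<omega> \<omega>' \<in> A}" .
  qed
  finally show ?thesis unfolding measure_def by measurable
qed

end

context brw_law
begin

lemma prob_iter:
  assumes [measurable]: "T \<in> Pr \<rightarrow>\<^sub>M Pr" and "distr Pr Pr T = Pr" and B [measurable]: "B \<in> sets Pr"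
  shows "prob {\<omega>. (T ^^ p) \<omega> \<in> B} = prob B"
  using measure_distr[of "T ^^ p" Pr Pr B] distr_iter[OF assms(1,2), of p] by (simp add: vimage_def)

text \<open>A transformation that drops the sources of one generation and moves the starting
  point along one edge has a trivial invariant field: an invariant event is measurable with respect
  to the starting point, and as such it is invariant under the shift of the letters.\<close>

lemma zero_one_exch:
  assumes a: "SZ a \<in> used" and T: "T = (\<lambda>\<omega>. reindex f (exch a \<omega>))"
    and inj: "inj_on f used" and law: "\<And>s. s \<in> used \<Longrightarrow> law (f s) = law s"
    and fU: "\<And>j. f (SU j) = SU j"
    and fD: "\<And>s. s \<in> used - range SU \<Longrightarrow> f s \<in> used - range SU \<and> f s \<noteq> SZ a \<and> lev s < (lev (f s) :: nat)"
    and A [measurable]: "A \<in> sets Pr" and inv: "AE \<omega> in Pr. \<omega> \<in> A \<longleftrightarrow> T \<omega> \<in> A"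
  shows "prob A = 0 \<or> prob A = 1"
proof -
  let ?U = "range SU"
  define D where "D = used - ?U"
  have Tm [measurable]: "T \<in> Pr \<rightarrow>\<^sub>M Pr" unfolding T by measurable
  have Td: "distr Pr Pr T = Pr"
    unfolding T by (rule distr_comp[OF measurable_exch measurable_reindex distr_exch[OF a] distr_reindex[OF inj law]])
  have fD': "f s \<in> D" "f s \<noteq> SZ a" "lev s < lev (f s)" if "s \<in> D" for s using fD that unfolding D_def by auto
  have fpD: "(f ^^ p) s \<in> D" "lev s + p \<le> lev ((f ^^ p) s)" if "s \<in> D" for p s
  proof (induction p)
    case (Suc p)
    { case 1 then show ?case using Suc fD' by simp }
    { case 2 then show ?case using Suc fD'(3)[of "(f ^^ p) s"] by simp }
  qed (use that in auto)
  have injp: "inj_on (f ^^ p) D" for p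
  proof (induction p)
    case (Suc p)
    show ?case unfolding funpow.simps
    proof (rule comp_inj_on[OF Suc])
      show "inj_on f ((f ^^ p) ` D)"
        by (rule inj_on_subset[OF inj]) (use fpD in \<open>auto simp: D_def\<close>)
    qed
  qed auto
  have TD: "(T ^^ p) \<omega> s = \<omega> ((f ^^ p) s)" if "s \<in> D" for p s \<omega>
    using that
  proof (induction p arbitrary: s)
    case (Suc p)
    have e: "exch a \<omega>' t = \<omega>' t" if "t \<in> D" "t \<noteq> SZ a" for t \<omega>' using that by (cases t) (auto simp: D_def)
    have "(T ^^ Suc p) \<omega> s = exch a ((T ^^ p) \<omega>) (f s)" using Suc.prems by (simp add: T reindex_def D_def)
    also have "\<dots> = (T ^^ p) \<omega> (f s)" by (rule e) (use fD' Suc.prems in auto)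
    also have "\<dots> = \<omega> ((f ^^ p) (f s))" by (rule Suc.IH) (use fD' Suc.prems in auto)
    finally show ?case by (simp add: funpow_swap1)
  qed simp
  have aD: "SZ a \<in> D" using a by (auto simp: D_def)
  \<comment> \<open>The letters of the p-th iterate are made of the initial letters and of moves
    dropped so far; they do not involve the sources that survive \<open>p\<close> steps.\<close>
  have TU: "(T ^^ p) \<omega> (SU j) = (T ^^ p) \<omega>' (SU j)"
    if "\<And>s. s \<notin> (f ^^ p) ` D \<Longrightarrow> \<omega> s = \<omega>' s" for p \<omega> \<omega>' j
    using that
  proof (induction p arbitrary: j)
    case 0
    then show ?case by (auto simp: D_def)
  next
    case (Suc p)
    have sub: "(f ^^ Suc p) ` D \<subseteq> (f ^^ p) ` D"
      using fD' by (auto simp: funpow_swap1[symmetric] simp del: funpow.simps) (simp add: funpow_swap1)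
    have IH: "(T ^^ p) \<omega> (SU j) = (T ^^ p) \<omega>' (SU j)" for j
      by (rule Suc.IH) (use Suc.prems sub in blast)
    have "(f ^^ p) (SZ a) \<notin> (f ^^ Suc p) ` D"
    proof
      assume "(f ^^ p) (SZ a) \<in> (f ^^ Suc p) ` D"
      then obtain t where t: "t \<in> D" "(f ^^ p) (SZ a) = (f ^^ p) (f t)"
        by (auto simp: funpow_swap1)
      then have "SZ a = f t" using injp[of p] aD fD'(1) by (auto dest: inj_onD)
      then show False using fD'(2)[OF t(1)] by simp
    qed
    then have z: "(T ^^ p) \<omega> (SZ a) = (T ^^ p) \<omega>' (SZ a)"
      using Suc.prems by (simp add: TD[OF aD])
    have "exch a ((T ^^ p) \<omega>) (SU j) = exch a ((T ^^ p) \<omega>') (SU j)"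
      using z IH by (simp split: nat.splits)
    then show ?case by (simp add: T reindex_def fU)
  qed
  \<comment> \<open>A version of the conditional probability of \<open>B\<close> given the
    letters.\<close>
  define g where "g B \<omega> = prob {\<omega>'. mix ?U \<omega> \<omega>' \<in> B}" for B \<omega>
  have g [measurable]: "g B \<in> borel_measurable Pr" if "B \<in> sets Pr" for B
    unfolding g_def[abs_def] by (rule measurable_prob_mix[OF that])
  have key: "prob B = (\<integral>\<omega>. indicator B \<omega> * g B \<omega> \<partial>Pr)"
    if B [measurable]: "B \<in> sets Pr" and Binv: "AE \<omega> in Pr. \<omega> \<in> B \<longleftrightarrow> T \<omega> \<in> B" for B
  proof (rule prob_eq_integral_of_approximation[OF Tm Td B Binv g[OF B]])
    fix e :: real assume "e > 0"
    then obtain C J where C: "C \<in> sets Pr" "finite J" "dep_on J C" "prob ((B - C) \<union> (C - B)) < e"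
      using approx_finite_dim[OF B] by blast
    note [measurable] = C(1)
    obtain p0 where p0: "\<And>s. s \<in> J \<Longrightarrow> lev s < p0"
      using finite_nat_set_iff_bounded[of "lev ` J"] C(2) by auto
    \<comment> \<open>Sources read after \<open>p\<close> steps have higher level than those on
      which \<open>C\<close> depends. That \<open>p\<close> is positive ensures that the values
      outside \<open>used\<close> have been reset to 0.\<close>
    define p where "p = Suc p0"
    define K where "K = - ((f ^^ p) ` D)"
    have JK: "J \<subseteq> K"
    proof
      fix s assume "s \<in> J"
      show "s \<in> K"
      proof (rule ccontr)
        assume "s \<notin> K"
        then obtain t where "t \<in> D" "s = (f ^^ p) t" by (auto simp: K_def)
        then show False using fpD(2)[of t p] p0[OF \<open>s \<in> J\<close>] by (simp add: p_def)
      qed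
    qed
    have mC: "mix K \<omega> \<omega>' \<in> C \<longleftrightarrow> \<omega> \<in> C" for \<omega> \<omega>'
      by (rule dep_onD[OF C(3)]) (use JK in \<open>auto simp: mix_def\<close>)
    \<comment> \<open>Given the sources in \<open>K\<close>, the p-th iterate keeps its letters and
      takes everything else from an independent sample.\<close>
    have mT: "(T ^^ p) (mix K \<omega> \<omega>') = mix ?U ((T ^^ p) \<omega>) ((T ^^ p) \<omega>')" for \<omega> \<omega>'
    proof
      fix s
      consider j where "s = SU j" | "s \<in> D" | "s \<notin> used" by (auto simp: D_def)
      then show "(T ^^ p) (mix K \<omega> \<omega>') s = mix ?U ((T ^^ p) \<omega>) ((T ^^ p) \<omega>') s"
      proof cases
        case 1
        have "(T ^^ p) (mix K \<omega> \<omega>') (SU j) = (T ^^ p) \<omega> (SU j)" for j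
          by (rule TU) (auto simp: mix_def K_def)
        then show ?thesis using 1 by (simp add: mix_def)
      next
        case 2
        then show ?thesis by (simp add: TD mix_def K_def) (auto simp: D_def)
      next
        case 3
        then have "s \<notin> ?U" by auto
        then show ?thesis using 3 by (simp add: mix_def p_def T reindex_def)
      qed
    qed
    have "ennreal (prob (C \<inter> {\<omega>\<in>space Pr. (T ^^ p) \<omega> \<in> B})) =
       (\<integral>\<^sup>+\<omega>. emeasure Pr {\<omega>'. mix K \<omega> \<omega>' \<in> C \<inter> {\<omega>\<in>space Pr. (T ^^ p) \<omega> \<in> B}} \<partial>Pr)"
      unfolding emeasure_eq_measure[symmetric] by (rule emeasure_mix) measurable
    also have "\<dots> = (\<integral>\<^sup>+\<omega>. ennreal (indicator C \<omega> * g B ((T ^^ p) \<omega>)) \<partial>Pr)"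
    proof (rule nn_integral_cong)
      fix \<omega>
      have "{\<omega>'. mix K \<omega> \<omega>' \<in> C \<inter> {\<omega>\<in>space Pr. (T ^^ p) \<omega> \<in> B}} =
         (if \<omega> \<in> C then {\<omega>'. (T ^^ p) \<omega>' \<in> {\<omega>'. mix ?U ((T ^^ p) \<omega>) \<omega>' \<in> B}} else {})"
        by (auto simp: mC mT)
      moreover have "prob {\<omega>'. (T ^^ p) \<omega>' \<in> {\<omega>'. mix ?U ((T ^^ p) \<omega>) \<omega>' \<in> B}} = g B ((T ^^ p) \<omega>)"
        unfolding g_def by (rule prob_iter[OF Tm Td]) measurable
      ultimately show "emeasure Pr {\<omega>'. mix K \<omega> \<omega>' \<in> C \<inter> {\<omega>\<in>space Pr. (T ^^ p) \<omega> \<in> B}} =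
         ennreal (indicator C \<omega> * g B ((T ^^ p) \<omega>))"
        by (cases "\<omega> \<in> C")
          (simp_all only: emeasure_eq_measure if_True if_False measure_empty indicator_simps mult_1 mult_zero_left not_False_eq_True)
    qed
    also have "\<dots> = ennreal (\<integral>\<omega>. indicator C \<omega> * g B ((T ^^ p) \<omega>) \<partial>Pr)"
    proof (rule nn_integral_eq_integral)
      have [measurable]: "(\<lambda>\<omega>. g B ((T ^^ p) \<omega>)) \<in> borel_measurable Pr"
        by (rule measurable_compose[OF _ g]) (use B in measurable)
      show "integrable Pr (\<lambda>\<omega>. indicator C \<omega> * g B ((T ^^ p) \<omega>))"
        by (rule integrable_const_bound[where B=1]) (auto simp: g_def indicator_def)
    qed (auto simp: g_def)
    finally have "prob (C \<inter> {\<omega>\<in>space Pr. (T ^^ p) \<omega> \<in> B}) = (\<integral>\<omega>. indicator C \<omega> * g B ((T ^^ p) \<omega>) \<partial>Pr)"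
      by (subst (asm) ennreal_inj) (auto simp: g_def intro!: integral_nonneg_AE)
    then show "\<exists>C\<in>sets Pr. prob ((B - C) \<union> (C - B)) < e \<and>
      (\<exists>p. prob (C \<inter> {x\<in>space Pr. (T ^^ p) x \<in> B}) = (\<integral>x. indicator C x * g B ((T ^^ p) x) \<partial>Pr))"
      using C by blast
  qed (auto simp: g_def)
  have AE1: "AE \<omega> in Pr. \<omega> \<in> B \<longrightarrow> g B \<omega> = 1"
    if B [measurable]: "B \<in> sets Pr" and Binv: "AE \<omega> in Pr. \<omega> \<in> B \<longleftrightarrow> T \<omega> \<in> B" for B
  proof -
    have [measurable]: "g B \<in> borel_measurable Pr" by (rule g[OF B])
    have i1: "integrable Pr (\<lambda>\<omega>. indicator B \<omega> * g B \<omega>)"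
      by (rule integrable_const_bound[where B=1]) (auto simp: g_def indicator_def)
    have i2: "integrable Pr (\<lambda>\<omega>. indicator B \<omega> :: real)"
      by (rule integrable_const_bound[where B=1]) (auto simp: indicator_def)
    have "(\<integral>\<omega>. indicator B \<omega> - indicator B \<omega> * g B \<omega> \<partial>Pr) = 0"
      using key[OF B Binv] i1 i2 by simp
    moreover have "AE \<omega> in Pr. 0 \<le> indicator B \<omega> - indicator B \<omega> * g B \<omega>" by (auto simp: g_def indicator_def)
    ultimately have "AE \<omega> in Pr. indicator B \<omega> - indicator B \<omega> * g B \<omega> = 0"
      by (subst (asm) integral_nonneg_eq_0_iff_AE) (use i1 i2 in auto)
    then show ?thesis by eventually_elim (auto simp: indicator_def)
  qed
  define A' where "A' = {\<omega>. g A \<omega> = 1}"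
  have [measurable]: "g A \<in> borel_measurable Pr" by (rule g[OF A])
  have A' [measurable]: "A' \<in> sets Pr" unfolding A'_def by measurable
  have dA': "dep_on ?U A'"
  proof -
    have "mix ?U \<omega> = mix ?U \<omega>'" if "\<forall>j\<in>?U. \<omega> j = \<omega>' j" for \<omega> \<omega>' :: "src \<Rightarrow> nat"
      using that by (auto simp: mix_def fun_eq_iff)
    then have "g A \<omega> = g A \<omega>'" if "\<forall>j\<in>?U. \<omega> j = \<omega>' j" for \<omega> \<omega>' :: "src \<Rightarrow> nat"
      unfolding g_def using that by metis
    then show ?thesis unfolding dep_on_def A'_def by (metis mem_Collect_eq)
  qed
  \<comment> \<open>Applied to the complement, \<open>AE1\<close> gives \<open>g A = 0\<close> off
    \<open>A\<close>; so \<open>A\<close> agrees almost surely with an event of the letters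
    alone.\<close>
  have AA': "AE \<omega> in Pr. \<omega> \<in> A \<longleftrightarrow> \<omega> \<in> A'"
  proof -
    have [measurable]: "- A \<in> sets Pr" using sets.compl_sets[OF A] by (simp add: Compl_eq_Diff_UNIV)
    have "AE \<omega> in Pr. \<omega> \<in> - A \<longleftrightarrow> T \<omega> \<in> - A" using inv by eventually_elim auto
    then have "AE \<omega> in Pr. \<omega> \<in> - A \<longrightarrow> g (- A) \<omega> = 1" by (intro AE1) measurable
    moreover have "g (- A) \<omega> = 1 - g A \<omega>" for \<omega>
    proof -
      have "{\<omega>'. mix ?U \<omega> \<omega>' \<in> - A} = space Pr - {\<omega>'. mix ?U \<omega> \<omega>' \<in> A}" by auto
      then show ?thesis unfolding g_def by (simp only:) (rule prob_compl, measurable)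
    qed
    ultimately have "AE \<omega> in Pr. \<omega> \<in> - A \<longrightarrow> g A \<omega> = 0" by simp
    with AE1[OF A inv] show ?thesis by eventually_elim (auto simp: A'_def)
  qed
  define sh where "sh = reindex (\<lambda>s. case s of SU j \<Rightarrow> SU (Suc j) | _ \<Rightarrow> s)"
  have sm [measurable]: "sh \<in> Pr \<rightarrow>\<^sub>M Pr" unfolding sh_def by measurable
  have sd: "distr Pr Pr sh = Pr"
    unfolding sh_def by (rule distr_reindex) (auto simp: inj_on_def split: src.splits)
  have shU: "(sh ^^ p) \<omega> (SU j) = \<omega> (SU (j + p))" for p \<omega> j
    by (induction p arbitrary: j) (auto simp: sh_def reindex_def)
  define B where "B = {\<omega>. (\<omega> \<in> A') \<noteq> (sh \<omega> \<in> A')}"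
  have B [measurable]: "B \<in> sets Pr" unfolding B_def by measurable
  have dB: "dep_on ?U B"
    unfolding dep_on_def
  proof (intro allI impI)
    fix \<omega> \<omega>' :: "src \<Rightarrow> nat" assume eq: "\<forall>j\<in>?U. \<omega> j = \<omega>' j"
    have "sh \<omega> \<in> A' \<longleftrightarrow> sh \<omega>' \<in> A'"
      by (rule dep_onD[OF dA']) (use eq shU[of 1] in auto)
    moreover have "\<omega> \<in> A' \<longleftrightarrow> \<omega>' \<in> A'" by (rule dep_onD[OF dA']) (use eq in auto)
    ultimately show "\<omega> \<in> B \<longleftrightarrow> \<omega>' \<in> B" by (simp add: B_def)
  qed
  \<comment> \<open>When the move is 0, \<open>T\<close> acts on the letters as their shift. Since
    the move is independent of the letters and is 0 with probability 1/2, \<open>B\<close> itself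
    must be null.\<close>
  have "AE \<omega> in Pr. \<omega> \<notin> B \<inter> {\<omega>. \<omega> (SZ a) \<in> {0}}"
  proof -
    have "AE \<omega> in Pr. T \<omega> \<in> A \<longleftrightarrow> T \<omega> \<in> A'"
      by (rule AE_distrD[OF Tm]) (subst Td, rule AA')
    with AA' inv show ?thesis
    proof eventually_elim
      case (elim \<omega>)
      have "T \<omega> \<in> A' \<longleftrightarrow> sh \<omega> \<in> A'" if "\<omega> (SZ a) = 0"
        by (rule dep_onD[OF dA']) (use that shU[of 1] in \<open>auto simp: T reindex_def fU\<close>)
      then show ?case using elim by (auto simp: B_def)
    qed
  qed
  then have "prob (B \<inter> {\<omega>. \<omega> (SZ a) \<in> {0}}) = 0"
    by (subst prob_eq_0) auto
  also have "prob (B \<inter> {\<omega>. \<omega> (SZ a) \<in> {0}}) = prob B * prob {\<omega>. \<omega> (SZ a) \<in> {0}}"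
    by (rule prob_Int_dep[where J="?U" and K="{SZ a}"]) (auto simp: dB, auto simp: dep_on_def)
  also have "prob {\<omega>. \<omega> (SZ a) \<in> {0}} = 1/2"
    by (simp only: prob_cyl1) (simp add: a measure_pmf_single pmf_zlaw)
  finally have "prob B = 0" by simp
  then have "AE \<omega> in Pr. \<omega> \<notin> B" by (subst (asm) prob_eq_0) auto
  then have inv': "AE \<omega> in Pr. \<omega> \<in> A' \<longleftrightarrow> sh \<omega> \<in> A'" by eventually_elim (auto simp: B_def)
  \<comment> \<open>A far shift of the letters is independent of any finitely many sources, and for
    a shift invariant event this gives prob A' = (prob A')^2.\<close>
  have "prob A' = (\<integral>\<omega>. indicator A' \<omega> * prob A' \<partial>Pr)"
  proof (rule prob_eq_integral_of_approximation[OF sm sd A' inv'])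
    fix e :: real assume "e > 0"
    then obtain C J where C: "C \<in> sets Pr" "finite J" "dep_on J C" "prob ((A' - C) \<union> (C - A')) < e"
      using approx_finite_dim[OF A'] by blast
    note [measurable] = C(1)
    have "finite (SU -` J)" by (rule finite_vimageI[OF C(2)]) (auto simp: inj_on_def)
    then obtain p where p: "\<And>j. SU j \<in> J \<Longrightarrow> j < p"
      by (auto simp: finite_nat_set_iff_bounded)
    have "prob (C \<inter> {\<omega>\<in>space Pr. (sh ^^ p) \<omega> \<in> A'}) = prob C * prob {\<omega>. (sh ^^ p) \<omega> \<in> A'}"
    proof (simp, rule prob_Int_dep[where J=J and K="SU ` {p..}"])
      show "dep_on (SU ` {p..}) {\<omega>. (sh ^^ p) \<omega> \<in> A'}"
        unfolding dep_on_def
      proof (intro allI impI)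
        fix \<omega> \<omega>' :: "src \<Rightarrow> nat" assume eq: "\<forall>j\<in>SU ` {p..}. \<omega> j = \<omega>' j"
        have "(sh ^^ p) \<omega> \<in> A' \<longleftrightarrow> (sh ^^ p) \<omega>' \<in> A'"
          by (rule dep_onD[OF dA']) (use eq in \<open>auto simp: shU\<close>)
        then show "\<omega> \<in> {\<omega>. (sh ^^ p) \<omega> \<in> A'} \<longleftrightarrow> \<omega>' \<in> {\<omega>. (sh ^^ p) \<omega> \<in> A'}" by simp
      qed
      show "J \<inter> SU ` {p..} = {}" using p by force
    qed (use C in auto)
    also have "prob {\<omega>. (sh ^^ p) \<omega> \<in> A'} = prob A'" by (rule prob_iter[OF sm sd A'])
    also have "prob C * prob A' = (\<integral>\<omega>. indicator C \<omega> * prob A' \<partial>Pr)" by simp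
    finally show "\<exists>C\<in>sets Pr. prob ((A' - C) \<union> (C - A')) < e \<and>
      (\<exists>p. prob (C \<inter> {x\<in>space Pr. (sh ^^ p) x \<in> A'}) = (\<integral>x. indicator C x * prob A' \<partial>Pr))"
      using C by blast
  qed auto
  then have "prob A' = prob A' * prob A'" by simp
  then have "prob A' = 0 \<or> prob A' = 1" by simp
  moreover have "prob A = prob A'" by (rule finite_measure_eq_AE) (use AA' in auto)
  ultimately show ?thesis by simp
qed

text \<open>For offspring number constantly 1. \<open>push_ix\<close> reads the reversed edge back
  as the move of the first ancestor; \<open>line_ix\<close> skips it, so that sources are really
  lost, as \<open>zero_one_exch\<close> demands.\<close>

fun line_ix :: "src \<Rightarrow> src" where
  "line_ix (SK p) = SK (Suc p)"
| "line_ix (SXi (p, w)) = (if p = 0 then SXi (0, 0 # w) else SXi (Suc p, w))"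
| "line_ix (SU j) = SU j"
| "line_ix (SZ (p, w)) = (if p = 0 then SZ (0, 0 # w) else SZ (Suc p, w))"

text \<open>Strictly increased by \<open>line_ix\<close>, as \<open>slev\<close> is by
  \<open>spine_ix\<close>, off the letters: any finite set of such sources is eventually no longer
  read.\<close>

fun lev :: "src \<Rightarrow> nat" where
  "lev (SK p) = p"
| "lev (SXi (p, w)) = (if p = 0 then length w else p + 1)"
| "lev (SU j) = 0"
| "lev (SZ (p, w)) = p + (if p = 0 then length w else 0)"

fun slev :: "src \<Rightarrow> nat" where
  "slev (SK p) = p" | "slev (SXi (p, w)) = p" | "slev (SU j) = 0" | "slev (SZ (p, w)) = p"

definition Line :: "(src \<Rightarrow> nat) \<Rightarrow> src \<Rightarrow> nat" where
  "Line \<omega> = reindex line_ix (exch (0, [0]) \<omega>)"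

lemma zero_one_Spine:
  assumes "A \<in> sets Pr" "AE \<omega> in Pr. \<omega> \<in> A \<longleftrightarrow> Spine \<omega> \<in> A"
  shows "prob A = 0 \<or> prob A = 1"
proof (rule zero_one_exch[where a="(1, [])" and f=spine_ix and T=Spine and lev=slev])
  show "Spine = (\<lambda>\<omega>. reindex spine_ix (exch (1, []) \<omega>))" by (simp add: Spine_def[abs_def])
  show "law (spine_ix s) = law s" if "s \<in> used" for s using that by (cases s rule: push_ix.cases) auto
  show "spine_ix s \<in> used - range SU \<and> spine_ix s \<noteq> SZ (1, []) \<and> slev s < slev (spine_ix s)"
    if "s \<in> used - range SU" for s
    using that by (cases s rule: push_ix.cases) auto
qed (use assms inj_spine_ix in auto)

lemma inj_line_ix: "inj_on line_ix used"
proof (rule inj_onI)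
  fix s t assume "s \<in> used" "t \<in> used" "line_ix s = line_ix t"
  then show "s = t"
    by (cases s rule: push_ix.cases; cases t rule: push_ix.cases) (auto split: if_splits)
qed

lemma law_line_ix: "s \<in> used \<Longrightarrow> law (line_ix s) = law s"
  by (cases s rule: push_ix.cases) auto

lemma zero_one_Line:
  assumes "A \<in> sets Pr" "AE \<omega> in Pr. \<omega> \<in> A \<longleftrightarrow> Line \<omega> \<in> A"
  shows "prob A = 0 \<or> prob A = 1"
proof (rule zero_one_exch[where a="(0, [0])" and f=line_ix and T=Line and lev=lev])
  show "Line = (\<lambda>\<omega>. reindex line_ix (exch (0, [0]) \<omega>))" by (simp add: Line_def[abs_def])
  show "line_ix s \<in> used - range SU \<and> line_ix s \<noteq> SZ (0, [0]) \<and> lev s < lev (line_ix s)"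
    if "s \<in> used - range SU" for s
    using that by (cases s rule: push_ix.cases) auto
qed (use assms inj_line_ix law_line_ix in auto)

lemma distr_Line: "distr Pr Pr Line = Pr"
  unfolding Line_def[abs_def]
  by (rule distr_comp[OF measurable_exch measurable_reindex distr_exch distr_reindex[OF inj_line_ix law_line_ix]]) simp

lemma measurable_Line [measurable]: "Line \<in> Pr \<rightarrow>\<^sub>M Pr"
  unfolding Line_def[abs_def] by measurable

lemma Line_Y:
  assumes "tF \<omega> = range (\<lambda>n. (0, replicate n 0))" "tF (Line \<omega>) = range (\<lambda>n. (0, replicate n 0))"
  shows "\<exists>l. \<forall>n. Y (Line \<omega>) n = wshift l (Y \<omega> (Suc n))"
proof (intro exI allI)
  fix n
  define l where "l = fst (wmove (tO \<omega>) (\<omega> (SZ (0, [0]))))"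
  have o: "tO (Line \<omega>) = wshift l (wmove (tO \<omega>) (\<omega> (SZ (0, [0]))))"
    unfolding Line_def l_def by (subst tO_reindex) (simp_all add: exch_start)
  have Z0: "Line \<omega> (SZ (0, v)) = \<omega> (SZ (0, 0 # v))" if "v \<noteq> []" for v
    using that by (simp add: Line_def reindex_def)
  have "Y (Line \<omega>) n = wshift l (walk (\<lambda>a. Line \<omega> (SZ a)) 0 [] (wmove (tO \<omega>) (\<omega> (SZ (0, [0])))) (replicate n 0))"
    by (simp add: Y_def line_enum(2)[OF assms(2)] tX_eq o walk_shift)
  also have "walk (\<lambda>a. Line \<omega> (SZ a)) 0 [] (wmove (tO \<omega>) (\<omega> (SZ (0, [0])))) (replicate n 0) =
      walk (\<lambda>a. \<omega> (SZ a)) 0 [0] (wmove (tO \<omega>) (\<omega> (SZ (0, [0])))) (replicate n 0)"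
    by (rule walk_cong) (auto simp: Z0)
  also have "\<dots> = Y \<omega> (Suc n)" by (simp add: Y_def line_enum(2)[OF assms(1)] tX_eq)
  finally show "Y (Line \<omega>) n = wshift (fst (wmove (tO \<omega>) (\<omega> (SZ (0, [0]))))) (Y \<omega> (Suc n))" unfolding l_def .
qed

end

subsection \<open>Density of the range\<close>

definition range_size :: "(nat \<Rightarrow> 'b) \<Rightarrow> nat \<Rightarrow> nat" where
  "range_size y n = card (y ` {..<n})"

text \<open>Counting a value at its last visit before \<open>n\<close> turns novelty into a
  condition on the future, which is what the iterates of \<open>Succ\<close> see.\<close>

lemma range_size_last:
  "range_size y n = card {k. k < n \<and> (\<forall>j. k < j \<longrightarrow> j < n \<longrightarrow> y j \<noteq> y k)}"
proof -
  let ?L = "{k. k < n \<and> (\<forall>j. k < j \<longrightarrow> j < n \<longrightarrow> y j \<noteq> y k)}"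
  have inj: "inj_on y ?L"
  proof (rule inj_onI)
    fix i k assume "i \<in> ?L" "k \<in> ?L" "y i = y k"
    then show "i = k" by (metis (mono_tags, lifting) mem_Collect_eq linorder_neqE_nat)
  qed
  have "y ` ?L = y ` {..<n}"
  proof (intro equalityI subsetI)
    fix x assume "x \<in> y ` {..<n}"
    then obtain i where i: "i < n" "x = y i" by auto
    let ?S = "{k. k < n \<and> y k = x}"
    have fin: "finite ?S" and ne: "?S \<noteq> {}" using i by auto
    define m where "m = Max ?S"
    have "m \<in> ?S" unfolding m_def using Max_in[OF fin ne] .
    then have "m < n" "x = y m" by auto
    moreover have "y j \<noteq> x" if "m < j" "j < n" for j
    proof
      assume "y j = x"
      then have "j \<in> ?S" using that by simp
      then show False using Max_ge[OF fin] that(1) unfolding m_def by (metis not_le)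
    qed
    ultimately show "x \<in> y ` ?L" by blast
  qed auto
  then show ?thesis unfolding range_size_def using card_image[OF inj] by (simp only:)
qed

text \<open>Without their first \<open>K\<close> and \<open>K'\<close> terms the sequences agree
  after applying \<open>g'\<close> and \<open>g\<close>, and deleted terms change the number of
  values by at most their own number.\<close>

lemma card_image_shift_le:
  assumes e: "\<And>n. g' (u (K + n)) = g (v (K' + n))" and gi: "inj g'"
  shows "card (u ` {..<n}) \<le> card (v ` {..<n}) + (K + K')"
proof -
  have "u ` {..<n} \<subseteq> u ` {..<K} \<union> (\<lambda>m. u (K + m)) ` {..<n - K}"
  proof
    fix x assume "x \<in> u ` {..<n}"
    then obtain i where i: "i < n" "x = u i" by auto
    show "x \<in> u ` {..<K} \<union> (\<lambda>m. u (K + m)) ` {..<n - K}"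
    proof (cases "i < K")
      case False
      then have "x = u (K + (i - K))" "i - K < n - K" using i by auto
      then show ?thesis by blast
    qed (use i in auto)
  qed
  then have "card (u ` {..<n}) \<le> card (u ` {..<K} \<union> (\<lambda>m. u (K + m)) ` {..<n - K})" by (intro card_mono) auto
  also have "\<dots> \<le> card (u ` {..<K}) + card ((\<lambda>m. u (K + m)) ` {..<n - K})" by (rule card_Un_le)
  also have "card (u ` {..<K}) \<le> K" using card_image_le[of "{..<K}" u] by simp
  also have "card ((\<lambda>m. u (K + m)) ` {..<n - K}) = card (g' ` (\<lambda>m. u (K + m)) ` {..<n - K})"
    by (rule card_image[symmetric]) (use gi in \<open>auto intro: inj_on_subset\<close>)
  also have "g' ` (\<lambda>m. u (K + m)) ` {..<n - K} = g ` (\<lambda>m. v (K' + m)) ` {..<n - K}"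
    by (simp add: image_image e)
  also have "card \<dots> \<le> card ((\<lambda>m. v (K' + m)) ` {..<n - K})" by (rule card_image_le) auto
  also have "\<dots> \<le> card (v ` {..<n} \<union> v ` {n..<n + K'})"
  proof (rule card_mono)
    show "(\<lambda>m. v (K' + m)) ` {..<n - K} \<subseteq> v ` {..<n} \<union> v ` {n..<n + K'}"
    proof
      fix x assume "x \<in> (\<lambda>m. v (K' + m)) ` {..<n - K}"
      then obtain m where m: "m < n - K" "x = v (K' + m)" by auto
      then show "x \<in> v ` {..<n} \<union> v ` {n..<n + K'}" by (cases "K' + m < n") auto
    qed
  qed auto
  also have "\<dots> \<le> card (v ` {..<n}) + card (v ` {n..<n + K'})" by (rule card_Un_le)
  also have "card (v ` {n..<n + K'}) \<le> K'" using card_image_le[of "{n..<n + K'}" v] by simp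
  finally show ?thesis by simp
qed

lemma range_size_perturb:
  assumes eq: "\<And>n. y' (N' + n) = h (y (N + n))" and h: "inj h"
  shows "range_size y n \<le> range_size y' n + (N + N')" "range_size y' n \<le> range_size y n + (N + N')"
proof -
  show "range_size y n \<le> range_size y' n + (N + N')"
    unfolding range_size_def by (rule card_image_shift_le[where g'=h and g="\<lambda>x. x"]) (use eq h in auto)
  show "range_size y' n \<le> range_size y n + (N + N')"
    unfolding range_size_def using card_image_shift_le[where g'="\<lambda>x. x" and g=h and u=y' and v=y and K=N' and K'=N] eq
    by (simp add: add.commute)
qed

text \<open>The upper limit of r n / n is at least \<open>q\<close>, written with countable
  quantifiers. Used for the range and for its negative, hence for upper and lower densities.\<close>

definition slope_ge :: "real \<Rightarrow> (nat \<Rightarrow> real) \<Rightarrow> bool" where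
  "slope_ge q r \<longleftrightarrow> (\<forall>k N. \<exists>n\<ge>N. r n > (q - 1 / Suc k) * real n)"

lemma slope_ge_perturb:
  assumes r: "slope_ge q r" and C: "\<And>n. r n \<le> r' n + C"
  shows "slope_ge q r'"
  unfolding slope_ge_def
proof (intro allI)
  fix k N
  \<comment> \<open>Beyond this index \<open>C\<close> takes at most half of the allowed slack n /
    (k + 1).\<close>
  define N' where "N' = max N (nat \<lceil>C * (2 * real k + 2)\<rceil>)"
  obtain n where n: "n \<ge> N'" "r n > (q - 1 / Suc (2 * k + 1)) * real n"
    using r unfolding slope_ge_def by blast
  have "C * (2 * real k + 2) \<le> real n" using n(1) by (simp add: N'_def)
  then have "C \<le> real n / (2 * real k + 2)" by (simp add: field_simps)
  moreover have "(q - 1 / Suc (2 * k + 1)) * real n = (q - 1 / Suc k) * real n + real n / (2 * real k + 2)"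
  proof -
    define h where "h = 1 / real (Suc k)"
    have "1 / real (Suc (2 * k + 1)) = h / 2" "real n / (2 * real k + 2) = h / 2 * real n"
      by (simp_all add: h_def field_simps)
    then show ?thesis unfolding h_def[symmetric] by (simp add: algebra_simps)
  qed
  ultimately have "r' n > (q - 1 / Suc k) * real n" using n(2) C[of n] by linarith
  moreover have "n \<ge> N" using n(1) by (simp add: N'_def)
  ultimately show "\<exists>n\<ge>N. r' n > (q - 1 / Suc k) * real n" by blast
qed

lemma not_slope_geD:
  assumes "\<not> slope_ge q r"
  shows "eventually (\<lambda>n. r n \<le> q * real n) sequentially"
proof -
  obtain k N where "\<And>n. n \<ge> N \<Longrightarrow> r n \<le> (q - 1 / Suc k) * real n"
    using assms unfolding slope_ge_def by (meson not_less)
  moreover have "(q - 1 / Suc k) * real n \<le> q * real n" for n by (intro mult_right_mono) auto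
  ultimately show ?thesis unfolding eventually_sequentially by (meson order_trans)
qed

context brw_law
begin

definition Rs :: "(src \<Rightarrow> nat) \<Rightarrow> nat \<Rightarrow> nat" where
  "Rs \<omega> = range_size (Y \<omega>)"

lemma src_meas_Pr: "src_meas Pr idS"
  by unfold_locales measurable

lemma pred_Y_eq [measurable]: "Measurable.pred Pr (\<lambda>\<omega>. Y \<omega> i = Y \<omega> j)"
proof -
  interpret src_meas Pr idS by (rule src_meas_Pr)
  have "wmeas Pr (\<lambda>\<omega>. Y \<omega> n)" for n
    using wmeas_enum[of n] unfolding src_enum_eq Y_def .
  then show ?thesis by (intro pred_wmeas_eq)
qed

lemma measurable_Rs [measurable]: "(\<lambda>\<omega>. Rs \<omega> n) \<in> Pr \<rightarrow>\<^sub>M count_space UNIV"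
proof -
  have "(\<lambda>\<omega>. Rs \<omega> n) = (\<lambda>\<omega>. \<Sum>k<n. if \<forall>j. k < j \<longrightarrow> j < n \<longrightarrow> Y \<omega> j \<noteq> Y \<omega> k then 1 else 0)"
  proof
    fix \<omega>
    show "Rs \<omega> n = (\<Sum>k<n. if \<forall>j. k < j \<longrightarrow> j < n \<longrightarrow> Y \<omega> j \<noteq> Y \<omega> k then 1 else 0)"
      unfolding Rs_def range_size_last by (subst sum.inter_filter[symmetric]) (auto simp: Int_def intro!: arg_cong[where f=card])
  qed
  also have "\<dots> \<in> Pr \<rightarrow>\<^sub>M count_space UNIV"
  proof (induction n)
    case 0 then show ?case by simp
  next
    case (Suc n)
    have "(\<lambda>\<omega>. \<Sum>k<m. if \<forall>j. k < j \<longrightarrow> j < l \<longrightarrow> Y \<omega> j \<noteq> Y \<omega> k then 1 else 0 :: nat) \<in> Pr \<rightarrow>\<^sub>M count_space UNIV" for m l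
    proof (induction m)
      case (Suc m)
      note [measurable] = Suc
      show ?case by simp
    qed simp
    then show ?case .
  qed
  finally show ?thesis .
qed

lemma slope_sets [measurable]:
  "{\<omega>. slope_ge q (\<lambda>n. real (Rs \<omega> n))} \<in> sets Pr" "{\<omega>. slope_ge q (\<lambda>n. - real (Rs \<omega> n))} \<in> sets Pr"
  unfolding slope_ge_def by measurable

lemma AE_transfer:
  assumes [measurable]: "T \<in> Pr \<rightarrow>\<^sub>M Pr" and "distr Pr Pr T = Pr" "AE \<omega> in Pr. Q \<omega>"
  shows "AE \<omega> in Pr. Q (T \<omega>)"
  by (rule AE_distrD[OF assms(1)]) (subst assms(2), rule assms(3))

lemma slope_cong:
  assumes "\<forall>n. Y \<omega>' (N' + n) = wshift l (Y \<omega> (N + n))"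
  shows "slope_ge q (\<lambda>n. real (Rs \<omega> n)) \<longleftrightarrow> slope_ge q (\<lambda>n. real (Rs \<omega>' n))"
    "slope_ge q (\<lambda>n. - real (Rs \<omega> n)) \<longleftrightarrow> slope_ge q (\<lambda>n. - real (Rs \<omega>' n))"
proof -
  have i: "inj (wshift l)" by (auto simp: inj_def)
  have 1: "real (Rs \<omega> n) \<le> real (Rs \<omega>' n) + real (N + N')" "real (Rs \<omega>' n) \<le> real (Rs \<omega> n) + real (N + N')" for n
    using range_size_perturb[where y="Y \<omega>" and y'="Y \<omega>'" and h="wshift l" and N=N and N'=N' and n=n] assms i
    unfolding Rs_def by (metis of_nat_add of_nat_mono)+
  show "slope_ge q (\<lambda>n. real (Rs \<omega> n)) \<longleftrightarrow> slope_ge q (\<lambda>n. real (Rs \<omega>' n))"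
    using slope_ge_perturb[of q "\<lambda>n. real (Rs \<omega> n)" "\<lambda>n. real (Rs \<omega>' n)", OF _ 1(1)]
      slope_ge_perturb[of q "\<lambda>n. real (Rs \<omega>' n)" "\<lambda>n. real (Rs \<omega> n)", OF _ 1(2)] by blast
  have 2: "- real (Rs \<omega> n) \<le> - real (Rs \<omega>' n) + real (N + N')" "- real (Rs \<omega>' n) \<le> - real (Rs \<omega> n) + real (N + N')" for n
    using 1[of n] by linarith+
  show "slope_ge q (\<lambda>n. - real (Rs \<omega> n)) \<longleftrightarrow> slope_ge q (\<lambda>n. - real (Rs \<omega>' n))"
    using slope_ge_perturb[of q "\<lambda>n. - real (Rs \<omega> n)" "\<lambda>n. - real (Rs \<omega>' n)", OF _ 2(1)]
      slope_ge_perturb[of q "\<lambda>n. - real (Rs \<omega>' n)" "\<lambda>n. - real (Rs \<omega> n)", OF _ 2(2)] by blast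
qed

text \<open>On a line \<open>Spine\<close> would replace the whole infinite ray; there
  \<open>Line\<close>, which removes only the first vertex, takes its place.\<close>

lemma slope_zero_one:
  "prob {\<omega>. slope_ge q (\<lambda>n. real (Rs \<omega> n))} \<in> {0, 1}"
  "prob {\<omega>. slope_ge q (\<lambda>n. - real (Rs \<omega> n))} \<in> {0, 1}"
proof -
  let ?A = "{\<omega>. slope_ge q (\<lambda>n. real (Rs \<omega> n))}" and ?B = "{\<omega>. slope_ge q (\<lambda>n. - real (Rs \<omega> n))}"
  have "(prob ?A = 0 \<or> prob ?A = 1) \<and> (prob ?B = 0 \<or> prob ?B = 1)"
  proof (cases rule: offspring_cases)
    case 1
    have g: "AE \<omega> in Pr. wellenum (tF \<omega>) \<and> (\<forall>p. finite {v \<in> tF \<omega>. fst v = p})"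
      using AE_good AE_finite_blocks[OF 1(2)] by eventually_elim auto
    have ae: "AE \<omega> in Pr. \<exists>l N N'. \<forall>n. Y (Spine \<omega>) (N' + n) = wshift l (Y \<omega> (N + n))"
      using g AE_transfer[OF measurable_Spine distr_Spine g]
    proof eventually_elim
      case (elim \<omega>)
      have "{v \<in> tF \<omega>. fst v \<le> 1} = {v \<in> tF \<omega>. fst v = 0} \<union> {v \<in> tF \<omega>. fst v = 1}" by auto
      then have "finite {v \<in> tF \<omega>. fst v \<le> 1}" using elim by (simp only: finite_Un)
      then show ?case using elim by (intro Spine_enum) auto
    qed
    have "AE \<omega> in Pr. \<omega> \<in> ?A \<longleftrightarrow> Spine \<omega> \<in> ?A" using ae by eventually_elim (use slope_cong(1) in blast)
    moreover have "AE \<omega> in Pr. \<omega> \<in> ?B \<longleftrightarrow> Spine \<omega> \<in> ?B" using ae by eventually_elim (use slope_cong(2) in blast)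
    ultimately show ?thesis using zero_one_Spine slope_sets by blast
  next
    case 2
    note g = AE_line[OF 2(1)]
    have ae: "AE \<omega> in Pr. \<exists>l. \<forall>n. Y (Line \<omega>) (0 + n) = wshift l (Y \<omega> (1 + n))"
      using g AE_transfer[OF measurable_Line distr_Line g] by eventually_elim (use Line_Y in simp)
    have "AE \<omega> in Pr. \<omega> \<in> ?A \<longleftrightarrow> Line \<omega> \<in> ?A" using ae by eventually_elim (use slope_cong(1) in blast)
    moreover have "AE \<omega> in Pr. \<omega> \<in> ?B \<longleftrightarrow> Line \<omega> \<in> ?B" using ae by eventually_elim (use slope_cong(2) in blast)
    ultimately show ?thesis using zero_one_Line slope_sets by blast
  qed
  then show "prob ?A \<in> {0, 1}" "prob ?B \<in> {0, 1}" by auto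
qed

section \<open>Comparison of the range with Birkhoff sums along \<open>Succ\<close>\<close>

definition new_m :: "nat \<Rightarrow> (src \<Rightarrow> nat) \<Rightarrow> real" where
  "new_m m \<omega> = of_bool (\<forall>j. 1 \<le> j \<longrightarrow> j \<le> m \<longrightarrow> Y \<omega> j \<noteq> Y \<omega> 0)"

definition new_inf :: "(src \<Rightarrow> nat) \<Rightarrow> real" where
  "new_inf \<omega> = of_bool (\<forall>j\<ge>1. Y \<omega> j \<noteq> Y \<omega> 0)"

lemma measurable_new [measurable]: "new_m m \<in> borel_measurable Pr" "new_inf \<in> borel_measurable Pr"
  unfolding new_m_def[abs_def] new_inf_def[abs_def] of_bool_def by measurable

lemma AE_iter_Y:
  "AE \<omega> in Pr. \<forall>k. \<exists>l. \<forall>n. Y ((Succ ^^ k) \<omega>) n = wshift l (Y \<omega> (k + n))"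
  using AE_iter_invariant[OF measurable_Succ distr_Succ AE_good]
proof eventually_elim
  case (elim \<omega>)
  show ?case
  proof
    fix k
    show "\<exists>l. \<forall>n. Y ((Succ ^^ k) \<omega>) n = wshift l (Y \<omega> (k + n))"
    proof (induction k)
      case 0 then show ?case by (intro exI[of _ 0]) (simp add: wshift_def)
    next
      case (Suc k)
      then obtain l where l: "\<And>n. Y ((Succ ^^ k) \<omega>) n = wshift l (Y \<omega> (k + n))" by blast
      obtain r old where "wellenum (tF ((Succ ^^ k) \<omega>))" "rerooted ((Succ ^^ k) \<omega>) (Succ ((Succ ^^ k) \<omega>)) r old"
        using elim by blast
      then obtain l' where "\<And>n. Y (Succ ((Succ ^^ k) \<omega>)) n = wshift l' (Y ((Succ ^^ k) \<omega>) (Suc n))"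
        using rerooted_enum by blast
      then have "Y ((Succ ^^ Suc k) \<omega>) n = wshift (l + l') (Y \<omega> (Suc k + n))" for n by (simp add: l)
      then show ?case by blast
    qed
  qed
qed

lemma AE_range_bounds:
  "AE \<omega> in Pr. \<forall>n m. (\<Sum>k<n. new_inf ((Succ ^^ k) \<omega>)) \<le> real (Rs \<omega> n) \<and>
     real (Rs \<omega> n) \<le> real m + (\<Sum>k<n. new_m m ((Succ ^^ k) \<omega>))"
  using AE_iter_Y
proof eventually_elim
  case (elim \<omega>)
  have eq: "Y ((Succ ^^ k) \<omega>) i = Y ((Succ ^^ k) \<omega>) j \<longleftrightarrow> Y \<omega> (k + i) = Y \<omega> (k + j)" for k i j
    using elim[rule_format, of k] by auto
  have ni: "new_inf ((Succ ^^ k) \<omega>) = of_bool (\<forall>j\<ge>1. Y \<omega> (k + j) \<noteq> Y \<omega> k)" for k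
    unfolding new_inf_def eq by simp
  have nm: "new_m m ((Succ ^^ k) \<omega>) = of_bool (\<forall>j. 1 \<le> j \<longrightarrow> j \<le> m \<longrightarrow> Y \<omega> (k + j) \<noteq> Y \<omega> k)" for m k
    unfolding new_m_def eq by simp
  show ?case
  proof (intro allI conjI)
    fix n m
    let ?L = "{k. k < n \<and> (\<forall>j. k < j \<longrightarrow> j < n \<longrightarrow> Y \<omega> j \<noteq> Y \<omega> k)}"
    have s: "(\<Sum>k<n. of_bool (Q k)) = real (card {k. k < n \<and> Q k})" for Q
      unfolding of_bool_def by (subst sum.inter_filter[symmetric]) (auto simp: Int_def)
    have "{k. k < n \<and> (\<forall>j\<ge>1. Y \<omega> (k + j) \<noteq> Y \<omega> k)} \<subseteq> ?L"
    proof safe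
      fix k j assume "\<forall>j\<ge>1. Y \<omega> (k + j) \<noteq> Y \<omega> k" "k < j" "Y \<omega> j = Y \<omega> k"
      then show False by (metis One_nat_def Suc_leI le_add_diff_inverse less_imp_le zero_less_diff)
    qed
    then have "card {k. k < n \<and> (\<forall>j\<ge>1. Y \<omega> (k + j) \<noteq> Y \<omega> k)} \<le> card ?L" by (rule card_mono[rotated]) auto
    then show "(\<Sum>k<n. new_inf ((Succ ^^ k) \<omega>)) \<le> real (Rs \<omega> n)"
      unfolding ni s Rs_def range_size_last by simp
    let ?Q = "{k. k < n \<and> (\<forall>j. 1 \<le> j \<longrightarrow> j \<le> m \<longrightarrow> Y \<omega> (k + j) \<noteq> Y \<omega> k)}"
    \<comment> \<open>For the last \<open>m\<close> indices the window of length \<open>m\<close>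
      reaches \<open>n\<close> or beyond, so these are counted unconditionally.\<close>
    have "?L \<subseteq> ?Q \<union> {n - m..<n}"
    proof
      fix k assume k: "k \<in> ?L"
      show "k \<in> ?Q \<union> {n - m..<n}"
      proof (cases "k < n - m")
        case True
        then have "Y \<omega> (k + j) \<noteq> Y \<omega> k" if "1 \<le> j" "j \<le> m" for j using that k by auto
        then show ?thesis using k by auto
      qed (use k in auto)
    qed
    then have "card ?L \<le> card (?Q \<union> {n - m..<n})" by (rule card_mono[rotated]) auto
    also have "\<dots> \<le> card ?Q + card {n - m..<n}" by (rule card_Un_le)
    also have "\<dots> \<le> m + card ?Q" by simp
    finally show "real (Rs \<omega> n) \<le> real m + (\<Sum>k<n. new_m m ((Succ ^^ k) \<omega>))"
      unfolding nm s Rs_def range_size_last by linarith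
  qed
qed

definition cc :: real where "cc = (\<integral>\<omega>. new_inf \<omega> \<partial>Pr)"

lemma new_m_lim: "(\<lambda>m. \<integral>\<omega>. new_m m \<omega> \<partial>Pr) \<longlonglongrightarrow> cc"
  unfolding cc_def
proof (rule integral_dominated_convergence[where w="\<lambda>_. 1"])
  show "AE \<omega> in Pr. (\<lambda>m. new_m m \<omega>) \<longlonglongrightarrow> new_inf \<omega>"
  proof (rule AE_I2)
    fix \<omega>
    have "eventually (\<lambda>m. new_m m \<omega> = new_inf \<omega>) sequentially"
    proof (cases "\<exists>j\<ge>1. Y \<omega> j = Y \<omega> 0")
      case True
      then obtain j where "j \<ge> 1" "Y \<omega> j = Y \<omega> 0" by auto
      then have "new_inf \<omega> = 0" "\<forall>m\<ge>j. new_m m \<omega> = 0" unfolding new_inf_def new_m_def by auto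
      then show ?thesis unfolding eventually_sequentially by auto
    next
      case False
      then show ?thesis unfolding new_inf_def new_m_def by auto
    qed
    then show "(\<lambda>m. new_m m \<omega>) \<longlonglongrightarrow> new_inf \<omega>" by (rule tendsto_eventually)
  qed
qed (auto simp: new_m_def)

lemma integrable_new: "integrable Pr (new_m m)" "integrable Pr new_inf"
  by (rule integrable_const_bound[where B=1], auto simp: new_m_def new_inf_def)+

text \<open>Otherwise, by the zero-one law, the upper density is at least \<open>q\<close> almost
  surely. For \<open>m\<close> such that the mean of \<open>new_m m\<close> is below
  \<open>q0\<close>, the Birkhoff sums of \<open>new_m m - q0\<close> would then almost surely
  become positive, against \<open>maximal_ergodic\<close>.\<close>

lemma slope_upper:
  assumes "q > cc"
  shows "AE \<omega> in Pr. \<not> slope_ge q (\<lambda>n. real (Rs \<omega> n))"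
proof -
  let ?A = "{\<omega>. slope_ge q (\<lambda>n. real (Rs \<omega> n))}"
  have "prob ?A \<noteq> 1"
  proof
    assume "prob ?A = 1"
    then have ae: "AE \<omega> in Pr. slope_ge q (\<lambda>n. real (Rs \<omega> n))"
      by (subst (asm) prob_eq_1) auto
    \<comment> \<open>Half of the gap \<open>q - q0\<close> will pay for \<open>1 / Suc k\<close>,
      the other half for the boundary term \<open>m\<close>.\<close>
    define q0 where "q0 = (cc + q) / 2"
    have q0: "cc < q0" "q0 < q" using assms by (auto simp: q0_def field_simps)
    obtain m where m: "(\<integral>\<omega>. new_m m \<omega> \<partial>Pr) < q0"
      using order_tendstoD(2)[OF new_m_lim q0(1)] by (auto simp: eventually_sequentially)
    obtain k where k: "1 / real (Suc k) < (q - q0) / 2"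
      using q0 by (metis diff_gt_0_iff_gt half_gt_zero nat_approx_posE)
    have "(\<integral>\<omega>. new_m m \<omega> - q0 \<partial>Pr) \<ge> 0"
    proof (rule maximal_ergodic[OF measurable_Succ distr_Succ, where B="1 + \<bar>q0\<bar>"])
      show "\<bar>new_m m \<omega> - q0\<bar> \<le> 1 + \<bar>q0\<bar>" for \<omega> unfolding new_m_def of_bool_def by (auto split: if_splits)
      show "AE \<omega> in Pr. \<exists>n. (\<Sum>i<n. new_m m ((Succ ^^ i) \<omega>) - q0) > 0"
        using ae AE_range_bounds
      proof eventually_elim
        case (elim \<omega>)
        define N where "N = Suc (nat \<lceil>2 * real m / (q - q0)\<rceil>)"
        obtain n where n: "n \<ge> N" "real (Rs \<omega> n) > (q - 1 / Suc k) * real n"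
          using elim(1) unfolding slope_ge_def by blast
        have "2 * real m / (q - q0) < real n" using n(1) unfolding N_def by linarith
        then have mn: "real m < real n * ((q - q0) / 2)" using q0 by (simp add: field_simps)
        have "(q - 1 / Suc k) * real n \<ge> (q0 + (q - q0) / 2) * real n"
          using k by (intro mult_right_mono) (auto simp: field_simps)
        then have "(\<Sum>i<n. new_m m ((Succ ^^ i) \<omega>)) > q0 * real n"
        proof -
          have "(q0 + (q - q0) / 2) * real n = q0 * real n + real n * ((q - q0) / 2)" by (simp add: algebra_simps)
          then show ?thesis
            using n(2) elim(2)[rule_format, of n m] mn \<open>(q - 1 / Suc k) * real n \<ge> (q0 + (q - q0) / 2) * real n\<close> by linarith
        qed
        then show ?case by (intro exI[of _ n]) (simp add: sum_subtractf mult.commute)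
      qed
    qed auto
    then show False using m integrable_new(1)[of m] prob_space by simp
  qed
  then have "prob ?A = 0" using slope_zero_one(1)[of q] by auto
  then show ?thesis by (subst (asm) prob_eq_0) auto
qed

lemma slope_lower:
  assumes "q < cc"
  shows "AE \<omega> in Pr. \<not> slope_ge (- q) (\<lambda>n. - real (Rs \<omega> n))"
proof -
  let ?A = "{\<omega>. slope_ge (- q) (\<lambda>n. - real (Rs \<omega> n))}"
  have "prob ?A \<noteq> 1"
  proof
    assume "prob ?A = 1"
    then have ae: "AE \<omega> in Pr. slope_ge (- q) (\<lambda>n. - real (Rs \<omega> n))"
      by (subst (asm) prob_eq_1) auto
    define q0 where "q0 = (cc + q) / 2"
    have q0: "q < q0" "q0 < cc" using assms by (auto simp: q0_def field_simps)
    obtain k where k: "1 / real (Suc k) < q0 - q"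
      using q0 by (metis diff_gt_0_iff_gt nat_approx_posE)
    have "(\<integral>\<omega>. q0 - new_inf \<omega> \<partial>Pr) \<ge> 0"
    proof (rule maximal_ergodic[OF measurable_Succ distr_Succ, where B="1 + \<bar>q0\<bar>"])
      show "\<bar>q0 - new_inf \<omega>\<bar> \<le> 1 + \<bar>q0\<bar>" for \<omega> unfolding new_inf_def of_bool_def by (auto split: if_splits)
      show "AE \<omega> in Pr. \<exists>n. (\<Sum>i<n. q0 - new_inf ((Succ ^^ i) \<omega>)) > 0"
        using ae AE_range_bounds
      proof eventually_elim
        case (elim \<omega>)
        obtain n where n: "n \<ge> 1" "- real (Rs \<omega> n) > (- q - 1 / Suc k) * real n"
          using elim(1) unfolding slope_ge_def by blast
        have "(- q - 1 / Suc k) * real n \<ge> (- q0) * real n"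
          using k by (intro mult_right_mono) auto
        then have "(\<Sum>i<n. new_inf ((Succ ^^ i) \<omega>)) < q0 * real n"
          using n(2) elim(2)[rule_format, of n 0] by linarith
        then show ?case by (intro exI[of _ n]) (simp add: sum_subtractf mult.commute)
      qed
    qed auto
    then show False using q0 integrable_new(2) prob_space by (simp add: cc_def)
  qed
  then have "prob ?A = 0" using slope_zero_one(2)[of "- q"] by auto
  then show ?thesis by (subst (asm) prob_eq_0) auto
qed

lemma range_limit: "AE \<omega> in Pr. (\<lambda>n. real (card (Y \<omega> ` {1..n})) / real n) \<longlonglongrightarrow> cc"
proof -
  have "AE \<omega> in Pr. \<forall>k. \<not> slope_ge (cc + 1 / Suc k) (\<lambda>n. real (Rs \<omega> n))"
    unfolding AE_all_countable by (intro allI slope_upper) auto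
  moreover have "AE \<omega> in Pr. \<forall>k. \<not> slope_ge (- (cc - 1 / Suc k)) (\<lambda>n. - real (Rs \<omega> n))"
    unfolding AE_all_countable by (intro allI slope_lower) auto
  ultimately show ?thesis
  proof eventually_elim
    case (elim \<omega>)
    have lim: "(\<lambda>n. real (Rs \<omega> n) / real n) \<longlonglongrightarrow> cc"
    proof (rule LIMSEQ_I)
      fix e :: real assume "e > 0"
      then obtain k where k: "1 / real (Suc k) < e" by (metis nat_approx_posE)
      have "eventually (\<lambda>n. real (Rs \<omega> n) \<le> (cc + 1 / Suc k) * real n) sequentially"
        "eventually (\<lambda>n. - real (Rs \<omega> n) \<le> (- (cc - 1 / Suc k)) * real n) sequentially"
        by (rule not_slope_geD, use elim in blast)+
      then have "eventually (\<lambda>n. norm (real (Rs \<omega> n) / real n - cc) < e) sequentially"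
        using eventually_gt_at_top[of 0]
      proof eventually_elim
        case (elim n)
        then have "real (Rs \<omega> n) / real n \<le> cc + 1 / Suc k" "cc - 1 / Suc k \<le> real (Rs \<omega> n) / real n"
          by (simp_all add: field_simps)
        then show ?case using k by (simp add: abs_less_iff)
      qed
      then show "\<exists>no. \<forall>n\<ge>no. norm (real (Rs \<omega> n) / real n - cc) < e" by (simp add: eventually_sequentially)
    qed
    \<comment> \<open>\<open>Rs\<close> counts the indices below \<open>n\<close> including 0, the
      claim those from 1 to \<open>n\<close>.\<close>
    have d: "\<bar>real (card (Y \<omega> ` {1..n})) - real (Rs \<omega> n)\<bar> \<le> 1" for n
    proof -
      have "card (Y \<omega> ` {1..n}) \<le> card (insert (Y \<omega> n) (Y \<omega> ` {..<n}))"
        by (rule card_mono) (auto simp: image_iff less_le)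
      also have "\<dots> \<le> card (Y \<omega> ` {..<n}) + 1" using card_insert_le_m1 by (simp add: card_insert_if)
      finally have 1: "card (Y \<omega> ` {1..n}) \<le> Rs \<omega> n + 1" by (simp add: Rs_def range_size_def)
      have "Y \<omega> ` {..<n} \<subseteq> insert (Y \<omega> 0) (Y \<omega> ` {1..n})"
      proof
        fix x assume "x \<in> Y \<omega> ` {..<n}"
        then obtain i where "i < n" "x = Y \<omega> i" by auto
        then show "x \<in> insert (Y \<omega> 0) (Y \<omega> ` {1..n})" by (cases "i = 0") auto
      qed
      then have "card (Y \<omega> ` {..<n}) \<le> card (insert (Y \<omega> 0) (Y \<omega> ` {1..n}))" by (rule card_mono[rotated]) auto
      also have "\<dots> \<le> card (Y \<omega> ` {1..n}) + 1" by (simp add: card_insert_if)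
      finally show ?thesis using 1 by (simp add: Rs_def range_size_def)
    qed
    have "(\<lambda>n. real (card (Y \<omega> ` {1..n})) / real n - real (Rs \<omega> n) / real n) \<longlonglongrightarrow> 0"
    proof (rule Lim_null_comparison)
      show "eventually (\<lambda>n. norm (real (card (Y \<omega> ` {1..n})) / real n - real (Rs \<omega> n) / real n) \<le> 1 / real n) sequentially"
        using eventually_gt_at_top[of 0]
      proof eventually_elim
        case (elim n)
        have "real (card (Y \<omega> ` {1..n})) / real n - real (Rs \<omega> n) / real n = (real (card (Y \<omega> ` {1..n})) - real (Rs \<omega> n)) / real n"
          by (simp add: diff_divide_distrib)
        then show ?case using d[of n] elim by (simp add: divide_right_mono)
      qed
    qed (rule lim_1_over_n)
    from tendsto_add[OF this lim] show ?case by simp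
  qed
qed

end

subsection \<open>A superharmonic function\<close>

text \<open>\<open>desc x0 m x\<close>: \<open>x\<close> is a descendant of the ancestor of \<open>x0\<close> at height \<open>-m\<close> (for \<open>x0\<close> of
  height 0).\<close>

definition desc :: "wstar \<Rightarrow> nat \<Rightarrow> wstar \<Rightarrow> bool" where
  "desc x0 m x \<longleftrightarrow> - int m \<le> fst x \<and> (\<forall>j. snd x (nat (fst x + int m) + j) = snd x0 (m + j))"

lemma desc_parentD: "desc x0 m (wparent x) \<Longrightarrow> desc x0 m x \<and> - int m < fst x"
proof -
  assume d: "desc x0 m (wparent x)"
  then have h: "- int m < fst x" by (simp add: desc_def wparent_def)
  then have "nat (fst x + int m) = Suc (nat (fst x - 1 + int m))" by linarith
  then show ?thesis using d h by (auto simp: desc_def wparent_def)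
qed

lemma desc_childD:
  assumes "desc x0 m (wchild x i)"
  shows "(desc x0 m x) \<or> (i = snd x0 m \<and> fst x = - int (Suc m) \<and> desc x0 (Suc m) x)"
proof -
  have h: "- int m \<le> fst x + 1" and l: "\<And>j. case_nat i (snd x) (nat (fst x + 1 + int m) + j) = snd x0 (m + j)"
    using assms by (auto simp: desc_def wchild_def)
  show ?thesis
  proof (cases "- int m \<le> fst x")
    case True
    then have "nat (fst x + 1 + int m) = Suc (nat (fst x + int m))" by linarith
    then show ?thesis using l True by (simp add: desc_def)
  next
    case False
    then have e: "fst x = - int (Suc m)" using h by simp
    then have n: "nat (fst x + 1 + int m) = 0" "nat (fst x + int (Suc m)) = 0" by auto
    have "i = snd x0 m" using l[of 0] n by simp
    moreover have "snd x j = snd x0 (Suc m + j)" for j using l[of "Suc j"] n by simp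
    ultimately show ?thesis using e n by (simp add: desc_def)
  qed
qed

lemma desc_0: "fst x0 = 0 \<Longrightarrow> desc x0 0 x0"
  by (simp add: desc_def)

text \<open>The exponent is the depth of the confluence of \<open>x\<close> and \<open>x0\<close>;
  the value 0 stands for points that share no ancestor with \<open>x0\<close>.\<close>

definition pot :: "real \<Rightarrow> wstar \<Rightarrow> wstar \<Rightarrow> real" where
  "pot t x0 x = (if \<exists>m. desc x0 m x then t ^ (LEAST m. desc x0 m x) else 0)"

context brw_law
begin

abbreviation EZ :: "(nat \<Rightarrow> real) \<Rightarrow> real" where "EZ \<phi> \<equiv> measure_pmf.expectation zlaw \<phi>"

abbreviation bi :: real where "bi \<equiv> 1 / real b"

lemma bi: "0 < bi" "bi \<le> 1/2" using b2 by (auto simp: field_simps)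

lemma pot_nonneg: "0 \<le> pot bi x0 x" by (simp add: pot_def)

lemma pot_le:
  assumes "0 \<le> c" "\<And>m. desc x0 m x \<Longrightarrow> bi ^ m \<le> c"
  shows "pot bi x0 x \<le> c"
  using assms LeastI_ex[of "\<lambda>m. desc x0 m x"] by (auto simp: pot_def simp del: power_one_over)

lemma pot_le_pow:
  assumes "\<And>m. desc x0 m x \<Longrightarrow> k \<le> m"
  shows "pot bi x0 x \<le> bi ^ k"
  by (rule pot_le) (use assms bi in \<open>auto intro!: power_decreasing simp del: power_one_over\<close>)

lemma pot_le_1: "pot bi x0 x \<le> 1"
  using pot_le_pow[of x0 x 0] by simp

lemma pot_start: "fst x0 = 0 \<Longrightarrow> pot bi x0 x0 = 1"
proof -
  assume "fst x0 = 0"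
  then have d: "desc x0 0 x0" by (rule desc_0)
  then have "(LEAST m. desc x0 m x0) = 0" by (intro Least_eq_0)
  then show ?thesis using d by (auto simp: pot_def)
qed

lemma pot_height: "fst x = - int H \<Longrightarrow> pot bi x0 x \<le> bi ^ H"
  by (rule pot_le_pow) (simp add: desc_def)

lemma integrable_zlaw: "integrable (measure_pmf zlaw) (\<phi> :: nat \<Rightarrow> real)"
  by (rule integrable_measure_pmf_finite) (simp add: set_zlaw)

lemma EZ_mono: "(\<And>z. \<phi> z \<le> \<psi> z) \<Longrightarrow> EZ \<phi> \<le> EZ \<psi>"
  by (rule integral_mono[OF integrable_zlaw integrable_zlaw])

lemma EZ_eval: "EZ \<phi> = \<phi> 0 / 2 + (\<Sum>i=1..b. \<phi> i) / (2 * real b)"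
proof -
  have "EZ \<phi> = (\<Sum>z\<in>{..b}. \<phi> z * pmf zlaw z)"
    by (rule integral_measure_pmf_real) (auto simp: set_zlaw)
  also have "{..b} = insert 0 {1..b}" by auto
  also have "(\<Sum>z\<in>insert 0 {1..b}. \<phi> z * pmf zlaw z) = \<phi> 0 / 2 + (\<Sum>i=1..b. \<phi> i * (1 / (2 * real b)))"
    by (simp add: pmf_zlaw)
  finally show ?thesis by (simp add: sum_divide_distrib)
qed

text \<open>Strictly above the confluence level no neighbour has a larger value. At that level with
  depth m > 0, the parent has weight 1/2 and at most bi^(m+1), the child towards \<open>x0\<close>
  has weight 1/(2b) and at most bi^(m-1), the other children at most bi^m, and these bounds average
  to bi^m. At \<open>x0\<close> the parent and the children contribute at most 1/4 + 1/2, which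
  leaves the gap 1/4.\<close>

lemma pot_superharmonic:
  assumes x0: "fst x0 = 0"
  shows "EZ (\<lambda>z. pot bi x0 (wmove x z)) + of_bool (x = x0) / 4 \<le> pot bi x0 x"
proof -
  let ?v = "pot bi x0"
  have bpos: "real b > 0" using b2 by simp
  have E: "EZ (\<lambda>z. ?v (wmove x z)) = ?v (wparent x) / 2 + (\<Sum>i=1..b. ?v (wchild x i)) / (2 * real b)"
    unfolding EZ_eval by (simp add: wmove_def)
  show ?thesis
  proof (cases "\<exists>m. desc x0 m x")
    case False
    then have "\<not> desc x0 m (wparent x)" "\<not> desc x0 m (wchild x i)" for m i
      using desc_parentD desc_childD by blast+
    then have "?v (wparent x) = 0" "?v (wchild x i) = 0" for i by (auto simp: pot_def)
    moreover have "x \<noteq> x0" using False desc_0[OF x0] by auto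
    ultimately show ?thesis unfolding E by (simp add: pot_nonneg)
  next
    case True
    define m where "m = (LEAST m. desc x0 m x)"
    have dm: "desc x0 m x" unfolding m_def by (rule LeastI_ex[OF True])
    have ml: "m \<le> k" if "desc x0 k x" for k unfolding m_def by (rule Least_le[where P="\<lambda>m. desc x0 m x", OF that])
    have vx: "?v x = bi ^ m" using True by (simp add: pot_def m_def)
    have hm: "- int m \<le> fst x" using dm by (simp add: desc_def)
    show ?thesis
    proof (cases "- int m < fst x")
      case True
      have p: "?v (wparent x) \<le> bi ^ m" by (rule pot_le_pow) (use desc_parentD ml in blast)
      have c: "?v (wchild x i) \<le> bi ^ m" for i
      proof (rule pot_le_pow)
        fix k assume "desc x0 k (wchild x i)"
        from desc_childD[OF this] show "m \<le> k" using ml[of k] ml[of "Suc k"] True by auto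
      qed
      have "(\<Sum>i=1..b. ?v (wchild x i)) \<le> (\<Sum>i=1..b. bi ^ m)" by (rule sum_mono) (rule c)
      then have "(\<Sum>i=1..b. ?v (wchild x i)) / (2 * real b) \<le> bi ^ m / 2"
        using bpos by (simp add: field_simps)
      moreover have "x \<noteq> x0" using True x0 ml[of 0] desc_0[OF x0] by auto
      ultimately show ?thesis unfolding E vx using p by simp
    next
      case False
      then have h: "fst x = - int m" using hm by simp
      have p: "?v (wparent x) \<le> bi ^ Suc m"
      proof (rule pot_le_pow)
        fix k assume "desc x0 k (wparent x)"
        from desc_parentD[OF this] show "Suc m \<le> k" using h by auto
      qed
      show ?thesis
      proof (cases m)
        case 0
        have "(\<Sum>i=1..b. ?v (wchild x i)) \<le> (\<Sum>i=1..b. 1)" by (rule sum_mono) (rule pot_le_1)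
        then have "(\<Sum>i=1..b. ?v (wchild x i)) / (2 * real b) \<le> 1 / 2" using bpos by (simp add: field_simps)
        moreover have "?v (wparent x) \<le> 1 / 2" using p bi(2) 0 by simp
        moreover have "of_bool (x = x0) \<le> (1::real)" by (simp add: of_bool_def)
        moreover have "bi ^ m = 1" using 0 by simp
        ultimately show ?thesis unfolding E vx by linarith
      next
        case (Suc k)
        have c: "?v (wchild x i) \<le> bi ^ m + (if i = snd x0 k then bi ^ k - bi ^ m else 0)" for i
        proof (cases "i = snd x0 k")
          case True
          have "?v (wchild x i) \<le> bi ^ k"
          proof (rule pot_le_pow)
            fix l assume "desc x0 l (wchild x i)"
            from desc_childD[OF this] show "k \<le> l" using ml[of l] h Suc by auto
          qed
          then show ?thesis using True by simp
        next
          case False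
          have "?v (wchild x i) \<le> bi ^ m"
          proof (rule pot_le_pow)
            fix l assume "desc x0 l (wchild x i)"
            from desc_childD[OF this] show "m \<le> l" using ml[of l] h Suc False by auto
          qed
          then show ?thesis using False by simp
        qed
        have le: "bi ^ m \<le> bi ^ k" using Suc bi by (intro power_decreasing) (auto simp del: power_one_over)
        have "(\<Sum>i=1..b. ?v (wchild x i)) \<le> (\<Sum>i=1..b. bi ^ m + (if i = snd x0 k then bi ^ k - bi ^ m else 0))"
          by (rule sum_mono) (rule c)
        also have "\<dots> = real b * bi ^ m + (if snd x0 k \<in> {1..b} then bi ^ k - bi ^ m else 0)"
          by (simp add: sum.distrib sum.delta' del: power_one_over)
        also have "\<dots> \<le> real b * bi ^ m + (bi ^ k - bi ^ m)" using le by simp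
        also have "bi ^ k = real b * bi ^ m" using Suc bpos by simp
        finally have "(\<Sum>i=1..b. ?v (wchild x i)) / (2 * real b) \<le> (real b * bi ^ m + (real b * bi ^ m - bi ^ m)) / (2 * real b)"
          using bpos by (intro divide_right_mono) auto
        also have "\<dots> = bi ^ m - bi ^ Suc m / 2" using bpos by (simp add: field_simps)
        finally have "(\<Sum>i=1..b. ?v (wchild x i)) / (2 * real b) \<le> bi ^ m - bi ^ Suc m / 2" .
        moreover have "x \<noteq> x0" using h Suc x0 by auto
        ultimately show ?thesis unfolding E vx using p by simp
      qed
    qed
  qed
qed

section \<open>Walks of finite length: Green function, supermartingale bounds, survival\<close>

lemma pot_superharmonic': "fst x0 = 0 \<Longrightarrow> EZ (\<lambda>z. pot bi x0 (wmove x z)) \<le> pot bi x0 x"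
  using pot_superharmonic[of x0 x] by (simp add: of_bool_def split: if_splits)

text \<open>Expectation over \<open>n\<close> independent moves as an iterated integral, so that
  first-step analysis becomes induction.\<close>

primrec EL :: "nat \<Rightarrow> (nat list \<Rightarrow> real) \<Rightarrow> real" where
  "EL 0 \<phi> = \<phi> []"
| "EL (Suc n) \<phi> = EZ (\<lambda>z. EL n (\<lambda>zs. \<phi> (z # zs)))"

abbreviation pos :: "wstar \<Rightarrow> nat list \<Rightarrow> wstar" where "pos \<equiv> foldl wmove"

lemma EL_mono: "(\<And>zs. length zs = n \<Longrightarrow> \<phi> zs \<le> \<psi> zs) \<Longrightarrow> EL n \<phi> \<le> EL n \<psi>"
proof (induction n arbitrary: \<phi> \<psi>)
  case (Suc n)
  show ?case unfolding EL.simps by (intro EZ_mono Suc.IH Suc.prems) simp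
qed simp

lemma EL_const [simp]: "EL n (\<lambda>_. c) = c"
  by (induction n) simp_all

lemma EL_nonneg: "(\<And>zs. 0 \<le> \<phi> zs) \<Longrightarrow> 0 \<le> EL n \<phi>"
  using EL_mono[of n "\<lambda>_. 0" \<phi>] by simp

lemma EL_add: "EL n (\<lambda>zs. \<phi> zs + \<psi> zs) = EL n \<phi> + EL n \<psi>"
  by (induction n arbitrary: \<phi> \<psi>) (simp_all add: integrable_zlaw)

lemma EL_sum: "EL n (\<lambda>zs. \<Sum>i<(N::nat). \<phi> i zs) = (\<Sum>i<N. EL n (\<phi> i))"
  by (induction N) (simp_all add: EL_add)

lemma EL_cmult: "EL n (\<lambda>zs. c * \<phi> zs) = c * EL n \<phi>"
  by (induction n arbitrary: \<phi>) simp_all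

text \<open>Each visit to \<open>x0\<close> consumes the gap 1/4 in
  \<open>pot_superharmonic\<close>; hence the factor 4.\<close>

lemma green_bound:
  assumes x0: "fst x0 = 0"
  shows "(\<Sum>n<N. EL n (\<lambda>zs. of_bool (pos x zs = x0))) \<le> 4 * pot bi x0 x"
proof (induction N arbitrary: x)
  case (Suc N)
  have "(\<Sum>n<Suc N. EL n (\<lambda>zs. of_bool (pos x zs = x0))) =
     of_bool (x = x0) + (\<Sum>n<N. EZ (\<lambda>z. EL n (\<lambda>zs. of_bool (pos (wmove x z) zs = x0))))"
    by (subst sum.lessThan_Suc_shift) simp
  also have "(\<Sum>n<N. EZ (\<lambda>z. EL n (\<lambda>zs. of_bool (pos (wmove x z) zs = x0)))) =
     EZ (\<lambda>z. \<Sum>n<N. EL n (\<lambda>zs. of_bool (pos (wmove x z) zs = x0)))"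
    by (subst Bochner_Integration.integral_sum) (auto simp: integrable_zlaw)
  also have "\<dots> \<le> EZ (\<lambda>z. 4 * pot bi x0 (wmove x z))" by (rule EZ_mono) (rule Suc.IH)
  also have "\<dots> = 4 * EZ (\<lambda>z. pot bi x0 (wmove x z))" by simp
  finally show ?case using pot_superharmonic[OF x0, of x] by simp
qed (simp add: pot_nonneg)

text \<open>The last of the \<open>Suc p\<close> moves stands for the edge from the ancestor of
  index \<open>p\<close> into a bush; superharmonicity is used for this one step, on the event that
  the ancestor is deep.\<close>

lemma green_after:
  assumes x0: "fst x0 = 0" and e: "0 \<le> e"
  shows "EL (Suc p) (\<lambda>zs. of_bool (pot bi x0 (pos x (take p zs)) \<le> e) * pot bi x0 (pos x zs)) \<le> e"
proof (induction p arbitrary: x)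
  case 0
  have "EL (Suc 0) (\<lambda>zs. of_bool (pot bi x0 (pos x (take 0 zs)) \<le> e) * pot bi x0 (pos x zs)) =
    of_bool (pot bi x0 x \<le> e) * EZ (\<lambda>z. pot bi x0 (wmove x z))" by simp
  then show ?case using pot_superharmonic'[OF x0, of x] e by (auto simp: of_bool_def)
next
  case (Suc p)
  have "EL (Suc (Suc p)) (\<lambda>zs. of_bool (pot bi x0 (pos x (take (Suc p) zs)) \<le> e) * pot bi x0 (pos x zs)) =
     EZ (\<lambda>z. EL (Suc p) (\<lambda>zs. of_bool (pot bi x0 (pos (wmove x z) (take p zs)) \<le> e) * pot bi x0 (pos (wmove x z) zs)))"
    by simp
  also have "\<dots> \<le> EZ (\<lambda>z. e)" by (rule EZ_mono) (rule Suc.IH)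
  finally show ?case by simp
qed

text \<open>The maximal inequality for the nonnegative supermartingale given by \<open>pot\<close>
  along the walk.\<close>

lemma return_bound:
  assumes x0: "fst x0 = 0" and e: "0 < e"
  shows "EL n (\<lambda>zs. of_bool (\<exists>k\<le>n. e < pot bi x0 (pos x (take k zs)))) \<le> pot bi x0 x / e"
proof (induction n arbitrary: x)
  case 0
  then show ?case using e pot_nonneg[of x0 x] by (auto simp: of_bool_def field_simps)
next
  case (Suc n)
  show ?case
  proof (cases "e < pot bi x0 x")
    case True
    have "EL (Suc n) (\<lambda>zs. of_bool (\<exists>k\<le>Suc n. e < pot bi x0 (pos x (take k zs)))) \<le> EL (Suc n) (\<lambda>_. 1)"
      by (rule EL_mono) (simp add: of_bool_def)
    also have "\<dots> \<le> pot bi x0 x / e" using True e by (simp add: field_simps)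
    finally show ?thesis .
  next
    case False
    have ex: "(\<exists>k\<le>Suc n. Q k) \<longleftrightarrow> Q 0 \<or> (\<exists>k\<le>n. Q (Suc k))" for Q
      by (metis Suc_le_mono le0 not0_implies_Suc)
    have "EL (Suc n) (\<lambda>zs. of_bool (\<exists>k\<le>Suc n. e < pot bi x0 (pos x (take k zs)))) =
      EZ (\<lambda>z. EL n (\<lambda>zs. of_bool (\<exists>k\<le>n. e < pot bi x0 (pos (wmove x z) (take k zs)))))"
      unfolding EL.simps ex using False by simp
    also have "\<dots> \<le> EZ (\<lambda>z. pot bi x0 (wmove x z) / e)" by (rule EZ_mono) (rule Suc.IH)
    also have "\<dots> = EZ (\<lambda>z. pot bi x0 (wmove x z)) / e" by simp
    also have "\<dots> \<le> pot bi x0 x / e" using e pot_superharmonic'[OF x0] by (intro divide_right_mono) auto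
    finally show ?thesis .
  qed
qed

text \<open>Probability that simple random walk started from \<open>h\<close> has not hit 0 by time \<open>l\<close>.\<close>

fun surv :: "nat \<Rightarrow> nat \<Rightarrow> real" where
  "surv l 0 = 0"
| "surv 0 (Suc h) = 1"
| "surv (Suc l) (Suc h) = (surv l h + surv l (Suc (Suc h))) / 2"

text \<open>The expectation of \<open>s ^ min T l\<close> for the hitting time \<open>T\<close> of 0.\<close>

fun disc :: "real \<Rightarrow> nat \<Rightarrow> nat \<Rightarrow> real" where
  "disc s l 0 = 1"
| "disc s 0 (Suc h) = 1"
| "disc s (Suc l) (Suc h) = s * (disc s l h + disc s l (Suc (Suc h))) / 2"

lemma surv_bounds: "0 \<le> surv l h \<and> surv l h \<le> 1"
proof (induction l arbitrary: h)
  case 0 then show ?case by (cases h) auto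
next
  case (Suc l)
  show ?case
  proof (cases h)
    case (Suc k)
    then show ?thesis using Suc.IH[of k] Suc.IH[of "Suc (Suc k)"] by simp
  qed simp
qed

text \<open>With this \<open>s\<close> the function r^h is harmonic for the walk discounted by
  \<open>s\<close> at each step, and it is at most the terminal value 1.\<close>

lemma disc_ge:
  assumes r: "0 < r" "r \<le> 1" and s: "s = 2 * r / (1 + r\<^sup>2)"
  shows "r ^ h \<le> disc s l h"
proof (induction l arbitrary: h)
  case 0 then show ?case using r by (cases h) (auto simp: power_le_one simp del: power_Suc)
next
  case (Suc l)
  show ?case
  proof (cases h)
    case 0 then show ?thesis by simp
  next
    case (Suc k)
    have "0 < 1 + r\<^sup>2" by (simp add: add_pos_nonneg)
    then have "r ^ Suc k = s * (r ^ k + r ^ Suc (Suc k)) / 2"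
      by (simp add: s field_simps power2_eq_square)
    also have "\<dots> \<le> s * (disc s l k + disc s l (Suc (Suc k))) / 2"
      using r s by (intro divide_right_mono mult_left_mono add_mono Suc.IH) (auto intro!: divide_nonneg_nonneg)
    finally show ?thesis using Suc by simp
  qed
qed

text \<open>A path that survives up to time \<open>l\<close> carries the weight s^l, any other path
  at most 1.\<close>

lemma disc_le:
  assumes s: "0 \<le> s" "s \<le> 1"
  shows "disc s l h \<le> 1 - surv l h * (1 - s ^ l)"
proof (induction l arbitrary: h)
  case 0 then show ?case by (cases h) auto
next
  case (Suc l)
  show ?case
  proof (cases h)
    case 0 then show ?thesis by simp
  next
    case (Suc k)
    let ?q = "surv (Suc l) (Suc k)"
    have "disc s (Suc l) (Suc k) \<le> s * ((1 - surv l k * (1 - s ^ l)) + (1 - surv l (Suc (Suc k)) * (1 - s ^ l))) / 2"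
      unfolding disc.simps using s by (intro divide_right_mono mult_left_mono add_mono Suc.IH) auto
    also have "\<dots> = s * (1 - ?q * (1 - s ^ l))" by (simp add: field_simps)
    also have "\<dots> = s * (1 - ?q) + ?q * s ^ Suc l" by (simp add: algebra_simps del: surv.simps)
    also have "\<dots> \<le> 1 * (1 - ?q) + ?q * s ^ Suc l"
      using s surv_bounds[of "Suc l" "Suc k"] by (intro add_right_mono mult_right_mono) (auto simp del: surv.simps)
    finally show ?thesis using Suc by (simp add: algebra_simps del: surv.simps disc.simps)
  qed
qed

text \<open>For r = 1 - 2^(-j) one has 1 - s >= 4^(-j)/2, so that s^(4^j) <= 2/3, while r^h >= 1 - h
  2^(-j). Comparing \<open>disc_ge\<close> with \<open>disc_le\<close> then yields decay like the
  inverse square root of time.\<close>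

lemma surv_le: "surv (4 ^ j) h \<le> 3 * real h / 2 ^ j"
proof (cases "j = 0 \<or> h = 0")
  case True
  then show ?thesis
  proof (cases "h = 0")
    case False
    then have "1 \<le> real h" "j = 0" using True by auto
    then show ?thesis using surv_bounds[of "4 ^ j" h] by simp
  qed simp
next
  case False
  define d :: real where "d = 1 / 2 ^ j"
  define r where "r = 1 - d"
  define s where "s = 2 * r / (1 + r\<^sup>2)"
  define t where "t = d\<^sup>2 / 2"
  have two: "(2::real) ^ j \<ge> 2" using False by (metis one_le_numeral power_increasing power_one_right Suc_leI neq0_conv One_nat_def)
  have d: "0 < d" "d \<le> 1/2" using two by (auto simp: d_def field_simps)
  have r: "0 < r" "r \<le> 1" using d by (auto simp: r_def)
  have r2: "0 < 1 + r\<^sup>2" "1 + r\<^sup>2 \<le> 2" using r by (auto simp: add_pos_nonneg power_le_one)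
  have s1: "s = 1 - d\<^sup>2 / (1 + r\<^sup>2)" using r2(1) by (simp add: s_def r_def field_simps power2_eq_square)
  have st: "s \<le> 1 - t"
  proof -
    have "d\<^sup>2 / 2 \<le> d\<^sup>2 / (1 + r\<^sup>2)" using r2 by (intro divide_left_mono) auto
    then show ?thesis unfolding s1 t_def by simp
  qed
  have s0: "0 \<le> s" using r r2 by (auto simp: s_def intro!: divide_nonneg_nonneg)
  have s01: "s \<le> 1" using st by (simp add: t_def order_trans[OF st])
  have "d\<^sup>2 \<le> (1/2)\<^sup>2" using d by (intro power_mono) auto
  then have t01: "0 \<le> t" "t \<le> 1" by (auto simp: t_def power2_eq_square)
  have lt: "real (4 ^ j) * t = 1 / 2"
  proof -
    have "(4::real) ^ j = (2 ^ j)\<^sup>2" by (simp add: power2_eq_square flip: power_mult_distrib)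
    then show ?thesis by (simp add: t_def d_def power_divide)
  qed
  \<comment> \<open>Bernoulli's inequality for 1 + t: as 4^j t = 1/2, it bounds (1 - t)^(4^j) by
    2/3.\<close>
  have "(1 + real (4 ^ j) * t) * (1 - t) ^ (4 ^ j) \<le> (1 + t) ^ (4 ^ j) * (1 - t) ^ (4 ^ j)"
    using t01 by (intro mult_right_mono Bernoulli_inequality) auto
  also have "\<dots> = (1 - t\<^sup>2) ^ (4 ^ j)" by (simp add: power_mult_distrib[symmetric] algebra_simps power2_eq_square)
  also have "\<dots> \<le> 1" using t01 by (intro power_le_one) (auto simp: power_le_one abs_square_le_1)
  finally have "(1 - t) ^ (4 ^ j) \<le> 2 / 3" unfolding lt by simp
  moreover have "s ^ (4 ^ j) \<le> (1 - t) ^ (4 ^ j)" using st s0 by (intro power_mono) auto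
  ultimately have s3: "1 / 3 \<le> 1 - s ^ (4 ^ j)" by simp
  have "surv (4 ^ j) h * (1 / 3) \<le> surv (4 ^ j) h * (1 - s ^ (4 ^ j))"
    using s3 surv_bounds[of "4 ^ j" h] by (intro mult_left_mono) auto
  also have "\<dots> \<le> 1 - r ^ h"
    using disc_le[OF s0 s01, of "4 ^ j" h] disc_ge[OF r s_def, of h "4 ^ j"] by linarith
  also have "\<dots> \<le> real h * d"
  proof -
    have "1 + real h * (- d) \<le> (1 + (- d)) ^ h" using d by (intro Bernoulli_inequality) auto
    then show ?thesis by (simp add: r_def)
  qed
  finally show ?thesis by (simp add: d_def field_simps)
qed

text \<open>Here \<open>h\<close> is the height above level -H. Either that level is not met within
  \<open>l\<close> steps, or the walk reaches it, where \<open>pot\<close> is at most bi^H, and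
  \<open>return_bound\<close> applies from then on.\<close>

lemma late_bound:
  assumes x0: "fst x0 = 0" and e: "0 < e" and h: "fst x = int h - int H"
  shows "EL n (\<lambda>zs. of_bool (\<exists>k. l \<le> k \<and> k \<le> n \<and> e < pot bi x0 (pos x (take k zs)))) \<le> surv l h + bi ^ H / e"
  using h
proof (induction l arbitrary: n x h)
  case 0
  show ?case
  proof (cases h)
    case 0
    have "EL n (\<lambda>zs. of_bool (\<exists>k. 0 \<le> k \<and> k \<le> n \<and> e < pot bi x0 (pos x (take k zs)))) \<le> pot bi x0 x / e"
      using return_bound[OF x0 e, of n x] by simp
    also have "\<dots> \<le> bi ^ H / e" using pot_height[of x H x0] 0 \<open>fst x = int h - int H\<close> e by (intro divide_right_mono) auto
    finally show ?thesis using 0 by simp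
  next
    case (Suc k)
    have "EL n (\<lambda>zs. of_bool (\<exists>k. 0 \<le> k \<and> k \<le> n \<and> e < pot bi x0 (pos x (take k zs)))) \<le> EL n (\<lambda>_. 1)"
      by (rule EL_mono) (simp add: of_bool_def)
    then show ?thesis using Suc e bi by (auto intro: order_trans)
  qed
next
  case (Suc l)
  show ?case
  proof (cases h)
    case 0
    have "EL n (\<lambda>zs. of_bool (\<exists>k. Suc l \<le> k \<and> k \<le> n \<and> e < pot bi x0 (pos x (take k zs)))) \<le>
      EL n (\<lambda>zs. of_bool (\<exists>k\<le>n. e < pot bi x0 (pos x (take k zs))))"
      by (rule EL_mono) (auto simp: of_bool_def)
    also have "\<dots> \<le> pot bi x0 x / e" by (rule return_bound[OF x0 e])
    also have "\<dots> \<le> bi ^ H / e" using pot_height[of x H x0] 0 Suc.prems e by (intro divide_right_mono) auto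
    finally show ?thesis using 0 by simp
  next
    case (Suc h')
    show ?thesis
    proof (cases n)
      case 0
      then show ?thesis using e bi surv_bounds[of "Suc l" h] by simp
    next
      case (Suc n')
      have ex: "(\<exists>k. Suc l \<le> k \<and> k \<le> Suc n' \<and> Q k) \<longleftrightarrow> (\<exists>k. l \<le> k \<and> k \<le> n' \<and> Q (Suc k))" for Q
        by (metis Suc_le_D Suc_le_mono)
      have "EL n (\<lambda>zs. of_bool (\<exists>k. Suc l \<le> k \<and> k \<le> n \<and> e < pot bi x0 (pos x (take k zs)))) =
        EZ (\<lambda>z. EL n' (\<lambda>zs. of_bool (\<exists>k. l \<le> k \<and> k \<le> n' \<and> e < pot bi x0 (pos (wmove x z) (take k zs)))))"
        unfolding \<open>n = Suc n'\<close> EL.simps ex by simp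
      also have "\<dots> \<le> EZ (\<lambda>z. (if z = 0 then surv l h' else surv l (Suc (Suc h'))) + bi ^ H / e)"
      proof (rule EZ_mono)
        fix z
        have "fst (wmove x z) = int (if z = 0 then h' else Suc (Suc h')) - int H"
          using Suc.prems \<open>h = Suc h'\<close> by (simp add: wmove_def wparent_def wchild_def)
        from Suc.IH[OF this, of n']
        show "EL n' (\<lambda>zs. of_bool (\<exists>k. l \<le> k \<and> k \<le> n' \<and> e < pot bi x0 (pos (wmove x z) (take k zs)))) \<le>
          (if z = 0 then surv l h' else surv l (Suc (Suc h'))) + bi ^ H / e" by (auto split: if_splits)
      qed
      also have "\<dots> = surv (Suc l) (Suc h') + bi ^ H / e"
        unfolding EZ_eval using b2 by (simp add: sum.distrib field_simps)
      finally show ?thesis using \<open>h = Suc h'\<close> by simp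
    qed
  qed
qed

end

context brw_law
begin

subsection \<open>Positivity of the limit\<close>

lemma prob_le_coord:
  assumes A [measurable]: "A \<in> sets Pr" and le: "\<And>\<omega>. prob {\<omega>'. mix {j} \<omega> \<omega>' \<in> A} \<le> \<psi> (\<omega> j)"
  shows "ennreal (prob A) \<le> (\<integral>\<^sup>+k. ennreal (\<psi> k) \<partial>measure_pmf (law j))"
proof -
  have "ennreal (prob A) = (\<integral>\<^sup>+\<omega>. emeasure Pr {\<omega>'. mix {j} \<omega> \<omega>' \<in> A} \<partial>Pr)"
    unfolding emeasure_eq_measure[symmetric] by (rule emeasure_mix) measurable
  also have "\<dots> \<le> (\<integral>\<^sup>+\<omega>. ennreal (\<psi> (\<omega> j)) \<partial>Pr)"
    by (rule nn_integral_mono) (use le in \<open>auto simp: emeasure_eq_measure intro!: ennreal_leI\<close>)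
  also have "\<dots> = (\<integral>\<^sup>+k. ennreal (\<psi> k) \<partial>measure_pmf (law j))" by (rule nn_integral_coord)
  finally show ?thesis .
qed

lemma prob_le_EZ:
  assumes "SZ a \<in> used" "A \<in> sets Pr" "\<And>\<omega>. prob {\<omega>'. mix {SZ a} \<omega> \<omega>' \<in> A} \<le> \<psi> (\<omega> (SZ a))" "\<And>z. 0 \<le> \<psi> z"
  shows "prob A \<le> EZ \<psi>"
proof -
  have "ennreal (prob A) \<le> (\<integral>\<^sup>+k. ennreal (\<psi> k) \<partial>measure_pmf (law (SZ a)))"
    by (rule prob_le_coord) (use assms in auto)
  also have "\<dots> = ennreal (EZ \<psi>)"
    using assms by (simp add: nn_integral_eq_integral[OF integrable_zlaw])
  finally show ?thesis using assms by (subst (asm) ennreal_le_iff) (auto intro!: integral_nonneg_AE)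
qed

lemma measurable_moves [measurable]: "(\<lambda>\<omega>. map (\<lambda>a. \<omega> (SZ a)) js) \<in> Pr \<rightarrow>\<^sub>M count_space UNIV"
proof (induction js)
  case (Cons a js)
  have "(\<lambda>\<omega>. i # map (\<lambda>a. \<omega> (SZ a)) js) \<in> Pr \<rightarrow>\<^sub>M count_space UNIV" for i
    by (rule measurable_compose[OF Cons]) simp
  then have "(\<lambda>\<omega>. (\<lambda>i \<omega>. i # map (\<lambda>a. \<omega> (SZ a)) js) (\<omega> (SZ a)) \<omega>) \<in> Pr \<rightarrow>\<^sub>M count_space UNIV"
    by (rule measurable_compose_countable) measurable
  then show ?case by simp
qed simp

lemma sets_moves [measurable]:
  assumes [measurable]: "\<And>zs. E zs \<in> sets Pr"
  shows "{\<omega>. \<omega> \<in> E (map (\<lambda>a. \<omega> (SZ a)) js)} \<in> sets Pr"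
proof (rule Collect_in_sets)
  show "Measurable.pred Pr (\<lambda>\<omega>. \<omega> \<in> E (map (\<lambda>a. \<omega> (SZ a)) js))"
    by (rule measurable_compose_countable[where f="\<lambda>zs \<omega>. \<omega> \<in> E zs" and g="\<lambda>\<omega>. map (\<lambda>a. \<omega> (SZ a)) js"]) measurable
qed

text \<open>The listed moves are conditioned upon one after another; since \<open>E zs\<close>
  depends on other sources only, fixing them does not affect its probability.\<close>

lemma prob_moves_le:
  assumes "distinct js" "\<And>a. a \<in> set js \<Longrightarrow> SZ a \<in> used" "\<And>zs. E zs \<in> sets Pr"
    "\<And>zs. dep_on (- (SZ ` set js)) (E zs)"
    "\<And>zs. length zs = length js \<Longrightarrow> prob (E zs) \<le> \<phi> zs" "\<And>zs. 0 \<le> \<phi> zs"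
  shows "prob {\<omega>. \<omega> \<in> E (map (\<lambda>a. \<omega> (SZ a)) js)} \<le> EL (length js) \<phi>"
  using assms
proof (induction js arbitrary: E \<phi>)
  case (Cons a js)
  have [measurable]: "E zs \<in> sets Pr" for zs by (rule Cons.prems)
  show ?case unfolding length_Cons EL.simps
  proof (rule prob_le_EZ)
    show "SZ a \<in> used" using Cons.prems by simp
    show "{\<omega>. \<omega> \<in> E (map (\<lambda>a. \<omega> (SZ a)) (a # js))} \<in> sets Pr" by (rule sets_moves) measurable
    fix \<omega>
    have na: "a \<notin> set js" using Cons.prems by simp
    have m1: "mix {SZ a} \<omega> \<omega>' \<in> E zs \<longleftrightarrow> \<omega>' \<in> E zs" for \<omega>' zs
      by (rule dep_onD[OF Cons.prems(4)]) (auto simp: mix_def)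
    have m2: "map (\<lambda>c. mix {SZ a} \<omega> \<omega>' (SZ c)) js = map (\<lambda>c. \<omega>' (SZ c)) js" for \<omega>'
      using na by (auto simp: mix_def)
    have m3: "mix {SZ a} \<omega> \<omega>' (SZ a) = \<omega> (SZ a)" for \<omega>' by (simp add: mix_def)
    have "{\<omega>'. mix {SZ a} \<omega> \<omega>' \<in> {\<omega>. \<omega> \<in> E (map (\<lambda>a. \<omega> (SZ a)) (a # js))}} =
       {\<omega>'. \<omega>' \<in> E (\<omega> (SZ a) # map (\<lambda>a. \<omega>' (SZ a)) js)}"
      by (simp only: mem_Collect_eq list.map m1 m2 m3)
    also have "prob \<dots> \<le> EL (length js) (\<lambda>zs. \<phi> (\<omega> (SZ a) # zs))"
    proof (rule Cons.IH[of "\<lambda>zs. E (\<omega> (SZ a) # zs)" "\<lambda>zs. \<phi> (\<omega> (SZ a) # zs)"])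
      show "dep_on (- SZ ` set js) (E (\<omega> (SZ a) # zs))" for zs
        by (rule dep_on_mono[OF Cons.prems(4)]) auto
    qed (use Cons.prems in auto)
    finally show "prob {\<omega>'. mix {SZ a} \<omega> \<omega>' \<in> {\<omega>. \<omega> \<in> E (map (\<lambda>a. \<omega> (SZ a)) (a # js))}} \<le>
       EL (length js) (\<lambda>zs. \<phi> (\<omega> (SZ a) # zs))" .
  qed (use Cons.prems EL_nonneg in auto)
qed auto

text \<open>Some vertex \<open>n\<close> generations below (p, c) has label \<open>x0\<close>,
  computed as if (p, c) had label \<open>x\<close>. Keeping \<open>x\<close> free separates the
  event from the moves leading to (p, c).\<close>

definition hit :: "wstar \<Rightarrow> nat \<Rightarrow> nat \<Rightarrow> nat list \<Rightarrow> wstar \<Rightarrow> (src \<Rightarrow> nat) set" where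
  "hit x0 n p c x = {\<omega>. \<exists>w\<in>gw_set (\<lambda>u. \<omega> (SXi (p, c @ u))). length w = n \<and> walk (\<lambda>a. \<omega> (SZ a)) p c x w = x0}"

lemma hit_0: "hit x0 0 p c x = (if x = x0 then UNIV else {})"
  by (auto simp: hit_def intro: bexI[of _ "[]"])

lemma hit_Suc: "hit x0 (Suc n) p c x =
    {\<omega>. \<exists>i<\<omega> (SXi (p, c)). \<omega> \<in> hit x0 n p (c @ [i]) (wmove x (\<omega> (SZ (p, c @ [i]))))}"
proof (intro set_eqI iffI)
  fix \<omega> assume "\<omega> \<in> hit x0 (Suc n) p c x"
  then obtain w where w: "w \<in> gw_set (\<lambda>u. \<omega> (SXi (p, c @ u)))" "length w = Suc n" "walk (\<lambda>a. \<omega> (SZ a)) p c x w = x0"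
    by (auto simp: hit_def)
  then obtain i v where "w = i # v" by (cases w) auto
  then show "\<omega> \<in> {\<omega>. \<exists>i<\<omega> (SXi (p, c)). \<omega> \<in> hit x0 n p (c @ [i]) (wmove x (\<omega> (SZ (p, c @ [i]))))}"
    using w by (auto simp: hit_def)
next
  fix \<omega> assume "\<omega> \<in> {\<omega>. \<exists>i<\<omega> (SXi (p, c)). \<omega> \<in> hit x0 n p (c @ [i]) (wmove x (\<omega> (SZ (p, c @ [i]))))}"
  then obtain i w where "i < \<omega> (SXi (p, c))" "w \<in> gw_set (\<lambda>u. \<omega> (SXi (p, (c @ [i]) @ u)))" "length w = n"
    "walk (\<lambda>a. \<omega> (SZ a)) p (c @ [i]) (wmove x (\<omega> (SZ (p, c @ [i])))) w = x0" by (auto simp: hit_def)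
  then show "\<omega> \<in> hit x0 (Suc n) p c x" unfolding hit_def by (intro CollectI bexI[of _ "i # w"]) auto
qed

lemma sets_hit [measurable]: "hit x0 n p c x \<in> sets Pr"
proof (induction n arbitrary: c x)
  case (Suc n)
  note [measurable] = Suc
  have [measurable]: "Measurable.pred Pr (\<lambda>\<omega>. \<omega> \<in> hit x0 n p c' (wmove x (\<omega> s)))" for c' s
    by (rule measurable_compose_countable[where f="\<lambda>z \<omega>. \<omega> \<in> hit x0 n p c' (wmove x z)" and g="\<lambda>\<omega>. \<omega> s"]) measurable
  show ?case unfolding hit_Suc by measurable
qed (auto simp: hit_0 intro: sets.top[of Pr, simplified])

lemma dep_on_hit:
  "dep_on ({SXi (p, c @ u) | u. True} \<union> {SZ (p, c @ u) | u. u \<noteq> []}) (hit x0 n p c x)"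
  unfolding dep_on_def
proof (intro allI impI)
  fix \<omega> \<omega>' :: "src \<Rightarrow> nat"
  assume eq: "\<forall>j\<in>{SXi (p, c @ u) | u. True} \<union> {SZ (p, c @ u) | u. u \<noteq> []}. \<omega> j = \<omega>' j"
  have "gw_set (\<lambda>u. \<omega> (SXi (p, c @ u))) = gw_set (\<lambda>u. \<omega>' (SXi (p, c @ u)))"
    by (rule gw_set_cong) (use eq in blast)
  moreover have "walk (\<lambda>a. \<omega> (SZ a)) p c x w = walk (\<lambda>a. \<omega>' (SZ a)) p c x w" for w
    by (rule walk_cong) (use eq in blast)
  ultimately show "\<omega> \<in> hit x0 n p c x \<longleftrightarrow> \<omega>' \<in> hit x0 n p c x" by (simp add: hit_def)
qed

text \<open>A many-to-one bound: by the union bound over children, whose mean number is one, the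
  tree hits \<open>x0\<close> in generation \<open>n\<close> with at most the probability that a
  single walk is there at time \<open>n\<close>.\<close>

lemma prob_hit:
  assumes "c \<noteq> []" "p = 0 \<or> hd c \<noteq> 0"
  shows "prob (hit x0 n p c x) \<le> EL n (\<lambda>zs. of_bool (pos x zs = x0))"
  using assms
proof (induction n arbitrary: c x)
  case 0
  then show ?case using prob_space by (simp add: hit_0)
next
  case (Suc n)
  define s where "s = EL (Suc n) (\<lambda>zs. of_bool (pos x zs = x0))"
  have s0: "0 \<le> s" unfolding s_def by (rule EL_nonneg) simp
  let ?B = "\<lambda>i. {\<omega>. \<omega> \<in> hit x0 n p (c @ [i]) (wmove x (\<omega> (SZ (p, c @ [i]))))}"
  have B [measurable]: "?B i \<in> sets Pr" for i
  proof (rule Collect_in_sets)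
    show "Measurable.pred Pr (\<lambda>\<omega>. \<omega> \<in> hit x0 n p (c @ [i]) (wmove x (\<omega> (SZ (p, c @ [i])))))"
      by (rule measurable_compose_countable[where f="\<lambda>z \<omega>. \<omega> \<in> hit x0 n p (c @ [i]) (wmove x z)"]) measurable
  qed
  have PB: "prob (?B i) \<le> s" for i
  proof -
    have "prob (?B i) \<le> EZ (\<lambda>z. EL n (\<lambda>zs. of_bool (pos (wmove x z) zs = x0)))"
    proof (rule prob_le_EZ[where a="(p, c @ [i])"])
      show "SZ (p, c @ [i]) \<in> used" using Suc.prems by (auto simp: hd_append)
      fix \<omega>
      have "mix {SZ (p, c @ [i])} \<omega> \<omega>' \<in> hit x0 n p (c @ [i]) y \<longleftrightarrow> \<omega>' \<in> hit x0 n p (c @ [i]) y" for \<omega>' y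
        by (rule dep_onD[OF dep_on_hit]) (auto simp: mix_def)
      then have "{\<omega>'. mix {SZ (p, c @ [i])} \<omega> \<omega>' \<in> ?B i} = hit x0 n p (c @ [i]) (wmove x (\<omega> (SZ (p, c @ [i]))))"
        by (simp add: mix_def)
      also have "prob \<dots> \<le> EL n (\<lambda>zs. of_bool (pos (wmove x (\<omega> (SZ (p, c @ [i])))) zs = x0))"
        by (rule Suc.IH) (use Suc.prems in \<open>auto simp: hd_append\<close>)
      finally show "prob {\<omega>'. mix {SZ (p, c @ [i])} \<omega> \<omega>' \<in> ?B i} \<le> \<dots>" .
    qed (auto intro!: EL_nonneg)
    then show ?thesis by (simp add: s_def)
  qed
  have "ennreal (prob (hit x0 (Suc n) p c x)) \<le> (\<integral>\<^sup>+k. ennreal (real k * s) \<partial>measure_pmf (law (SXi (p, c))))"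
  proof (rule prob_le_coord)
    fix \<omega>
    have m: "mix {SXi (p, c)} \<omega> \<omega>' \<in> hit x0 n p (c @ [i]) y \<longleftrightarrow> \<omega>' \<in> hit x0 n p (c @ [i]) y" for \<omega>' y i
      by (rule dep_onD[OF dep_on_hit]) (auto simp: mix_def)
    have "{\<omega>'. mix {SXi (p, c)} \<omega> \<omega>' \<in> hit x0 (Suc n) p c x} = (\<Union>i<\<omega> (SXi (p, c)). ?B i)"
      unfolding hit_Suc by (auto simp: m) (auto simp: mix_def)
    also have "prob \<dots> \<le> (\<Sum>i<\<omega> (SXi (p, c)). prob (?B i))"
      by (rule finite_measure_subadditive_finite) (use B in auto)
    also have "\<dots> \<le> (\<Sum>i<\<omega> (SXi (p, c)). s)" by (rule sum_mono) (rule PB)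
    finally show "prob {\<omega>'. mix {SXi (p, c)} \<omega> \<omega>' \<in> hit x0 (Suc n) p c x} \<le> real (\<omega> (SXi (p, c))) * s" by simp
  qed measurable
  also have "law (SXi (p, c)) = \<mu>" using Suc.prems by (intro law_simps) auto
  also have "(\<integral>\<^sup>+k. ennreal (real k * s) \<partial>measure_pmf \<mu>) = (\<integral>\<^sup>+k. ennreal (real k) \<partial>measure_pmf \<mu>) * ennreal s"
    using s0 by (subst nn_integral_multc[symmetric]) (auto simp: ennreal_mult)
  also have "\<dots> = ennreal s" by (simp add: mean_nn)
  finally show ?case using s0 by (simp add: s_def[symmetric] del: EL.simps)
qed

section \<open>Bushes along the spine\<close>

lemma anc_lab_pos: "anc_lab Z x0 p = pos x0 (map (\<lambda>k. Z (Suc k, [])) [0..<p])"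
  by (induction p) auto

lemma walk_pos: "walk Z p u x w = pos x (map (\<lambda>k. Z (p, u @ take (Suc k) w)) [0..<length w])"
proof (induction w arbitrary: u x)
  case (Cons i w)
  have "[0..<length (i # w)] = 0 # map Suc [0..<length w]" by (simp add: upt_conv_Cons map_Suc_upt del: upt_Suc)
  then show ?case using Cons[of "u @ [i]"] by (simp add: comp_def del: upt_Suc)
qed simp

abbreviation sp :: "nat \<Rightarrow> addr" where "sp k \<equiv> (Suc k, [])"

text \<open>Truncated to ancestors at which \<open>pot\<close> is at most \<open>e\<close>, which is
  what makes the first moment small; the other ancestors are left to \<open>late\<close>.\<close>

definition bush :: "wstar \<Rightarrow> real \<Rightarrow> nat \<Rightarrow> nat \<Rightarrow> nat \<Rightarrow> (src \<Rightarrow> nat) set" where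
  "bush x0 e p i n = {\<omega>. \<omega> \<in> (\<lambda>zs. if pot bi x0 (pos x0 (take p zs)) \<le> e then hit x0 n p [i] (pos x0 zs) else {})
      (map (\<lambda>a. \<omega> (SZ a)) (map sp [0..<p] @ [(p, [i])]))}"

lemma bush_iff: "\<omega> \<in> bush x0 e p i n \<longleftrightarrow> pot bi x0 (anc_lab (\<lambda>a. \<omega> (SZ a)) x0 p) \<le> e \<and>
    (\<exists>w\<in>gw_set (\<lambda>u. \<omega> (SXi (p, i # u))). length w = n \<and>
       walk (\<lambda>a. \<omega> (SZ a)) p [] (anc_lab (\<lambda>a. \<omega> (SZ a)) x0 p) (i # w) = x0)"
  unfolding bush_def anc_lab_pos by (auto simp: hit_def comp_def)

lemma sets_bush [measurable]: "bush x0 e p i n \<in> sets Pr"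
  unfolding bush_def by (rule sets_moves) auto

text \<open>Summation over generations produces the Green function of a single walk, at most
  \<open>4 * pot\<close> at the top of the bush, and \<open>green_after\<close> bounds this one step
  after a deep ancestor.\<close>

lemma prob_bush:
  assumes x0: "fst x0 = 0" and pi: "1 \<le> p" "1 \<le> i" and e: "0 \<le> e"
  shows "prob (\<Union>n. bush x0 e p i n) \<le> 4 * e"
proof -
  let ?js = "map sp [0..<p] @ [(p, [i])]"
  have pn: "prob (bush x0 e p i n) \<le> EL (Suc p) (\<lambda>zs. of_bool (pot bi x0 (pos x0 (take p zs)) \<le> e) * EL n (\<lambda>zs'. of_bool (pos (pos x0 zs) zs' = x0)))" for n
  proof -
    have "prob (bush x0 e p i n) \<le> EL (length ?js) (\<lambda>zs. of_bool (pot bi x0 (pos x0 (take p zs)) \<le> e) * EL n (\<lambda>zs'. of_bool (pos (pos x0 zs) zs' = x0)))"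
      unfolding bush_def
    proof (rule prob_moves_le)
      show "distinct ?js" by (auto simp: distinct_map inj_on_def)
      show "SZ a \<in> used" if "a \<in> set ?js" for a using that pi by auto
      show "dep_on (- SZ ` set ?js) (if pot bi x0 (pos x0 (take p zs)) \<le> e then hit x0 n p [i] (pos x0 zs) else {})" for zs
      proof (cases "pot bi x0 (pos x0 (take p zs)) \<le> e")
        case True
        have "dep_on (- SZ ` set ?js) (hit x0 n p [i] (pos x0 zs))"
          by (rule dep_on_mono[OF dep_on_hit]) auto
        then show ?thesis using True by simp
      qed (simp add: dep_on_def)
      show "prob (if pot bi x0 (pos x0 (take p zs)) \<le> e then hit x0 n p [i] (pos x0 zs) else {}) \<le>
        of_bool (pot bi x0 (pos x0 (take p zs)) \<le> e) * EL n (\<lambda>zs'. of_bool (pos (pos x0 zs) zs' = x0))" for zs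
        using prob_hit[of "[i]" p x0 n "pos x0 zs"] pi by simp
    qed (auto intro!: mult_nonneg_nonneg EL_nonneg)
    then show ?thesis by simp
  qed
  have fin: "prob (\<Union>n<N. bush x0 e p i n) \<le> 4 * e" for N
  proof -
    have "prob (\<Union>n<N. bush x0 e p i n) \<le> (\<Sum>n<N. prob (bush x0 e p i n))"
      by (rule finite_measure_subadditive_finite) auto
    also have "\<dots> \<le> (\<Sum>n<N. EL (Suc p) (\<lambda>zs. of_bool (pot bi x0 (pos x0 (take p zs)) \<le> e) * EL n (\<lambda>zs'. of_bool (pos (pos x0 zs) zs' = x0))))"
      by (rule sum_mono) (rule pn)
    also have "\<dots> = EL (Suc p) (\<lambda>zs. \<Sum>n<N. of_bool (pot bi x0 (pos x0 (take p zs)) \<le> e) * EL n (\<lambda>zs'. of_bool (pos (pos x0 zs) zs' = x0)))"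
      by (rule EL_sum[symmetric])
    also have "\<dots> \<le> EL (Suc p) (\<lambda>zs. 4 * (of_bool (pot bi x0 (pos x0 (take p zs)) \<le> e) * pot bi x0 (pos x0 zs)))"
    proof (rule EL_mono)
      fix zs :: "nat list"
      show "(\<Sum>n<N. of_bool (pot bi x0 (pos x0 (take p zs)) \<le> e) * EL n (\<lambda>zs'. of_bool (pos (pos x0 zs) zs' = x0)))
         \<le> 4 * (of_bool (pot bi x0 (pos x0 (take p zs)) \<le> e) * pot bi x0 (pos x0 zs))"
        using green_bound[OF x0, of "pos x0 zs" N] by (simp add: of_bool_def)
    qed
    also have "\<dots> = 4 * EL (Suc p) (\<lambda>zs. of_bool (pot bi x0 (pos x0 (take p zs)) \<le> e) * pot bi x0 (pos x0 zs))"
      by (rule EL_cmult)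
    also have "\<dots> \<le> 4 * e" using green_after[OF x0 e, of p x0] by linarith
    finally show ?thesis .
  qed
  have "(\<lambda>N. prob (\<Union>n<N. bush x0 e p i n)) \<longlonglongrightarrow> prob (\<Union>N. \<Union>n<N. bush x0 e p i n)"
    by (rule finite_Lim_measure_incseq) (auto simp: incseq_def intro: order_less_le_trans)
  moreover have "(\<Union>N. \<Union>n<N. bush x0 e p i n) = (\<Union>n. bush x0 e p i n)" by blast
  ultimately show ?thesis using fin by (intro LIMSEQ_le_const2) auto
qed

definition late :: "wstar \<Rightarrow> real \<Rightarrow> nat \<Rightarrow> nat \<Rightarrow> (src \<Rightarrow> nat) set" where
  "late x0 e l n = {\<omega>. \<omega> \<in> (\<lambda>zs. if \<exists>k. l \<le> k \<and> k \<le> n \<and> e < pot bi x0 (pos x0 (take k zs)) then UNIV else {})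
     (map (\<lambda>a. \<omega> (SZ a)) (map sp [0..<n]))}"

lemma late_iff: "\<omega> \<in> late x0 e l n \<longleftrightarrow> (\<exists>k. l \<le> k \<and> k \<le> n \<and> e < pot bi x0 (anc_lab (\<lambda>a. \<omega> (SZ a)) x0 k))"
proof -
  have "take k (map (\<lambda>a. \<omega> (SZ a)) (map sp [0..<n])) = map (\<lambda>k. \<omega> (SZ (sp k))) [0..<k]" if "k \<le> n" for k
    using that by (simp add: take_map comp_def)
  then show ?thesis unfolding late_def anc_lab_pos by auto
qed

lemma UNIV_in_sets: "UNIV \<in> sets Pr" using sets.top[of Pr] by simp

lemma sets_late [measurable]: "late x0 e l n \<in> sets Pr"
  unfolding late_def by (rule sets_moves) (auto intro: UNIV_in_sets)

text \<open>The level -H is free: lowering it reduces the second term and makes it take longer to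
  reach.\<close>

lemma prob_late:
  assumes x0: "fst x0 = 0" and e: "0 < e"
  shows "prob (late x0 e l n) \<le> surv l H + bi ^ H / e"
proof -
  have "prob (late x0 e l n) \<le> EL (length (map sp [0..<n])) (\<lambda>zs. of_bool (\<exists>k. l \<le> k \<and> k \<le> n \<and> e < pot bi x0 (pos x0 (take k zs))))"
    unfolding late_def
    by (rule prob_moves_le) (auto simp: distinct_map inj_on_def dep_on_def intro: UNIV_in_sets)
  also have "\<dots> \<le> surv l H + bi ^ H / e"
    using late_bound[OF x0 e, of x0 H H n l] x0 by simp
  finally show ?thesis .
qed

lemma cc_eq: "cc = prob {\<omega>. \<forall>j\<ge>1. Y \<omega> j \<noteq> Y \<omega> 0}"
proof -
  have "cc = (\<integral>\<omega>. indicator {\<omega>. \<forall>j\<ge>1. Y \<omega> j \<noteq> Y \<omega> 0} \<omega> \<partial>Pr)"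
    unfolding cc_def by (rule Bochner_Integration.integral_cong) (auto simp: new_inf_def indicator_def)
  also have "\<dots> = prob {\<omega>. \<forall>j\<ge>1. Y \<omega> j \<noteq> Y \<omega> 0}" by simp
  finally show ?thesis .
qed

text \<open>Conditioning on the letters: \<omega>'' has the other sources of \<omega>' and the
  prescribed starting point. The bound \<open>d\<close> is uniform in \<open>x0\<close>, so it
  survives integration.\<close>

lemma new_inf_pos:
  assumes d: "d > 0" and NR: "\<And>x0. fst x0 = 0 \<Longrightarrow> \<exists>B\<in>sets Pr. prob B \<ge> d \<and>
    (AE \<omega>' in Pr. \<omega>' \<in> B \<longrightarrow> (\<forall>\<omega>''. (\<forall>s. s \<notin> range SU \<longrightarrow> \<omega>'' s = \<omega>' s) \<longrightarrow> tO \<omega>'' = x0 \<longrightarrow> (\<forall>j\<ge>1. Y \<omega>'' j \<noteq> Y \<omega>'' 0)))"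
  shows "cc > 0"
proof -
  let ?N = "{\<omega>. \<forall>j\<ge>1. Y \<omega> j \<noteq> Y \<omega> 0}"
  have N [measurable]: "?N \<in> sets Pr" by measurable
  have ge: "d \<le> prob {\<omega>'. mix (range SU) \<omega> \<omega>' \<in> ?N}" for \<omega>
  proof -
    obtain B where B: "B \<in> sets Pr" "prob B \<ge> d"
      "AE \<omega>' in Pr. \<omega>' \<in> B \<longrightarrow> (\<forall>\<omega>''. (\<forall>s. s \<notin> range SU \<longrightarrow> \<omega>'' s = \<omega>' s) \<longrightarrow> tO \<omega>'' = tO \<omega> \<longrightarrow> (\<forall>j\<ge>1. Y \<omega>'' j \<noteq> Y \<omega>'' 0))"
      using NR[of "tO \<omega>"] by (auto simp: src_o_def)
    have "prob B \<le> prob {\<omega>'. mix (range SU) \<omega> \<omega>' \<in> ?N}"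
    proof (rule finite_measure_mono_AE)
      show "AE \<omega>' in Pr. \<omega>' \<in> B \<longrightarrow> \<omega>' \<in> {\<omega>'. mix (range SU) \<omega> \<omega>' \<in> ?N}"
        using B(3)
      proof eventually_elim
        case (elim \<omega>')
        have "tO (mix (range SU) \<omega> \<omega>') = tO \<omega>" by (simp add: src_o_def mix_def)
        moreover have "\<forall>s. s \<notin> range SU \<longrightarrow> mix (range SU) \<omega> \<omega>' s = \<omega>' s" by (simp add: mix_def)
        ultimately show ?case using elim by blast
      qed
      show "{\<omega>'. mix (range SU) \<omega> \<omega>' \<in> ?N} \<in> sets Pr" by (rule sets_mix1[OF N])
    qed
    then show ?thesis using B by linarith
  qed
  have "ennreal d = (\<integral>\<^sup>+\<omega>. ennreal d \<partial>Pr)" using prob_space by (simp add: emeasure_eq_measure)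
  also have "\<dots> \<le> (\<integral>\<^sup>+\<omega>. emeasure Pr {\<omega>'. mix (range SU) \<omega> \<omega>' \<in> ?N} \<partial>Pr)"
    by (rule nn_integral_mono) (use ge in \<open>auto simp only: emeasure_eq_measure intro!: ennreal_leI\<close>)
  also have "\<dots> = emeasure Pr ?N" by (rule emeasure_mix[symmetric, OF N])
  finally have "d \<le> prob ?N" using d by (simp add: emeasure_eq_measure)
  then show ?thesis using d by (simp add: cc_eq)
qed

lemma tF_cong_SU:
  assumes "\<forall>s. s \<notin> range SU \<longrightarrow> \<omega>'' s = \<omega>' s"
  shows "tV \<omega>'' = tV \<omega>'" "\<omega>'' (SZ a) = \<omega>' (SZ a)" "\<omega>'' (SK p) = \<omega>' (SK p)" "\<omega>'' (SXi a) = \<omega>' (SXi a)"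
proof -
  show *: "\<omega>'' (SZ a) = \<omega>' (SZ a)" "\<omega>'' (SK p) = \<omega>' (SK p)" "\<omega>'' (SXi a) = \<omega>' (SXi a)" for a p using assms by auto
  show "tV \<omega>'' = tV \<omega>'" unfolding src_V_def * ..
qed

lemma Y_0: "wellenum (tF \<omega>) \<Longrightarrow> Y \<omega> 0 = tO \<omega>"
proof -
  assume W: "wellenum (tF \<omega>)"
  have "{u \<in> tF \<omega>. addr_less u root} = {}"
    using addr_less_root[OF fwd_canon] addr_less_asym fwd_irrefl by blast
  then have "rank (tF \<omega>) root = 0" "finite {u \<in> tF \<omega>. addr_less u root}" by (simp_all only: rank_def card.empty finite.emptyI)
  then have "fenum (tF \<omega>) 0 = root"
    using fenum_rank[of "tF \<omega>" root] by auto
  then show ?thesis by (simp add: Y_def root_def tX_eq)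
qed

text \<open>With probability 1/2 the first move goes to the parent, where \<open>pot\<close> is at
  most 1/2; since \<open>pot\<close> is 1 > 3/4 at \<open>x0\<close>, a return from there has
  probability at most (1/2)/(3/4) = 2/3. Altogether a return has probability at most (1/2)(2/3) +
  1/2 = 5/6.\<close>

lemma line_positive:
  assumes "pmf \<mu> 1 = 1"
  shows "cc > 0"
proof (rule new_inf_pos[where d="1/6"])
  fix x0 :: wstar assume x0: "fst x0 = 0"
  let ?js = "\<lambda>N. map (\<lambda>k. (0::nat, replicate (Suc k) (0::nat))) [0..<N]"
  define R where "R N = {\<omega>. \<omega> \<in> (\<lambda>zs. if \<exists>k. 1 \<le> k \<and> k \<le> N \<and> pos x0 (take k zs) = x0 then UNIV else {}) (map (\<lambda>a. \<omega> (SZ a)) (?js N))}" for N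
  have R_iff: "\<omega> \<in> R N \<longleftrightarrow> (\<exists>k. 1 \<le> k \<and> k \<le> N \<and> pos x0 (map (\<lambda>j. \<omega> (SZ (0, replicate (Suc j) 0))) [0..<k]) = x0)" for \<omega> N
  proof -
    have "take k (map (\<lambda>a. \<omega> (SZ a)) (?js N)) = map (\<lambda>j. \<omega> (SZ (0, replicate (Suc j) 0))) [0..<k]" if "k \<le> N" for k
      using that by (simp add: take_map comp_def)
    then show ?thesis unfolding R_def by auto
  qed
  have R [measurable]: "R N \<in> sets Pr" for N
    unfolding R_def by (rule sets_moves) (auto intro: UNIV_in_sets)
  have "prob (R N) \<le> 5 / 6" for N
  proof -
    have "prob (R N) \<le> EL (length (?js N)) (\<lambda>zs. of_bool (\<exists>k. 1 \<le> k \<and> k \<le> N \<and> pos x0 (take k zs) = x0))"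
      unfolding R_def
      by (rule prob_moves_le) (auto simp: distinct_map inj_on_def dep_on_def intro: UNIV_in_sets dest: arg_cong[where f=length])
    also have "\<dots> = EL N (\<lambda>zs. of_bool (\<exists>k. 1 \<le> k \<and> k \<le> N \<and> pos x0 (take k zs) = x0))" by simp
    also have "\<dots> \<le> 5 / 6"
    proof (cases N)
      case (Suc n)
      have ex: "(\<exists>k. 1 \<le> k \<and> k \<le> Suc n \<and> Q k) \<longleftrightarrow> (\<exists>k\<le>n. Q (Suc k))" for Q
        by (metis One_nat_def Suc_le_D Suc_le_mono le0)
      have "EL N (\<lambda>zs. of_bool (\<exists>k. 1 \<le> k \<and> k \<le> N \<and> pos x0 (take k zs) = x0)) =
        EZ (\<lambda>z. EL n (\<lambda>zs. of_bool (\<exists>k\<le>n. pos (wmove x0 z) (take k zs) = x0)))"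
        unfolding Suc EL.simps ex by simp
      also have "\<dots> \<le> EZ (\<lambda>z. if z = 0 then 2 / 3 else 1)"
      proof (rule EZ_mono)
        fix z
        show "EL n (\<lambda>zs. of_bool (\<exists>k\<le>n. pos (wmove x0 z) (take k zs) = x0)) \<le> (if z = 0 then 2 / 3 else 1)"
        proof (cases "z = 0")
          case True
          have "EL n (\<lambda>zs. of_bool (\<exists>k\<le>n. pos (wmove x0 z) (take k zs) = x0)) \<le>
            EL n (\<lambda>zs. of_bool (\<exists>k\<le>n. 3/4 < pot bi x0 (pos (wmove x0 z) (take k zs))))"
          proof (rule EL_mono)
            fix zs :: "nat list"
            have "3/4 < pot bi x0 y" if "y = x0" for y using that pot_start[OF x0] by simp
            then show "of_bool (\<exists>k\<le>n. pos (wmove x0 z) (take k zs) = x0) \<le> (of_bool (\<exists>k\<le>n. 3/4 < pot bi x0 (pos (wmove x0 z) (take k zs))) :: real)"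
              unfolding of_bool_def by auto
          qed
          also have "\<dots> \<le> pot bi x0 (wmove x0 z) / (3/4)" by (rule return_bound[OF x0]) simp
          also have "pot bi x0 (wmove x0 z) \<le> bi ^ 1"
            by (rule pot_height) (simp add: wmove_def True wparent_def x0)
          also have "bi ^ 1 / (3/4) \<le> 2/3" using bi(2) by simp
          finally show ?thesis using True by (simp add: divide_right_mono)
        next
          case False
          have "EL n (\<lambda>zs. of_bool (\<exists>k\<le>n. pos (wmove x0 z) (take k zs) = x0)) \<le> EL n (\<lambda>_. 1)"
            by (rule EL_mono) (simp add: of_bool_def)
          then show ?thesis using False by simp
        qed
      qed
      also have "\<dots> = 5 / 6" unfolding EZ_eval using b2 by simp
      finally show ?thesis .
    qed simp
    finally show ?thesis .
  qed
  moreover have "(\<lambda>N. prob (R N)) \<longlonglongrightarrow> prob (\<Union>N. R N)"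
  proof (rule finite_Lim_measure_incseq)
    show "incseq R" unfolding incseq_def subset_iff R_iff by (meson order_trans)
  qed auto
  ultimately have "prob (\<Union>N. R N) \<le> 5 / 6" by (intro LIMSEQ_le_const2) auto
  moreover have "prob (space Pr - (\<Union>N. R N)) = 1 - prob (\<Union>N. R N)" by (rule prob_compl) auto
  ultimately have ge: "1/6 \<le> prob (space Pr - (\<Union>N. R N))" by linarith
  have ae: "AE \<omega>' in Pr. \<omega>' \<in> space Pr - (\<Union>N. R N) \<longrightarrow> (\<forall>\<omega>''. (\<forall>s. s \<notin> range SU \<longrightarrow> \<omega>'' s = \<omega>' s) \<longrightarrow> tO \<omega>'' = x0 \<longrightarrow> (\<forall>j\<ge>1. Y \<omega>'' j \<noteq> Y \<omega>'' 0))"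
    using AE_line[OF assms]
  proof eventually_elim
    case (elim \<omega>')
    show ?case
    proof (intro impI allI)
      fix \<omega>'' and j :: nat
      assume nR: "\<omega>' \<in> space Pr - (\<Union>N. R N)" and eq: "\<forall>s. s \<notin> range SU \<longrightarrow> \<omega>'' s = \<omega>' s" and o: "tO \<omega>'' = x0" and j: "1 \<le> j"
      have F: "tF \<omega>'' = range (\<lambda>n. (0, replicate n 0))" using elim tF_cong_SU(1)[OF eq] by simp
      have "Y \<omega>'' j = walk (\<lambda>a. \<omega>' (SZ a)) 0 [] x0 (replicate j 0)"
        unfolding Y_def line_enum(2)[OF F] tX_eq by (simp add: o tF_cong_SU(2)[OF eq])
      also have "\<dots> = pos x0 (map (\<lambda>k. \<omega>' (SZ (0, replicate (Suc k) 0))) [0..<j])"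
        unfolding walk_pos by (auto simp: min_def intro!: arg_cong[where f="pos x0"])
      also have "\<dots> \<noteq> x0" using nR j R_iff[of \<omega>' j] by auto
      finally show "Y \<omega>'' j \<noteq> Y \<omega>'' 0" using Y_0[of \<omega>''] line_enum(1)[OF F] o by simp
    qed
  qed
  show "\<exists>B\<in>sets Pr. prob B \<ge> 1/6 \<and>
    (AE \<omega>' in Pr. \<omega>' \<in> B \<longrightarrow> (\<forall>\<omega>''. (\<forall>s. s \<notin> range SU \<longrightarrow> \<omega>'' s = \<omega>' s) \<longrightarrow> tO \<omega>'' = x0 \<longrightarrow> (\<forall>j\<ge>1. Y \<omega>'' j \<noteq> Y \<omega>'' 0)))"
  proof (rule bexI[of _ "space Pr - (\<Union>N. R N)"])
    show "space Pr - (\<Union>N. R N) \<in> sets Pr" by (rule sets.compl_sets) auto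
  qed (use ge ae in blast)
qed simp


text \<open>Summing the tails \<mu>{k..} over k > y counts, for each offspring number l, the k with
  y < k <= l; there are at most l of them, and none unless l > y.\<close>

lemma klaw_tail:
  "measure_pmf.prob klaw {y<..} \<le> measure_pmf.expectation \<mu> (\<lambda>l. real l * indicator {y<..} l)"
proof -
  have ind: "integrable (measure_pmf \<mu>) (\<lambda>l. indicator A l :: real)" for A :: "nat set"
    by (rule measure_pmf.integrable_const_bound[where B=1]) (auto simp: indicator_def)
  have int: "integrable (measure_pmf \<mu>) (\<lambda>l. real l * indicator {y<..} l)"
    by (rule Bochner_Integration.integrable_bound[OF mean_integrable]) (auto simp: indicator_def)
  have fin: "measure_pmf.prob klaw {y<..N} \<le> measure_pmf.expectation \<mu> (\<lambda>l. real l * indicator {y<..} l)" for N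
  proof -
    have "measure_pmf.prob klaw {y<..N} = (\<Sum>k\<in>{y<..N}. measure_pmf.prob \<mu> {k..})"
      by (subst measure_measure_pmf_finite) (auto simp: klaw intro!: sum.cong)
    also have "\<dots> = (\<Sum>k\<in>{y<..N}. measure_pmf.expectation \<mu> (\<lambda>l. indicator {k..} l))" by simp
    also have "\<dots> = measure_pmf.expectation \<mu> (\<lambda>l. \<Sum>k\<in>{y<..N}. indicator {k..} l)"
      by (rule Bochner_Integration.integral_sum[symmetric]) (rule ind)
    also have "\<dots> \<le> measure_pmf.expectation \<mu> (\<lambda>l. real l * indicator {y<..} l)"
    proof (rule integral_mono)
      show "integrable (measure_pmf \<mu>) (\<lambda>l. \<Sum>k\<in>{y<..N}. indicator {k..} l :: real)"
        by (rule Bochner_Integration.integrable_sum) (rule ind)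
      fix l
      show "(\<Sum>k\<in>{y<..N}. indicator {k..} l) \<le> real l * indicator {y<..} l"
      proof (cases "y < l")
        case True
        have "(\<Sum>k\<in>{y<..N}. indicator {k..} l :: real) = (\<Sum>k\<in>{y<..N} \<inter> {..l}. 1)"
          by (intro sum.mono_neutral_cong_right) (auto simp: indicator_def)
        also have "\<dots> = real (card ({y<..N} \<inter> {..l}))" by simp
        also have "card ({y<..N} \<inter> {..l}) \<le> card {1..l}" by (rule card_mono) auto
        finally show ?thesis using True by simp
      next
        case False
        have "(\<Sum>k\<in>{y<..N}. indicator {k..} l :: real) = 0" by (rule sum.neutral) (use False in auto)
        then show ?thesis by simp
      qed
    qed (rule int)
    finally show ?thesis .
  qed
  have "(\<lambda>N. measure_pmf.prob klaw {y<..N}) \<longlonglongrightarrow> measure_pmf.prob klaw (\<Union>N. {y<..N})"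
    by (rule measure_pmf.finite_Lim_measure_incseq) (auto simp: incseq_def)
  moreover have "(\<Union>N. {y<..N}) = {y<..}" by auto
  ultimately show ?thesis using fin by (intro LIMSEQ_le_const2) auto
qed

text \<open>Markov's inequality with weight ln(l)^s; y >= 2 keeps the logarithm positive.\<close>

lemma klaw_log_tail:
  assumes s: "s > 0" and sm: "summable (\<lambda>k. real k * ln (real k) powr s * pmf \<mu> k)"
  shows "\<exists>W\<ge>0. \<forall>y\<ge>2. measure_pmf.prob klaw {y<..} \<le> W / ln (real y) powr s"
proof -
  let ?f = "\<lambda>k. real k * ln (real k) powr s"
  have "(\<integral>\<^sup>+k. ennreal (?f k) \<partial>measure_pmf \<mu>) = (\<integral>\<^sup>+k. ennreal (?f k * pmf \<mu> k) \<partial>count_space UNIV)"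
    unfolding nn_integral_measure_pmf by (rule nn_integral_cong) (simp add: ennreal_mult mult.commute)
  also have "\<dots> = (\<Sum>k. ennreal (?f k * pmf \<mu> k))" by (rule nn_integral_count_space_nat)
  also have "\<dots> = ennreal (\<Sum>k. ?f k * pmf \<mu> k)" by (rule suminf_ennreal2) (use sm in auto)
  finally have int: "integrable (measure_pmf \<mu>) ?f" by (intro integrableI_nonneg) auto
  define W where "W = measure_pmf.expectation \<mu> ?f"
  have W0: "W \<ge> 0" unfolding W_def by (rule integral_nonneg_AE) simp
  have "measure_pmf.prob klaw {y<..} \<le> W / ln (real y) powr s" if y: "y \<ge> 2" for y
  proof -
    have ly: "ln (real y) > 0" using y by simp
    have "measure_pmf.prob klaw {y<..} \<le> measure_pmf.expectation \<mu> (\<lambda>l. real l * indicator {y<..} l)" by (rule klaw_tail)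
    also have "\<dots> \<le> measure_pmf.expectation \<mu> (\<lambda>l. ?f l / ln (real y) powr s)"
    proof (rule integral_mono)
      show "integrable (measure_pmf \<mu>) (\<lambda>l. real l * indicator {y<..} l)"
        by (rule Bochner_Integration.integrable_bound[OF mean_integrable]) (auto simp: indicator_def)
      show "integrable (measure_pmf \<mu>) (\<lambda>l. ?f l / ln (real y) powr s)" using int by simp
      fix l
      show "real l * indicator {y<..} l \<le> ?f l / ln (real y) powr s"
      proof (cases "y < l")
        case True
        then have "ln (real y) powr s \<le> ln (real l) powr s" using ly s y by (intro powr_mono2) auto
        then have "real l * ln (real y) powr s \<le> ?f l" by (intro mult_left_mono) auto
        then show ?thesis using True ly by (simp add: pos_le_divide_eq)
      qed simp
    qed
    also have "\<dots> = W / ln (real y) powr s" by (simp add: W_def)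
    finally show ?thesis .
  qed
  then show ?thesis using W0 by blast
qed

section \<open>Blocks of ancestors with index between consecutive powers of 4\<close>

lemma sets_coord: "{\<omega>. \<omega> j \<in> F} \<in> sets Pr"
  using sets_Collect_fin[of "{j}" "\<lambda>_. F"] by simp

text \<open>What may go wrong for the ancestors of index between \<open>4 ^ j\<close> and \<open>4 ^ Suc j\<close>: the
  confluence with the starting point is less deep than \<open>2 * L\<close>, some ancestor has more than
  \<open>2 ^ L\<close> children, or one of the bushes hits the starting point although neither is the case.\<close>

definition bad :: "wstar \<Rightarrow> nat \<Rightarrow> nat \<Rightarrow> (src \<Rightarrow> nat) set" where
  "bad x0 L j = late x0 (bi ^ (2 * L)) (4 ^ j) (4 ^ Suc j) \<union> (\<Union>p\<in>{4 ^ j..<4 ^ Suc j}. {\<omega>. \<omega> (SK p) \<in> {2 ^ L<..}}) \<union>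
     (\<Union>p\<in>{4 ^ j..<4 ^ Suc j}. \<Union>i\<in>{1..<2 ^ L}. \<Union>n. bush x0 (bi ^ (2 * L)) p i n)"

lemma sets_bad [measurable]: "bad x0 L j \<in> sets Pr"
  unfolding bad_def
  by (intro sets.Un sets_late sets_coord sets.countable_UN' sets_bush) auto

text \<open>The lateness is estimated with H = 4L, giving 12 L / 2^j and bi^(2L). At most 4^(j+1)
  ancestors with fewer than 2^L bushes each, every bush costing at most 4 4^(-L), give 16 4^j
  2^(-L); the constant 17 also absorbs bi^(2L).\<close>

lemma prob_bad:
  assumes x0: "fst x0 = 0" and W: "W \<ge> 0" "\<And>y. y \<ge> 2 \<Longrightarrow> measure_pmf.prob klaw {y<..} \<le> W / ln (real y) powr s" and L: "L \<ge> 1"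
  shows "prob (bad x0 L j) \<le> 12 * real L / 2 ^ j + 4 ^ Suc j * (W / (real L * ln 2) powr s) + 17 * 4 ^ j * (1/2) ^ L"
proof -
  let ?e = "bi ^ (2 * L)"
  let ?P = "{4 ^ j..<4 ^ Suc j} :: nat set"
  have e0: "0 < ?e" using bi by (intro zero_less_power)
  have e1: "?e \<le> (1/4) ^ L"
  proof -
    have "?e \<le> (1/2) ^ (2 * L)" using bi by (intro power_mono) auto
    also have "\<dots> = (1/4) ^ L" by (simp add: power_mult power2_eq_square)
    finally show ?thesis .
  qed
  have cardP: "real (card ?P) \<le> 4 ^ Suc j" by simp
  have p1: "p \<ge> 1" if "p \<in> ?P" for p using that by (auto intro: order_trans[OF one_le_power[of "4::nat" j]])
  have "prob (late x0 ?e (4 ^ j) (4 ^ Suc j)) \<le> surv (4 ^ j) (4 * L) + bi ^ (4 * L) / ?e" by (rule prob_late[OF x0 e0])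
  also have "bi ^ (4 * L) / ?e = ?e"
  proof -
    have "bi ^ (4 * L) = ?e * ?e" by (simp only: power_add[symmetric]) simp
    then show ?thesis using e0 by simp
  qed
  also have "surv (4 ^ j) (4 * L) \<le> 3 * real (4 * L) / 2 ^ j" by (rule surv_le)
  also have "?e \<le> 4 ^ j * (1/2) ^ L"
  proof -
    have "(1/4::real) ^ L \<le> (1/2) ^ L" by (intro power_mono) auto
    also have "\<dots> \<le> 4 ^ j * (1/2) ^ L" by simp
    finally show ?thesis using e1 by linarith
  qed
  finally have b1: "prob (late x0 ?e (4 ^ j) (4 ^ Suc j)) \<le> 12 * real L / 2 ^ j + 4 ^ j * (1/2) ^ L" by simp
  have "prob (\<Union>p\<in>?P. {\<omega>. \<omega> (SK p) \<in> {2 ^ L<..}}) \<le> (\<Sum>p\<in>?P. prob {\<omega>. \<omega> (SK p) \<in> {2 ^ L<..}})"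
    by (rule finite_measure_subadditive_finite) (auto intro!: sets_coord simp del: greaterThan_iff)
  also have "\<dots> \<le> (\<Sum>p\<in>?P. W / (real L * ln 2) powr s)"
  proof (rule sum_mono)
    fix p assume "p \<in> ?P"
    then have "prob {\<omega>. \<omega> (SK p) \<in> {2 ^ L<..}} = measure_pmf.prob klaw {2 ^ L<..}"
      using p1[of p] by (simp only: prob_cyl1 law_simps)
    also have "\<dots> \<le> W / ln (real (2 ^ L)) powr s"
      by (rule W(2)) (use L in \<open>metis one_le_numeral power_increasing power_one_right\<close>)
    also have "ln (real (2 ^ L)) = real L * ln 2" by (simp add: ln_realpow)
    finally show "prob {\<omega>. \<omega> (SK p) \<in> {2 ^ L<..}} \<le> W / (real L * ln 2) powr s" .
  qed
  also have "\<dots> = real (card ?P) * (W / (real L * ln 2) powr s)" by simp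
  also have "\<dots> \<le> 4 ^ Suc j * (W / (real L * ln 2) powr s)" using cardP W by (intro mult_right_mono) auto
  finally have b2: "prob (\<Union>p\<in>?P. {\<omega>. \<omega> (SK p) \<in> {2 ^ L<..}}) \<le> 4 ^ Suc j * (W / (real L * ln 2) powr s)" .
  have "prob (\<Union>p\<in>?P. \<Union>i\<in>{1..<2 ^ L}. \<Union>n. bush x0 ?e p i n) \<le> (\<Sum>p\<in>?P. prob (\<Union>i\<in>{1..<2 ^ L}. \<Union>n. bush x0 ?e p i n))"
    by (rule finite_measure_subadditive_finite) auto
  also have "\<dots> \<le> (\<Sum>p\<in>?P. 2 ^ L * (4 * ?e))"
  proof (rule sum_mono)
    fix p assume p: "p \<in> ?P"
    have "prob (\<Union>i\<in>{1..<2 ^ L}. \<Union>n. bush x0 ?e p i n) \<le> (\<Sum>i\<in>{1..<2 ^ L}. prob (\<Union>n. bush x0 ?e p i n))"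
      by (rule finite_measure_subadditive_finite) auto
    also have "\<dots> \<le> (\<Sum>i\<in>{1..<(2::nat) ^ L}. 4 * ?e)"
      by (rule sum_mono, rule prob_bush[OF x0 p1[OF p]]) (use e0 in auto)
    also have "\<dots> = real (card {1..<(2::nat) ^ L}) * (4 * ?e)" by simp
    also have "\<dots> \<le> 2 ^ L * (4 * ?e)" using e0 by (intro mult_right_mono) (auto simp: of_nat_diff)
    finally show "prob (\<Union>i\<in>{1..<2 ^ L}. \<Union>n. bush x0 ?e p i n) \<le> 2 ^ L * (4 * ?e)" .
  qed
  also have "\<dots> = real (card ?P) * (2 ^ L * (4 * ?e))" by simp
  also have "\<dots> \<le> 4 ^ Suc j * (2 ^ L * (4 * (1/4) ^ L))"
    using cardP e1 e0 by (intro mult_mono mult_left_mono) auto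
  also have "\<dots> = 16 * 4 ^ j * (1/2) ^ L"
  proof -
    have "(2::real) ^ L * (1/4) ^ L = (1/2) ^ L" by (simp flip: power_mult_distrib)
    then show ?thesis by (simp only: power_Suc) (simp add: mult.left_commute[of "2 ^ L"])
  qed
  finally have b3: "prob (\<Union>p\<in>?P. \<Union>i\<in>{1..<2 ^ L}. \<Union>n. bush x0 ?e p i n) \<le> 16 * 4 ^ j * (1/2) ^ L" .
  have "prob (bad x0 L j) \<le> prob (late x0 ?e (4 ^ j) (4 ^ Suc j) \<union> (\<Union>p\<in>?P. {\<omega>. \<omega> (SK p) \<in> {2 ^ L<..}})) +
     prob (\<Union>p\<in>?P. \<Union>i\<in>{1..<2 ^ L}. \<Union>n. bush x0 ?e p i n)"
    unfolding bad_def by (rule measure_Un_le) (intro sets.Un sets_late sets_coord sets.countable_UN' sets_bush, auto)+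
  also have "prob (late x0 ?e (4 ^ j) (4 ^ Suc j) \<union> (\<Union>p\<in>?P. {\<omega>. \<omega> (SK p) \<in> {2 ^ L<..}})) \<le>
     prob (late x0 ?e (4 ^ j) (4 ^ Suc j)) + prob (\<Union>p\<in>?P. {\<omega>. \<omega> (SK p) \<in> {2 ^ L<..}})"
    by (rule measure_Un_le) (intro sets_late sets_coord sets.countable_UN', auto)+
  finally show ?thesis using b1 b2 b3 by linarith
qed

text \<open>With L j about a^j, the first term requires a < 2 and the second a^s > 4. Such an
  \<open>a\<close> exists because s > 2; \<theta>, its logarithm to base 2, is the midpoint of 2/s
  and 1. As a > 1, the last term is then no constraint.\<close>

lemma summable_bound:
  assumes s: "s > 2" and W: "W \<ge> 0"
  shows "\<exists>L :: nat \<Rightarrow> nat. (\<forall>j. L j \<ge> 1) \<and> summable (\<lambda>j. 12 * real (L j) / 2 ^ j + 4 ^ Suc j * (W / (real (L j) * ln 2) powr s) + 17 * 4 ^ j * (1/2) ^ L j)"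
proof -
  define \<theta> where "\<theta> = (2 / s + 1) / 2"
  define a :: real where "a = 2 powr \<theta>"
  have th: "2 / s < \<theta>" "\<theta> < 1" "0 < \<theta>" using s by (auto simp: \<theta>_def field_simps)
  have a1: "1 < a" "a < 2" using th powr_less_mono[of 0 \<theta> 2] powr_less_mono[of \<theta> 1 2] by (auto simp: a_def)
  have as: "4 < a powr s"
  proof -
    have "2 < \<theta> * s" using th s by (simp add: field_simps)
    then have "2 powr 2 < 2 powr (\<theta> * s)" by (intro powr_less_mono) auto
    then show ?thesis by (simp add: a_def powr_powr)
  qed
  txt \<open>The first and second terms are geometric of ratios \<open>a / 2\<close> and \<open>4 / a powr s\<close>.\<close>
  define L where "L j = nat \<lceil>a ^ j\<rceil>" for j
  have aj: "1 \<le> a ^ j" for j using a1 by simp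
  have L1: "a ^ j \<le> real (L j)" for j unfolding L_def using aj[of j] by linarith
  have L2: "real (L j) \<le> 2 * a ^ j" for j unfolding L_def using aj[of j] by linarith
  have L3: "L j \<ge> 1" for j using L1[of j] aj[of j] by linarith
  have s1: "summable (\<lambda>j. 12 * real (L j) / 2 ^ j)"
  proof (rule summable_comparison_test'[where N=0])
    show "summable (\<lambda>j. 24 * (a / 2) ^ j)" using a1 by (intro summable_mult summable_geometric) auto
    show "norm (12 * real (L j) / 2 ^ j) \<le> 24 * (a / 2) ^ j" for j
      using L2[of j] by (simp add: power_divide divide_right_mono)
  qed
  have s2: "summable (\<lambda>j. 4 ^ Suc j * (W / (real (L j) * ln 2) powr s))"
  proof (rule summable_comparison_test'[where N=0])
    show "summable (\<lambda>j. (4 * W / ln 2 powr s) * (4 / a powr s) ^ j)"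
    proof (intro summable_mult summable_geometric)
      have "a powr s > 0" using as by linarith
      then show "norm (4 / a powr s) < 1" using as by simp
    qed
    show "norm (4 ^ Suc j * (W / (real (L j) * ln 2) powr s)) \<le> (4 * W / ln 2 powr s) * (4 / a powr s) ^ j" for j
    proof -
      have pos: "0 < (a powr s) ^ j * ln 2 powr s" using a1 by simp
      have "(a powr s) ^ j * ln 2 powr s = (a ^ j * ln 2) powr s"
        using a1 by (simp add: powr_mult powr_power powr_realpow[symmetric] powr_powr mult.commute)
      also have "\<dots> \<le> (real (L j) * ln 2) powr s" using L1[of j] a1 s by (intro powr_mono2 mult_right_mono) auto
      finally have "W / (real (L j) * ln 2) powr s \<le> W / ((a powr s) ^ j * ln 2 powr s)"
        by (rule frac_le[OF W order_refl pos])
      then have "4 ^ Suc j * (W / (real (L j) * ln 2) powr s) \<le> 4 ^ Suc j * (W / ((a powr s) ^ j * ln 2 powr s))"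
        by (intro mult_left_mono) auto
      then show ?thesis using W by (simp add: power_divide mult_ac)
    qed
  qed
  have s3: "summable (\<lambda>j. 17 * (4 ^ j * (1/2) ^ L j) :: real)"
  proof (rule summable_mult)
    \<comment> \<open>Once L j >= 3 j, the term is at most 4^j 8^(-j) = 2^(-j).\<close>
    have "(\<lambda>j. real j / a ^ j) \<longlonglongrightarrow> 0" using lim_n_over_pown[of a] a1 by simp
    then have "eventually (\<lambda>j. real j / a ^ j < 1/3) sequentially" by (rule order_tendstoD) simp
    then obtain N where N: "\<And>j. j \<ge> N \<Longrightarrow> real j / a ^ j < 1/3" by (auto simp: eventually_sequentially)
    show "summable (\<lambda>j. 4 ^ j * (1/2) ^ L j :: real)"
    proof (rule summable_comparison_test'[where N=N])
      show "summable (\<lambda>j. (1/2) ^ j :: real)" by (intro summable_geometric) auto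
      fix j assume "j \<ge> N"
      then have "3 * real j < a ^ j" using N[of j] aj[of j] by (simp add: field_simps)
      then have "3 * j \<le> L j" using L1[of j] by linarith
      then have "(1/2::real) ^ L j \<le> (1/2) ^ (3 * j)" by (intro power_decreasing) auto
      then have "4 ^ j * (1/2::real) ^ L j \<le> 4 ^ j * (1/2) ^ (3 * j)" by (intro mult_left_mono) auto
      also have "\<dots> = (1/2) ^ j" by (simp add: power_mult power3_eq_cube flip: power_mult_distrib)
      finally show "norm (4 ^ j * (1/2) ^ L j :: real) \<le> (1/2) ^ j" by simp
    qed
  qed
  show ?thesis using summable_add[OF summable_add[OF s1 s2] s3] L3 by (intro exI[of _ L]) (simp add: mult.assoc)
qed

text \<open>On \<open>A\<close> the root is childless and the first ancestors have a single child,
  so no forward vertex other than the root lies on a level below 4^j0. With probability at least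
  1/2, and independently of \<open>A\<close>, none of the later blocks is bad; on both events the
  label of the root does not recur.\<close>

lemma critical_positive:
  assumes m0: "pmf \<mu> 0 > 0" and m2: "measure_pmf.prob \<mu> {2..} > 0"
    and s: "s > 2" and sm: "summable (\<lambda>k. real k * ln (real k) powr s * pmf \<mu> k)"
  shows "cc > 0"
proof -
  obtain W where W: "W \<ge> 0" "\<And>y. y \<ge> 2 \<Longrightarrow> measure_pmf.prob klaw {y<..} \<le> W / ln (real y) powr s"
    using klaw_log_tail[OF _ sm] s by auto
  obtain L where L: "\<And>j. L j \<ge> 1" and
    smT: "summable (\<lambda>j. 12 * real (L j) / 2 ^ j + 4 ^ Suc j * (W / (real (L j) * ln 2) powr s) + 17 * 4 ^ j * (1/2) ^ L j)"
    using summable_bound[OF s W(1)] by auto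
  define T where "T j = 12 * real (L j) / 2 ^ j + 4 ^ Suc j * (W / (real (L j) * ln 2) powr s) + 17 * 4 ^ j * (1/2) ^ L j" for j
  have smT: "summable T" using smT unfolding T_def[abs_def] .
  obtain j0 where j0: "norm (\<Sum>i. T (i + j0)) < 1/2"
    using suminf_exist_split[OF _ smT, of "1/2"] by auto
  have smT0: "summable (\<lambda>i. T (i + j0))" using smT by (rule summable_ignore_initial_segment)
  define JA where "JA = insert (SXi (0, [])) (SK ` {1..<4 ^ j0})"
  define t :: "src \<Rightarrow> nat" where "t = (\<lambda>s. case s of SK _ \<Rightarrow> 1 | _ \<Rightarrow> 0)"
  define A where "A = {\<omega>. \<forall>s\<in>JA. \<omega> s = t s}"
  have fJ: "finite JA" by (simp add: JA_def)
  have A [measurable]: "A \<in> sets Pr" unfolding A_def using sets_Collect_fin[OF fJ, of "\<lambda>s. {t s}"] by simp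
  have "prob A = (\<Prod>s\<in>JA. pmf (law s) (t s))" unfolding A_def by (rule prob_cyl_eq[OF fJ])
  also have "\<dots> > 0"
  proof (rule prod_pos)
    fix s assume "s \<in> JA"
    moreover have "pmf klaw 1 > 0"
    proof -
      have "measure_pmf.prob \<mu> {2..} \<le> measure_pmf.prob \<mu> {1..}" by (rule measure_pmf.finite_measure_mono) auto
      then show ?thesis using m2 by (simp add: klaw)
    qed
    ultimately show "0 < pmf (law s) (t s)" using m0 by (auto simp: JA_def t_def)
  qed
  finally have pA: "prob A > 0" .
  show ?thesis
  proof (rule new_inf_pos[where d="prob A / 2"])
    fix x0 :: wstar assume x0: "fst x0 = 0"
    define B where "B = (\<Union>i. bad x0 (L (i + j0)) (i + j0))"
    have [measurable]: "B \<in> sets Pr" unfolding B_def by measurable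
    have pb: "prob (bad x0 (L (i + j0)) (i + j0)) \<le> T (i + j0)" for i
      unfolding T_def by (rule prob_bad[OF x0 W L])
    have smb: "summable (\<lambda>i. prob (bad x0 (L (i + j0)) (i + j0)))"
      by (rule summable_comparison_test'[OF smT0]) (use pb in auto)
    have "prob B \<le> (\<Sum>i. prob (bad x0 (L (i + j0)) (i + j0)))"
      unfolding B_def by (rule finite_measure_subadditive_countably[OF _ smb]) auto
    also have "\<dots> \<le> (\<Sum>i. T (i + j0))" by (rule suminf_le[OF pb smb smT0])
    finally have pB: "prob B \<le> 1/2" using j0 by simp
    \<comment> \<open>The bad events from block \<open>j0\<close> on read moves, offspring numbers
      inside bushes, and \<open>SK p\<close> with p >= 4^j0, none of which is in
      \<open>JA\<close>.\<close>
    have dB: "dep_on (- JA) (UNIV - B)"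
      unfolding dep_on_def
    proof (intro allI impI)
      fix \<omega> \<omega>' :: "src \<Rightarrow> nat" assume eq: "\<forall>j\<in>- JA. \<omega> j = \<omega>' j"
      have Z: "\<omega> (SZ a) = \<omega>' (SZ a)" for a using eq by (auto simp: JA_def)
      have X: "\<omega> (SXi (p, i # u)) = \<omega>' (SXi (p, i # u))" for p i u using eq by (auto simp: JA_def)
      have K: "\<omega> (SK p) = \<omega>' (SK p)" if "p \<in> {4 ^ (i + j0)..<4 ^ Suc (i + j0)}" for p i
      proof -
        have "(4::nat) ^ j0 \<le> 4 ^ (i + j0)" by (intro power_increasing) auto
        moreover have "4 ^ (i + j0) \<le> p" using that by simp
        ultimately have "4 ^ j0 \<le> p" by (rule order_trans)
        then show ?thesis using eq by (auto simp: JA_def)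
      qed
      have "\<omega> \<in> bad x0 (L (i + j0)) (i + j0) \<longleftrightarrow> \<omega>' \<in> bad x0 (L (i + j0)) (i + j0)" for i
        unfolding bad_def Un_iff UN_iff late_iff bush_iff Z X mem_Collect_eq by (simp only: K[of _ i] cong: bex_cong)
      then show "\<omega> \<in> UNIV - B \<longleftrightarrow> \<omega>' \<in> UNIV - B" by (simp add: B_def)
    qed
    have cB [measurable]: "UNIV - B \<in> sets Pr" using sets.compl_sets[of B Pr] by simp
    have dA: "dep_on JA A" by (simp add: dep_on_def A_def)
    have "prob (A \<inter> (UNIV - B)) = prob A * prob (UNIV - B)"
      by (rule prob_Int_dep[OF A cB dA dB]) auto
    also have "prob (UNIV - B) = 1 - prob B" using prob_compl[of B] by simp
    also have "prob A * (1 - prob B) \<ge> prob A * (1/2)" using pB pA by (intro mult_left_mono) auto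
    finally have ge: "prob A / 2 \<le> prob (A \<inter> (UNIV - B))" by simp
    have ae: "AE \<omega>' in Pr. \<omega>' \<in> A \<inter> (UNIV - B) \<longrightarrow> (\<forall>\<omega>''. (\<forall>s. s \<notin> range SU \<longrightarrow> \<omega>'' s = \<omega>' s) \<longrightarrow> tO \<omega>'' = x0 \<longrightarrow> (\<forall>j\<ge>1. Y \<omega>'' j \<noteq> Y \<omega>'' 0))"
      using AE_good
    proof eventually_elim
      case (elim \<omega>')
      show ?case
      proof (intro impI allI)
        fix \<omega>'' and j :: nat
        assume AB: "\<omega>' \<in> A \<inter> (UNIV - B)" and eq: "\<forall>s. s \<notin> range SU \<longrightarrow> \<omega>'' s = \<omega>' s" and o: "tO \<omega>'' = x0" and j: "1 \<le> j"
        note V = tF_cong_SU[OF eq]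
        have W'': "wellenum (tF \<omega>'')" using elim unfolding V(1) by simp
        define v where "v = fenum (tF \<omega>'') j"
        have v: "v \<in> tF \<omega>''" "rank (tF \<omega>'') v = j" using fenum_props[OF W'', of j] by (auto simp: v_def)
        have vr: "v \<noteq> root"
        proof
          assume "v = root"
          then have "{u \<in> tF \<omega>''. addr_less u v} = {}"
            using addr_less_root[OF fwd_canon] addr_less_asym fwd_irrefl by blast
          then show False using v(2) j by (simp only: rank_def card.empty)
        qed
        have vV: "v \<in> tV \<omega>'" "fwd v" using v(1) V(1) by auto
        have A0: "\<omega>' (SXi (0, [])) = 0" using AB by (auto simp: A_def JA_def t_def)
        have A1: "\<omega>' (SK p) = 1" if "1 \<le> p" "p < 4 ^ j0" for p using AB that by (auto simp: A_def JA_def t_def)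
        from fwd_canon[OF vV(2)] have "tX \<omega>'' v \<noteq> x0"
        proof (cases rule: rev_cases_addr[case_names own anc bush, consumes 1])
          case (own w)
          then show ?thesis using vr vV A0 by (cases w) (auto simp: root_def tV_simps)
        next
          case (anc q) then show ?thesis using vV by auto
        next
          case (bush q i w)
          define p where "p = Suc q"
          have vp: "v = (p, i # w)" using bush by (simp add: p_def)
          have i: "1 \<le> i" "i < \<omega>' (SK p)" and w: "w \<in> gw_set (\<lambda>u. \<omega>' (SXi (p, i # u)))"
            using vV bush by (auto simp: tV_simps p_def)
          have "4 ^ j0 \<le> p" using A1[of p] i by (cases "p < 4 ^ j0") (auto simp: p_def)
          \<comment> \<open>The block of the ancestor to whose bush \<open>v\<close>
            belongs.\<close>
          obtain jj where jj: "4 ^ jj \<le> p" "p < 4 ^ (jj + 1)"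
            using ex_power_ivl1[of 4 p] by (auto simp: p_def)
          have "(4::nat) ^ j0 < 4 ^ (jj + 1)" using \<open>4 ^ j0 \<le> p\<close> jj by linarith
          then have "j0 \<le> jj" using power_less_imp_less_exp[of "4::nat" j0 "jj + 1"] by simp
          then obtain k where k: "jj = k + j0" by (metis add.commute le_Suc_ex)
          have nb: "\<omega>' \<notin> bad x0 (L jj) jj" using AB unfolding B_def k by blast
          have pP: "p \<in> {4 ^ jj..<4 ^ Suc jj}" using jj by simp
          have K: "\<omega>' (SK p) \<le> 2 ^ L jj" using nb pP unfolding bad_def by (auto simp: not_less)
          have P: "pot bi x0 (anc_lab (\<lambda>a. \<omega>' (SZ a)) x0 p) \<le> bi ^ (2 * L jj)"
          proof (rule ccontr)
            assume "\<not> ?thesis"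
            then have "\<omega>' \<in> late x0 (bi ^ (2 * L jj)) (4 ^ jj) (4 ^ Suc jj)"
              unfolding late_iff using pP by (intro exI[of _ p]) auto
            then show False using nb unfolding bad_def by blast
          qed
          have "tX \<omega>'' v = walk (\<lambda>a. \<omega>' (SZ a)) p [] (anc_lab (\<lambda>a. \<omega>' (SZ a)) x0 p) (i # w)"
            unfolding vp tX_eq V(2) o ..
          moreover have "walk (\<lambda>a. \<omega>' (SZ a)) p [] (anc_lab (\<lambda>a. \<omega>' (SZ a)) x0 p) (i # w) \<noteq> x0"
          proof
            assume "walk (\<lambda>a. \<omega>' (SZ a)) p [] (anc_lab (\<lambda>a. \<omega>' (SZ a)) x0 p) (i # w) = x0"
            then have "\<omega>' \<in> bush x0 (bi ^ (2 * L jj)) p i (length w)" unfolding bush_iff using P w by blast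
            moreover have "i \<in> {1..<2 ^ L jj}" using i K by auto
            ultimately show False using nb pP unfolding bad_def by blast
          qed
          ultimately show ?thesis by simp
        qed
        then show "Y \<omega>'' j \<noteq> Y \<omega>'' 0" using Y_0[OF W''] o by (simp add: Y_def v_def)
      qed
    qed
    show "\<exists>B\<in>sets Pr. prob B \<ge> prob A / 2 \<and>
      (AE \<omega>' in Pr. \<omega>' \<in> B \<longrightarrow> (\<forall>\<omega>''. (\<forall>s. s \<notin> range SU \<longrightarrow> \<omega>'' s = \<omega>' s) \<longrightarrow> tO \<omega>'' = x0 \<longrightarrow> (\<forall>j\<ge>1. Y \<omega>'' j \<noteq> Y \<omega>'' 0)))"
    proof (rule bexI[of _ "A \<inter> (UNIV - B)"])
      show "A \<inter> (UNIV - B) \<in> sets Pr" by (rule sets.Int[OF A cB])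
    qed (use ge ae in blast)
  qed (use pA in simp)
qed

end

theorem theorem3p20:
  fixes M :: "'a measure" and b :: nat and \<mu> :: "nat pmf" and S :: "src \<Rightarrow> 'a \<Rightarrow> nat"
  assumes "prob_space M"
    and "b \<ge> 2"
    and "((\<lambda>k. real k * pmf \<mu> k) has_sum 1) UNIV"
    and "prob_space.indep_vars M (\<lambda>_. count_space UNIV) S UNIV"
    and "\<forall>p k. measure M {\<omega> \<in> space M. S (SK p) \<omega> = k} =
               (if 1 \<le> k then measure_pmf.prob \<mu> {k..} else 0)"
    and "\<forall>a k. measure M {\<omega> \<in> space M. S (SXi a) \<omega> = k} = pmf \<mu> k"
    and "\<forall>j k. measure M {\<omega> \<in> space M. S (SU j) \<omega> = k} =
               (if 1 \<le> k \<and> k \<le> b then 1 / real b else 0)"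
    and "\<forall>a k. measure M {\<omega> \<in> space M. S (SZ a) \<omega> = k} =
               (if k = 0 then 1 / 2 else if k \<le> b then 1 / (2 * real b) else 0)"
  shows "distr M TM (\<lambda>\<omega>. scc (theta S \<omega>)) = distr M TM (theta S)
    \<and> (let c = measure M {\<omega> \<in> space M. \<forall>n\<ge>1. src_X S \<omega> (src_enum S \<omega> n) \<noteq> src_o S \<omega>} in
        (AE \<omega> in M. (\<lambda>n. real (card ((\<lambda>k. src_X S \<omega> (src_enum S \<omega> k)) ` {1..n})) / real n)
                      \<longlonglongrightarrow> c)
      \<and> ((\<exists>\<beta>::real. \<beta> > 1 \<and>
            summable (\<lambda>k. real k * ln (real k) powr (1 + \<beta>) * pmf \<mu> k)) \<longrightarrow> c > 0))"
  proof -
  interpret prob_space M by fact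
  define f where "f k = (if 1 \<le> k then measure_pmf.prob \<mu> {k..} else 0)" for k
  have S [measurable]: "S s \<in> M \<rightarrow>\<^sub>M count_space UNIV" for s
    using assms(4) unfolding indep_vars_def by auto
  have f_eq: "f k = prob {\<omega> \<in> space M. S (SK 1) \<omega> = k}" for k
    using assms(5) by (simp add: f_def)
  \<comment> \<open>The tails of \<mu> are the point probabilities of the random variable
    \<open>S (SK 1)\<close>, so they have total mass one and define a law.\<close>
  have f1: "(\<integral>\<^sup>+k. ennreal (f k) \<partial>count_space UNIV) = 1"
  proof -
    let ?D = "distr M (count_space UNIV) (S (SK 1))"
    interpret D: prob_space ?D by (rule prob_space_distr) (rule S)
    have "emeasure ?D {k} = ennreal (f k)" for k
      unfolding f_eq emeasure_eq_measure[symmetric]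
      by (subst emeasure_distr) (auto intro!: arg_cong[where f="emeasure M"])
    then have "(\<integral>\<^sup>+k. ennreal (f k) \<partial>count_space UNIV) = emeasure ?D UNIV"
      by (subst emeasure_countable_singleton) auto
    then show ?thesis using D.emeasure_space_1 by simp
  qed
  define klaw where "klaw = embed_pmf f"
  have klaw: "pmf klaw k = f k" for k
    unfolding klaw_def by (rule pmf_embed_pmf) (use f1 in \<open>auto simp: f_def\<close>)
  interpret B: brw_law b \<mu> klaw
    by unfold_locales (use assms(2,3) klaw f_def in auto)
  \<comment> \<open>Resetting the sources outside \<open>used\<close> to 0 matches their point
    masses in \<open>B.law\<close> and leaves the labelled tree unchanged.\<close>
  define \<Phi> where "\<Phi> \<omega> = (\<lambda>s. if s \<in> used then S s \<omega> else 0)" for \<omega>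
  have \<Phi> [measurable]: "\<Phi> \<in> M \<rightarrow>\<^sub>M B.Pr"
    by (rule B.measurable_into_Pr) (auto simp: \<Phi>_def)
  have law: "prob {\<omega> \<in> space M. S s \<omega> = k} = pmf (B.law s) k" if "s \<in> used" for s k
    using that assms(5-8) by (cases s) (auto simp: B.pmf_ulaw B.pmf_zlaw klaw f_def)
  have \<Phi>law: "distr M B.Pr \<Phi> = B.Pr"
  proof (rule B.Pr_eqI)
    show "prob_space (distr M B.Pr \<Phi>)" by (rule prob_space_distr) measurable
    fix J :: "src set" assume J: "finite J"
    have "measure (distr M B.Pr \<Phi>) {\<omega>. \<forall>j\<in>J. \<omega> j = s j} = (\<Prod>j\<in>J. pmf (B.law j) (s j))" for s
    proof -
      have "{\<omega>. \<forall>j\<in>J. \<omega> j = s j} \<in> sets B.Pr" using B.sets_Collect_fin[OF J, of "\<lambda>j. {s j}"] by simp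
      then have eq: "measure (distr M B.Pr \<Phi>) {\<omega>. \<forall>j\<in>J. \<omega> j = s j} = prob {\<omega> \<in> space M. \<forall>j\<in>J. \<Phi> \<omega> j = s j}"
        by (subst measure_distr) (auto intro!: arg_cong[where f=prob])
      show ?thesis
      proof (cases "\<exists>j\<in>J - used. s j \<noteq> 0")
        case True
        then have "{\<omega> \<in> space M. \<forall>j\<in>J. \<Phi> \<omega> j = s j} = {}" by (auto simp: \<Phi>_def)
        moreover have "(\<Prod>j\<in>J. pmf (B.law j) (s j)) = 0" using True J by (intro prod_zero) (auto intro!: bexI)
        ultimately show ?thesis using eq by (simp only: measure_empty)
      next
        case False
        then have 1: "{\<omega> \<in> space M. \<forall>j\<in>J. \<Phi> \<omega> j = s j} = {\<omega> \<in> space M. \<forall>j\<in>J \<inter> used. S j \<omega> = s j}"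
          by (auto simp: \<Phi>_def)
        have 2: "prob {\<omega> \<in> space M. \<forall>j\<in>J \<inter> used. S j \<omega> = s j} = (\<Prod>j\<in>J \<inter> used. pmf (B.law j) (s j))"
        proof (cases "J \<inter> used = {}")
          case True then show ?thesis using prob_space by simp
        next
          case ne: False
          have "{\<omega> \<in> space M. \<forall>j\<in>J \<inter> used. S j \<omega> = s j} = (\<Inter>j\<in>J \<inter> used. S j -` {s j} \<inter> space M)"
            using ne by auto
          also have "prob \<dots> = (\<Prod>j\<in>J \<inter> used. prob (S j -` {s j} \<inter> space M))"
            by (rule indep_varsD[OF assms(4)]) (use J ne in auto)
          also have "\<dots> = (\<Prod>j\<in>J \<inter> used. pmf (B.law j) (s j))"
            by (rule prod.cong) (auto simp: law[symmetric] intro!: arg_cong[where f=prob])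
          finally show ?thesis .
        qed
        have 3: "(\<Prod>j\<in>J \<inter> used. pmf (B.law j) (s j)) = (\<Prod>j\<in>J. pmf (B.law j) (s j))"
          using J False by (intro prod.mono_neutral_left) auto
        show ?thesis unfolding eq 1 2 3 ..
      qed
    qed
    then show "\<exists>J'. J \<subseteq> J' \<and> finite J' \<and> (\<forall>s. measure (distr M B.Pr \<Phi>) {\<omega>. \<forall>j\<in>J'. \<omega> j = s j} = (\<Prod>j\<in>J'. pmf (B.law j) (s j)))"
      using J by blast
  qed simp
  have transfer: "AE \<omega> in M. Q (\<Phi> \<omega>)" if "AE \<omega> in B.Pr. Q \<omega>" for Q
    by (rule AE_distrD[OF \<Phi>]) (subst \<Phi>law, rule that)
  have used_eq: "\<And>s. s \<in> used \<Longrightarrow> (\<lambda>s. S s \<omega>) s = \<Phi> \<omega> s" for \<omega> by (simp add: \<Phi>_def)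
  have thetaS: "theta S \<omega> = theta (\<lambda>s \<omega>. \<omega> s) (\<Phi> \<omega>)" for \<omega>
  proof -
    have "theta S \<omega> = theta (\<lambda>s \<omega>. \<omega> s) (\<lambda>s. S s \<omega>)" by (simp add: theta_def src_V_def src_X_def src_o_def)
    also have "\<dots> = theta (\<lambda>s \<omega>. \<omega> s) (\<Phi> \<omega>)" by (rule theta_cong_used) (rule used_eq)
    finally show ?thesis .
  qed
  have VS: "src_V S \<omega> = src_V (\<lambda>s \<omega>. \<omega> s) (\<Phi> \<omega>)" for \<omega>
  proof -
    have "src_V S \<omega> = src_V (\<lambda>s \<omega>. \<omega> s) (\<lambda>s. S s \<omega>)" by (simp add: src_V_def)
    also have "\<dots> = src_V (\<lambda>s \<omega>. \<omega> s) (\<Phi> \<omega>)" by (rule tV_cong_used) (rule used_eq)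
    finally show ?thesis .
  qed
  have XS: "src_X S \<omega> a = src_X (\<lambda>s \<omega>. \<omega> s) (\<Phi> \<omega>) a" if "canon a" for \<omega> a
  proof -
    have "src_X S \<omega> a = src_X (\<lambda>s \<omega>. \<omega> s) (\<lambda>s. S s \<omega>) a" by (simp add: src_X_def src_o_def)
    also have "\<dots> = src_X (\<lambda>s \<omega>. \<omega> s) (\<Phi> \<omega>) a" by (rule tX_cong_used[OF used_eq that])
    finally show ?thesis .
  qed
  have oS: "src_o S \<omega> = src_o (\<lambda>s \<omega>. \<omega> s) (\<Phi> \<omega>)" for \<omega> by (simp add: src_o_def \<Phi>_def)
  have enS: "src_enum S \<omega> n = fenum (tF (\<Phi> \<omega>)) n" for \<omega> n
    unfolding src_enum_eq[symmetric] src_enum_def VS ..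
  have YS: "src_X S \<omega> (src_enum S \<omega> n) = Y (\<Phi> \<omega>) n" if "wellenum (tF (\<Phi> \<omega>))" for \<omega> n
  proof -
    have "canon (fenum (tF (\<Phi> \<omega>)) n)" using fenum_props[OF that, of n] fwd_canon by blast
    then show ?thesis by (simp add: enS XS Y_def)
  qed
  interpret R: src_meas M S by unfold_locales (rule S)
  interpret P: src_meas B.Pr "\<lambda>s \<omega>. \<omega> s" by (rule B.src_meas_Pr)
  have scc_AE: "AE \<omega> in B.Pr. scc (theta (\<lambda>s \<omega>. \<omega> s) \<omega>) = theta (\<lambda>s \<omega>. \<omega> s) (Succ \<omega>)"
    using B.AE_good by eventually_elim (use rerooted_scc in blast)
  have "distr M TM (\<lambda>\<omega>. scc (theta S \<omega>)) = distr (distr M B.Pr \<Phi>) TM (\<lambda>\<omega>. scc (theta (\<lambda>s \<omega>. \<omega> s) \<omega>))"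
    unfolding thetaS by (subst distr_distr) (auto simp: comp_def)
  also have "\<dots> = distr B.Pr TM (\<lambda>\<omega>. theta (\<lambda>s \<omega>. \<omega> s) (Succ \<omega>))"
    unfolding \<Phi>law by (rule distr_cong_AE) (use scc_AE in auto)
  also have "\<dots> = distr (distr B.Pr B.Pr Succ) TM (theta (\<lambda>s \<omega>. \<omega> s))"
    by (subst distr_distr) (auto simp: comp_def)
  also have "\<dots> = distr (distr M B.Pr \<Phi>) TM (theta (\<lambda>s \<omega>. \<omega> s))"
    unfolding B.distr_Succ \<Phi>law ..
  also have "\<dots> = distr M TM (theta S)"
    by (subst distr_distr) (auto simp: comp_def thetaS[abs_def])
  finally have part1: "distr M TM (\<lambda>\<omega>. scc (theta S \<omega>)) = distr M TM (theta S)" .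
  have good: "AE \<omega> in M. wellenum (tF (\<Phi> \<omega>))"
    by (rule transfer) (use B.AE_good in eventually_elim, auto)
  have c: "measure M {\<omega> \<in> space M. \<forall>n\<ge>1. src_X S \<omega> (src_enum S \<omega> n) \<noteq> src_o S \<omega>} = B.cc"
  proof -
    have N [measurable]: "{\<omega>. \<forall>j\<ge>1. Y \<omega> j \<noteq> Y \<omega> 0} \<in> sets B.Pr" by measurable
    have "B.cc = measure (distr M B.Pr \<Phi>) {\<omega>. \<forall>j\<ge>1. Y \<omega> j \<noteq> Y \<omega> 0}" unfolding \<Phi>law B.cc_eq ..
    also have "\<dots> = prob (\<Phi> -` {\<omega>. \<forall>j\<ge>1. Y \<omega> j \<noteq> Y \<omega> 0} \<inter> space M)" by (rule measure_distr[OF \<Phi> N])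
    also have "\<dots> = prob {\<omega> \<in> space M. \<forall>n\<ge>1. src_X S \<omega> (src_enum S \<omega> n) \<noteq> src_o S \<omega>}"
    proof (rule finite_measure_eq_AE)
      show "AE \<omega> in M. \<omega> \<in> \<Phi> -` {\<omega>. \<forall>j\<ge>1. Y \<omega> j \<noteq> Y \<omega> 0} \<inter> space M \<longleftrightarrow>
          \<omega> \<in> {\<omega> \<in> space M. \<forall>n\<ge>1. src_X S \<omega> (src_enum S \<omega> n) \<noteq> src_o S \<omega>}"
        using good by eventually_elim (auto simp: YS B.Y_0 oS)
      show "\<Phi> -` {\<omega>. \<forall>j\<ge>1. Y \<omega> j \<noteq> Y \<omega> 0} \<inter> space M \<in> events" by (rule measurable_sets[OF \<Phi> N])
      show "{\<omega> \<in> space M. \<forall>n\<ge>1. src_X S \<omega> (src_enum S \<omega> n) \<noteq> src_o S \<omega>} \<in> events"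
        by (rule predE[OF R.pred_no_return])
    qed
    finally show ?thesis by simp
  qed
  have part2: "AE \<omega> in M. (\<lambda>n. real (card ((\<lambda>k. src_X S \<omega> (src_enum S \<omega> k)) ` {1..n})) / real n) \<longlonglongrightarrow> B.cc"
    using transfer[OF B.range_limit] good by eventually_elim (simp add: YS)
  have part3: "B.cc > 0" if "\<beta> > 1" "summable (\<lambda>k. real k * ln (real k) powr (1 + \<beta>) * pmf \<mu> k)" for \<beta> :: real
  proof (cases rule: B.offspring_cases)
    case 1 then show ?thesis using B.critical_positive[of "1 + \<beta>"] that by simp
  next
    case 2 then show ?thesis using B.line_positive by simp
  qed
  show ?thesis unfolding Let_def c using part1 part2 part3 by blast
qed

end
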